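(* Let $\mu_0$ be a Borel probability measure on $\mathbb R$ satisfying Assumption A and Assumption B (with data $x^*, c_0, k, h$). Let $0<\tau<\tau_{\mathrm{crit}}$ and put $c_\tau := \frac{\tau_{\mathrm{crit}}}{\tau_{\mathrm{crit}}-\tau}\,c_0$. Then $\mu_\tau=\mu_0\boxplus\lambda_\tau$ has a density $\psi_\tau$, and with $$x^*_\tau = x^*+\tau\int\frac{d\mu_0(s)}{x^*-s}$$ the following hold. (a) Under Assumption B(a), $x^*_\tau$ is an interior point of the support of $\mu_\tau$ and $$\psi_\tau(s)=c_\tau^{2k+1}(s-x^*_\tau)^{2k}\bigl(1+O(s-x^*_\tau)\bigr),\qquad s\to x^*_\tau.$$ (b) Under Assumption B(b), $x^*_\tau$ is a right endpoint of the support of $\mu_\tau$, and for some $\epsilon>0$, $$\psi_\tau(s)=c_\tau^{2k+3/2}(x^*_\tau-s)^{2k+1/2}\bigl(1+O((x^*_\tau-s)^{1/2})\bigr)\ \text{ as } s\to (x^*_\tau)_-,\qquad \psi_\tau(s)=0\ \text{ for } s\in[x^*_\tau,x^*_\tau+\epsilon].$$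
   Context: Assumption A: $\mu_0$ has compact support and a continuous density $\psi_0$. Assumption B: there exist $x^*\in\operatorname{supp}(\mu_0)$, $c_0>0$, an integer $k\ge1$, and a function $h$ defined on $\operatorname{supp}(\mu_0)$ which is real analytic in a neighbourhood of $x^*$ with $h(x^* )=1$, such that either (a) $x^*$ is an interior point of $\operatorname{supp}(\mu_0)$ and $\psi_0(s)=c_0^{2k+1}(s-x^* )^{2k}h(s)$ for $s\in\operatorname{supp}(\mu_0)$ ("singular interior point with exponent $2k$"), or (b) there is $\epsilon>0$ with $\psi_0(s)=c_0^{2k+3/2}(x^*-s)^{2k+1/2}h(s)$ for $s\in[x^*-\epsilon,x^*]$ and $\psi_0(s)=0$ for $s\in[x^*,x^*+\epsilon]$ ("singular right edge point with exponent $2k+1/2$"). For $\tau>0$, $\lambda_\tau$ is the semicircle law $d\lambda_\tau(s)=\frac{1}{2\pi\tau}\sqrt{4\tau-s^2}\,ds$ on $[-2\sqrt\tau,2\sqrt\tau]$, and $\mu_\tau=\mu_0\boxplus\lambda_\tau$ is the free additive convolution. The critical value is $\tau_{\mathrm{crit}}=\left[\int\frac{d\mu_0(s)}{(x^*-s)^2}\right]^{-1}$, which is finite and positive under Assumption B. *)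

theory Defs
  imports "HOL-Analysis.Analysis" "HOL-Probability.Probability" "HOL-Library.Landau_Symbols"
begin

definition msupp :: "real measure \<Rightarrow> real set" where
  "msupp M = {x. \<forall>e>0. emeasure M (ball x e) > 0}"

definition moment :: "real measure \<Rightarrow> nat \<Rightarrow> real" where
  "moment M n = (\<integral>x. x ^ n \<partial>M)"

text \<open>kappa is the free cumulant sequence of M (indices n >= 1), via the
  moment-cumulant relation
  m_n = sum_{s=1}^n kappa_s sum_{i_1+...+i_s = n-s} m_{i_1} ... m_{i_s}.\<close>
definition free_cumulants :: "real measure \<Rightarrow> (nat \<Rightarrow> real) \<Rightarrow> bool" where
  "free_cumulants M \<kappa> \<longleftrightarrow>
     (\<forall>n\<ge>1. moment M n =
        (\<Sum>s=1..n. \<kappa> s *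
           (\<Sum>is\<in>{is. length is = s \<and> sum_list is = n - s}. prod_list (map (moment M) is))))"

definition compactly_supported_prob :: "real measure \<Rightarrow> bool" where
  "compactly_supported_prob M \<longleftrightarrow> prob_space M \<and> sets M = sets borel \<and>
     (\<exists>R. emeasure M (- {-R..R}) = 0)"

definition is_free_add_conv :: "real measure \<Rightarrow> real measure \<Rightarrow> real measure \<Rightarrow> bool" where
  "is_free_add_conv \<mu> \<nu> \<rho> \<longleftrightarrow> compactly_supported_prob \<rho> \<and>
     (\<exists>k\<mu> k\<nu> k\<rho>. free_cumulants \<mu> k\<mu> \<and> free_cumulants \<nu> k\<nu> \<and> free_cumulants \<rho> k\<rho> \<and>
        (\<forall>n\<ge>1. k\<rho> n = k\<mu> n + k\<nu> n))"

definition free_add_conv :: "real measure \<Rightarrow> real measure \<Rightarrow> real measure" (infixl "\<boxplus>" 65) where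
  "\<mu> \<boxplus> \<nu> = (THE \<rho>. is_free_add_conv \<mu> \<nu> \<rho>)"

definition semicircle :: "real \<Rightarrow> real measure" where
  "semicircle \<tau> = density lborel (\<lambda>s. ennreal (indicator {-2 * sqrt \<tau> .. 2 * sqrt \<tau>} s *
       (sqrt (4 * \<tau> - s\<^sup>2) / (2 * pi * \<tau>))))"

definition real_analytic_on :: "real set \<Rightarrow> (real \<Rightarrow> real) \<Rightarrow> bool" where
  "real_analytic_on U h \<longleftrightarrow> (\<forall>x\<in>U. \<exists>\<delta>>0. \<exists>a::nat \<Rightarrow> real.
      \<forall>s. \<bar>s - x\<bar> < \<delta> \<longrightarrow> (\<lambda>n. a n * (s - x) ^ n) sums h s)"

definition tau_crit :: "real measure \<Rightarrow> real \<Rightarrow> real" where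
  "tau_crit \<mu> x = inverse (\<integral>s. 1 / (x - s)\<^sup>2 \<partial>\<mu>)"

end

theory Submission
  imports Defs "HOL-Complex_Analysis.Complex_Analysis"
begin

text \<open>
  Let \<open>G\<close> be the Cauchy transform of \<open>\<mu>0\<close> and \<open>H z = z + \<tau> G z\<close>. Brouwer's theorem gives for every
  \<open>w\<close> in the upper half plane a solution \<open>\<omega> w\<close> of \<open>H z = w\<close>, and an expansion estimate for \<open>H\<close> makes
  it unique and locally 1/3-Hoelder, so that \<open>\<omega>\<close> extends to a continuous \<open>\<Omega>\<close> on the closed half
  plane. The density is \<open>p t = Im (\<Omega> t) / (\<pi> \<tau>)\<close>: by the maximum principle its Cauchy transform is
  \<open>G \<circ> \<omega>\<close>, and expanding \<open>G\<^sub>\<rho> (H z) = G z\<close> at infinity shows that passing from \<open>\<mu>0\<close> to \<open>\<rho>\<close> adds \<open>\<tau>\<close>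
  to the second free cumulant. The case \<open>\<mu>0 = \<delta>\<^sub>0\<close> of this gives the free cumulants of the semicircle
  law.

  Near \<open>xs\<close> write \<open>\<psi>0 s = (s - xs)\<^sup>2 \<phi> s\<close>. Then \<open>G z = G0 - A (z - xs) + (z - xs)\<^sup>2 \<Phi> z\<close> with
  \<open>A = 1 / tau_crit \<mu>0 xs\<close> and \<open>\<Phi>\<close>, the Cauchy transform of \<open>\<phi>\<close>, bounded. Hence, for \<open>x + \<i> v = \<Omega> t\<close> and
  \<open>a = 1 - \<tau> A\<close>, real parts give \<open>t - xt \<approx> a (x - xs)\<close> and imaginary parts give
  \<open>a v \<approx> \<pi> \<tau> \<psi>0 x\<close>, which is the assertion.
\<close>

section \<open>Moments and free cumulants\<close>

unbundle no vec_syntax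

text \<open>Where the exponent 1/3 comes from: the difference quotient of \<open>H\<close> at
  \<open>z\<close>, \<open>z'\<close> is 1 minus \<open>\<tau>\<close> times an integral, and
  polarization against the mirror image of \<open>z'\<close> shows that its real part is at least a
  multiple of |z - z'|^2. The obstacle at \<open>xs\<close> is that \<open>Im (\<Omega> t)\<close>
  has the order of \<open>\<psi>0\<close>, which is no larger than the quadratic error in the
  expansion of \<open>H\<close>. Imaginary parts therefore need an expansion of their own, with an
  error proportional to \<open>Im z\<close>. It rests on the Poisson integral of
  \<open>\<phi>\<close> at height v being known up to O(1 / |x - xs|) uniformly in v, and this is
  what the second difference supplies. As a first gain v = O((x - xs)^2): the curve
  \<open>\<Omega>\<close> is tangent to the real axis at \<open>xs\<close>, so every error can be
  measured by x - xs. The constant: x - xs ~ (t - xt) / a turns c0^(r+1) |x - xs|^r / a into (c0 /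
  a)^(r+1) |t - xt|^r, where r is the order of the zero. Since a = 1 - \<open>\<tau>\<close> /
  tau_crit, subcriticality is exactly a > 0 and \<open>ct\<close> is c0 / a. The relative error is
  O(t - xt) in both cases.\<close>

definition mgf :: "real measure \<Rightarrow> real fps" where
  "mgf M = Abs_fps (moment M)"

text \<open>In terms of the R-transform this is z R(z). \<open>free_cumulants\<close> constrains
  only the indices n >= 1; entry 0 is set to 0 so that M = 1 + C(X M) agrees with moment 0 being 1.
  On the moment side, \<open>fps_X * mgf M\<close> is the expansion of the Cauchy transform in u = 1
  / z.\<close>

definition cgf :: "(nat \<Rightarrow> real) \<Rightarrow> real fps" where
  "cgf \<kappa> = Abs_fps (\<lambda>n. if n = 0 then 0 else \<kappa> n)"

lemma cgf_0 [simp]: "cgf \<kappa> $ 0 = 0"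
  by (simp add: cgf_def)

text \<open>Links the inner sum of the moment-cumulant relation, which runs over lists of indices,
  to powers of the moment series.\<close>

lemma fps_power_nth_lists:
  fixes a :: "'a::comm_ring_1 fps"
  shows "(a ^ s) $ m = (\<Sum>is\<in>{is. length is = s \<and> sum_list is = m}. prod_list (map (fps_nth a) is))"
proof (cases s)
  case 0
  have "{is :: nat list. is = [] \<and> m = 0} = (if m = 0 then {[]} else {})"
    by auto
  then show ?thesis
    using 0 by (auto simp: cong: conj_cong)
next
  case (Suc t)
  have "prod_list (map (fps_nth a) v) = (\<Prod>j = 0..t. a $ (v ! j))" if "length v = Suc t" for v
    unfolding prod.list_conv_set_nth using that
    by (intro prod.cong) auto
  then show ?thesis
    unfolding Suc fps_power_nth_Suc
    by (intro sum.cong) (auto simp: natpermute_def)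
qed

lemma moment_0: "prob_space M \<Longrightarrow> moment M 0 = 1"
  by (simp add: moment_def prob_space.prob_space)

text \<open>The inner sum is coefficient n - s of the s-th power of the moment series, and the
  factor X^s in (X M)^s performs the shift by s.\<close>

lemma free_cumulants_iff:
  assumes "prob_space M"
  shows "free_cumulants M \<kappa> \<longleftrightarrow> mgf M = 1 + (cgf \<kappa> oo (fps_X * mgf M))"
proof -
  note m0 [simp] = moment_0[OF assms(1)]
  have *: "(cgf \<kappa> oo (fps_X * mgf M)) $ n = (\<Sum>s=1..n. \<kappa> s *
      (\<Sum>is\<in>{is. length is = s \<and> sum_list is = n - s}. prod_list (map (moment M) is)))" for n
  proof -
    have "(cgf \<kappa> oo (fps_X * mgf M)) $ n = (\<Sum>s=0..n. cgf \<kappa> $ s * (mgf M ^ s) $ (n - s))"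
      unfolding fps_compose_nth power_mult_distrib
      by (intro sum.cong) (auto simp: fps_X_power_mult_nth)
    also have "\<dots> = (\<Sum>s=1..n. cgf \<kappa> $ s * (mgf M ^ s) $ (n - s))"
      by (simp add: sum.atLeast_Suc_atMost)
    also have "\<dots> = (\<Sum>s=1..n. \<kappa> s *
        (\<Sum>is\<in>{is. length is = s \<and> sum_list is = n - s}. prod_list (map (fps_nth (mgf M)) is)))"
      unfolding fps_power_nth_lists by (intro sum.cong) (auto simp: cgf_def)
    also have "map (fps_nth (mgf M)) = map (moment M)"
      by (intro arg_cong[of _ _ map] ext) (simp add: mgf_def)
    finally show ?thesis .
  qed
  show ?thesis
    unfolding free_cumulants_def fps_eq_iff fps_add_nth *
    by (auto simp: mgf_def Suc_le_eq)
qed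

text \<open>X M has leading coefficient 1, hence a compositional inverse, and M = 1 + C(X M) can be
  solved for C.\<close>

lemma free_cumulants_exists:
  assumes "prob_space M"
  shows "\<exists>\<kappa>. free_cumulants M \<kappa>"
proof -
  note [simp] = moment_0[OF assms(1)]
  let ?F = "fps_X * mgf M"
  define C where "C = (mgf M - 1) oo fps_inv ?F"
  have F: "?F $ 0 = 0" "?F $ 1 \<noteq> 0"
    by (simp_all add: mgf_def)
  have "C oo ?F = (mgf M - 1) oo (fps_inv ?F oo ?F)"
    unfolding C_def using F by (subst fps_compose_assoc) (simp_all add: fps_inv_def)
  also have "\<dots> = mgf M - 1"
    by (simp only: fps_inv[OF F] fps_compose_fps_X)
  finally have "mgf M = 1 + (C oo ?F)"
    by simp
  moreover have "cgf (fps_nth C) = C"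
    by (auto simp: fps_eq_iff cgf_def C_def mgf_def)
  ultimately show ?thesis
    unfolding free_cumulants_iff[OF assms] by metis
qed

text \<open>Composition with X M can be cancelled. The conclusion speaks of \<open>cgf\<close>
  because entry 0 of \<open>\<kappa>\<close> is arbitrary.\<close>

lemma cgf_unique:
  assumes "prob_space M" "free_cumulants M \<kappa>" "free_cumulants M \<kappa>'"
  shows "cgf \<kappa> = cgf \<kappa>'"
proof -
  note [simp] = moment_0[OF assms(1)]
  let ?F = "fps_X * mgf M"
  have F: "?F $ 0 = 0" "?F $ 1 \<noteq> 0"
    by (simp_all add: mgf_def)
  have "cgf \<kappa> oo ?F = cgf \<kappa>' oo ?F"
    using assms unfolding free_cumulants_iff[OF assms(1)] by (metis add_left_cancel)
  then have "cgf \<kappa> oo ?F oo fps_inv ?F = cgf \<kappa>' oo ?F oo fps_inv ?F"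
    by simp
  then show ?thesis
    using F by (simp add: fps_compose_assoc[symmetric] fps_inv_def[of "?F"] fps_inv_right[OF F, unfolded fps_inv_def])
qed

text \<open>The equation \<open>M = 1 + C(X M)\<close> says that \<open>X / (1 + C)\<close> is the
  compositional inverse of \<open>X M\<close>, which makes both directions of the
  moment-cumulant correspondence injective.\<close>

lemma fps_inv_mgf:
  assumes "prob_space M" "free_cumulants M \<kappa>"
  shows "fps_inv (fps_X * mgf M) * (1 + cgf \<kappa>) = fps_X"
proof -
  note [simp] = moment_0[OF assms(1)]
  let ?F = "fps_X * mgf M"
  have F: "?F $ 0 = 0" "?F $ 1 \<noteq> 0"
    by (simp_all add: mgf_def)
  have I: "fps_inv ?F $ 0 = 0"
    by (simp add: fps_inv_def)
  have "?F = fps_X * (1 + (cgf \<kappa> oo ?F))"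
    using assms unfolding free_cumulants_iff[OF assms(1)] by metis
  then have "?F oo fps_inv ?F = (fps_X * (1 + (cgf \<kappa> oo ?F))) oo fps_inv ?F"
    by simp
  also have "\<dots> = fps_inv ?F * (1 + (cgf \<kappa> oo (?F oo fps_inv ?F)))"
    by (simp only: fps_compose_mult_distrib[OF I, of fps_X "1 + h" for h] fps_compose_add_distrib fps_compose_1
        fps_compose_assoc[OF I F(1)] fps_X_fps_compose_startby0[OF I])
  finally show ?thesis
    unfolding fps_inv_right[OF F] by simp
qed

lemma mgf_unique:
  assumes "prob_space M" "free_cumulants M \<kappa>" "prob_space M'" "free_cumulants M' \<kappa>'"
    "cgf \<kappa> = cgf \<kappa>'"
  shows "mgf M = mgf M'"
proof -
  note [simp] = moment_0[OF assms(1)] moment_0[OF assms(3)]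
  let ?F = "fps_X * mgf M" and ?F' = "fps_X * mgf M'"
  have F: "?F $ 0 = 0" "?F $ 1 \<noteq> 0" "?F' $ 0 = 0" "?F' $ 1 \<noteq> 0"
    by (simp_all add: mgf_def)
  have "1 + cgf \<kappa> \<noteq> 0"
    by (metis add_cancel_left_right cgf_0 fps_add_nth fps_one_nth fps_zero_nth zero_neq_one)
  moreover have "fps_inv ?F * (1 + cgf \<kappa>) = fps_inv ?F' * (1 + cgf \<kappa>)"
    using fps_inv_mgf[OF assms(1,2)] fps_inv_mgf[OF assms(3,4)] assms(5) by simp
  ultimately have *: "fps_inv ?F = fps_inv ?F'"
    by simp
  have I: "fps_inv ?F $ 0 = 0"
    by (simp add: fps_inv_def)
  have "?F = ?F oo (fps_inv ?F' oo ?F')"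
    by (simp only: fps_inv[OF F(3,4)] fps_compose_fps_X)
  also have "\<dots> = (?F oo fps_inv ?F) oo ?F'"
    unfolding * [symmetric] by (rule fps_compose_assoc[OF F(3) I])
  also have "\<dots> = ?F'"
    by (simp only: fps_inv_right[OF F(1,2)] fps_X_fps_compose_startby0[OF F(3)])
  finally show ?thesis
    by simp
qed

text \<open>\<open>E\<close> is \<open>1 / H(1 / z)\<close> at the origin, where \<open>H z = z + \<tau> G z\<close>; so the hypothesis is
  the subordination relation between the Cauchy transforms of \<open>\<rho>\<close> and \<open>\<mu>\<close> at infinity.\<close>

lemma free_cumulants_subordinated:
  fixes \<mu> \<rho> :: "real measure" and \<tau> :: real
  defines "E \<equiv> fps_X * inverse (1 + fps_const \<tau> * fps_X * (fps_X * mgf \<mu>))"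
  assumes \<mu>: "prob_space \<mu>" and \<rho>: "prob_space \<rho>" and \<kappa>: "free_cumulants \<mu> \<kappa>"
    and E: "(fps_X * mgf \<rho>) oo E = fps_X * mgf \<mu>"
  shows "free_cumulants \<rho> (\<lambda>n. \<kappa> n + (if n = 2 then \<tau> else 0))"
proof -
  note [simp] = moment_0[OF \<mu>]
  let ?F = "fps_X * mgf \<mu>" and ?R = "fps_X * mgf \<rho>"
  let ?D = "1 + fps_const \<tau> * fps_X * ?F"
  have D: "?D $ 0 \<noteq> 0"
    by simp
  have invD: "inverse ?D * ?D = 1"
    using D by (rule inverse_mult_eq_1)
  have E0: "E $ 0 = 0" and E1: "E $ 1 \<noteq> 0"
    by (simp_all add: E_def)
  have I: "fps_inv E $ 0 = 0"
    by (simp add: fps_inv_def)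
  have ED: "E * ?D = fps_X"
    unfolding E_def using invD by (simp add: mult.assoc)
  have "?F = E * (mgf \<rho> oo E)"
    using E E0 by (simp add: fps_compose_mult_distrib)
  then have "?F * ?D = fps_X * (mgf \<rho> oo E)"
    using ED by (metis mult.assoc mult.commute)
  then have "fps_X * (mgf \<mu> * ?D) = fps_X * (mgf \<rho> oo E)"
    by (simp add: mult.assoc)
  then have \<rho>E: "mgf \<rho> oo E = mgf \<mu> * ?D"
    by simp
  define c where "c = cgf \<kappa> + fps_const \<tau> * fps_X ^ 2"
  have cgf: "cgf (\<lambda>n. \<kappa> n + (if n = 2 then \<tau> else 0)) = c"
    by (auto simp: fps_eq_iff cgf_def c_def fps_X_power_iff)
  \<comment> \<open>The moment-cumulant equation of \<open>\<rho>\<close> is verified after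
    substituting \<open>E\<close>, which turns X M of \<open>\<rho>\<close> into X M of
    \<open>\<mu>\<close>. The extra term \<open>\<tau>\<close> X^2 then contributes
    \<open>\<tau>\<close> (X M)^2, exactly what multiplication by \<open>?D\<close> adds to
    \<open>mgf \<mu>\<close>.\<close>
  have "(1 + (c oo ?R)) oo E = 1 + (c oo ?F)"
    using E0 by (simp only: fps_compose_add_distrib fps_compose_1 E fps_compose_assoc[symmetric]) (simp add: E fps_compose_assoc[symmetric])
  also have "\<dots> = 1 + (cgf \<kappa> oo ?F) + fps_const \<tau> * ?F ^ 2"
    by (simp add: c_def fps_compose_add_distrib fps_compose_mult_distrib fps_compose_power[symmetric])
  also have "\<dots> = mgf \<mu> + fps_const \<tau> * ?F ^ 2"
    using \<kappa> unfolding free_cumulants_iff[OF \<mu>] by metis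
  also have "\<dots> = mgf \<mu> * ?D"
    by (simp add: algebra_simps power2_eq_square)
  finally have "(1 + (c oo ?R)) oo E = mgf \<rho> oo E"
    using \<rho>E by simp
  then have "((1 + (c oo ?R)) oo E) oo fps_inv E = (mgf \<rho> oo E) oo fps_inv E"
    by simp
  then have "1 + (c oo ?R) = mgf \<rho>"
    by (simp only: fps_compose_assoc[OF _ E0, symmetric] I fps_inv_right[OF E0 E1] fps_compose_fps_X)
  then show ?thesis
    unfolding free_cumulants_iff[OF \<rho>] cgf by simp
qed

section \<open>Compactly supported laws and their Cauchy transform\<close>

text \<open>Finite instead of probability: the measure \<open>\<rho>\<close> built later enters as a
  finite measure, and its mass is found only after its Cauchy transform has been identified.\<close>

locale bounded_measure = finite_measure M for M :: "real measure" +
  fixes R :: real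
  assumes sets_M [measurable_cong]: "sets M = sets borel" and R_nonneg: "R \<ge> 0"
    and AE_bound: "AE s in M. \<bar>s\<bar> \<le> R"
begin

abbreviation mass :: real where
  "mass \<equiv> measure M (space M)"

lemma integrable_bounded:
  fixes f :: "real \<Rightarrow> 'b::{banach, second_countable_topology}"
  assumes "f \<in> borel_measurable M" "AE s in M. norm (f s) \<le> B"
  shows "integrable M f"
  using assms by (intro integrable_const_bound) auto

lemma norm_integral_le:
  fixes f :: "real \<Rightarrow> 'b::{banach, second_countable_topology}"
  assumes "f \<in> borel_measurable M" "AE s in M. norm (f s) \<le> B"
  shows "norm (integral\<^sup>L M f) \<le> mass * B"
proof -
  have "norm (integral\<^sup>L M f) \<le> (\<integral>s. norm (f s) \<partial>M)"
    by (rule integral_norm_bound)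
  also have "\<dots> \<le> (\<integral>s. B \<partial>M)"
    using assms by (intro integral_mono_AE integrable_norm integrable_bounded[of f]) auto
  finally show ?thesis
    by simp
qed

lemma AE_power_bound: "AE s in M. \<bar>s ^ n\<bar> \<le> R ^ n"
  using AE_bound by eventually_elim (simp add: power_abs power_mono)

lemma integrable_power: "integrable M (\<lambda>s. s ^ n)"
  by (rule integrable_bounded[where B = "R ^ n"]) (use AE_power_bound in auto)

text \<open>Absolute convergence at radius \<open>R\<close> dominates the series on the support and
  permits termwise integration. It is applied with c n = u^n (Cauchy transform at infinity) and c n
  = (i t)^n / n! (characteristic function).\<close>

lemma moment_sums_integral:
  fixes c :: "nat \<Rightarrow> 'b::{banach, real_normed_field, second_countable_topology}"
  assumes "summable (\<lambda>n. norm (c n) * R ^ n)"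
  shows "(\<lambda>n. c n * of_real (moment M n)) sums (\<integral>s. (\<Sum>n. c n * of_real s ^ n) \<partial>M)"
proof -
  have int: "integrable M (\<lambda>s. c n * of_real s ^ n)" for n
    by (rule integrable_bounded[where B = "norm (c n) * R ^ n"])
      (use AE_bound in \<open>auto simp: norm_mult norm_power intro!: mult_left_mono power_mono elim!: eventually_mono\<close>)
  have "(\<integral>s. c n * of_real s ^ n \<partial>M) = c n * of_real (moment M n)" for n
  proof -
    have "(\<integral>s. (of_real (s ^ n) :: 'b) \<partial>M) = of_real (\<integral>s. s ^ n \<partial>M)"
      by (rule integral_bounded_linear[OF bounded_linear_of_real integrable_power])
    then show ?thesis
      unfolding moment_def by simp
  qed
  moreover have "(\<lambda>n. \<integral>s. c n * of_real s ^ n \<partial>M) sums (\<integral>s. (\<Sum>n. c n * of_real s ^ n) \<partial>M)"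
  proof (rule sums_integral)
    show "AE s in M. summable (\<lambda>n. norm (c n * of_real s ^ n))"
      using AE_bound
    proof eventually_elim
      case (elim s)
      show ?case
        by (rule summable_comparison_test'[OF assms])
          (use elim in \<open>auto simp: norm_mult norm_power intro!: mult_left_mono power_mono\<close>)
    qed
    show "summable (\<lambda>n. \<integral>s. norm (c n * of_real s ^ n) \<partial>M)"
    proof (rule summable_comparison_test'[OF summable_mult[OF assms, of mass]])
      fix n
      have "norm (\<integral>s. norm (c n * of_real s ^ n) \<partial>M) \<le> mass * (norm (c n) * R ^ n)"
        by (rule norm_integral_le)
          (use AE_bound in \<open>auto simp: norm_mult norm_power intro!: mult_left_mono power_mono elim!: eventually_mono\<close>)
      then show "norm (\<integral>s. norm (c n * of_real s ^ n) \<partial>M) \<le> mass * (norm (c n) * R ^ n)" .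
    qed
  qed (rule int)
  ultimately show ?thesis
    by (simp only:)
qed

end

locale bounded_law = bounded_measure M R + prob_space M for M R
begin

lemma real_distribution: "real_distribution M"
  by unfold_locales (simp_all add: sets_M sets_eq_imp_space_eq[OF sets_M])

text \<open>On a bounded support the exponential series can be integrated term by term, so the
  moments determine the characteristic function and, by Levy's theorem, the law.\<close>

lemma char_eq_suminf: "char M t = (\<Sum>n. (\<i> * of_real t) ^ n / fact n * of_real (moment M n))"
proof -
  have "summable (\<lambda>n. norm ((\<i> * of_real t) ^ n / fact n) * R ^ n)"
  proof -
    have "norm ((\<i> * of_real t) ^ n / fact n) * R ^ n = inverse (fact n) * (\<bar>t\<bar> * R) ^ n" for n
      by (simp add: norm_divide norm_power norm_mult power_mult_distrib field_simps)
    then show ?thesis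
      by (simp add: summable_exp)
  qed
  from moment_sums_integral[OF this]
  have "(\<Sum>n. (\<i> * of_real t) ^ n / fact n * of_real (moment M n))
      = (\<integral>s. (\<Sum>n. (\<i> * of_real t) ^ n / fact n * of_real s ^ n) \<partial>M)"
    by (simp add: sums_iff)
  also have "\<dots> = char M t"
    unfolding char_def exp_def
    by (intro Bochner_Integration.integral_cong refl suminf_cong)
      (simp add: scaleR_conv_of_real power_mult_distrib field_simps)
  finally show ?thesis ..
qed

end

lemma bounded_law_eqI:
  assumes "bounded_law M R" "bounded_law M' R'" "moment M = moment M'"
  shows "M = M'"
proof -
  interpret M: bounded_law M R by fact
  interpret M': bounded_law M' R' by fact
  show ?thesis
    using M.real_distribution M'.real_distribution
    by (rule Levy_uniqueness) (simp add: fun_eq_iff M.char_eq_suminf M'.char_eq_suminf assms(3))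
qed

lemma bounded_lawI:
  assumes "prob_space M" "sets M = sets borel" "R \<ge> 0" "AE s in M. \<bar>s\<bar> \<le> R"
  shows "bounded_law M R"
  using assms by (simp add: bounded_law_def bounded_measure_def bounded_measure_axioms_def prob_space_def)

lemma compactly_supported_prob_iff: "compactly_supported_prob M \<longleftrightarrow> (\<exists>R. bounded_law M R)"
proof -
  have *: "emeasure M (- {-R..R}) = 0 \<longleftrightarrow> (AE s in M. \<bar>s\<bar> \<le> R)" if "sets M = sets borel" for R
  proof -
    have "- {-R..R} \<in> sets M" "space M = UNIV"
      using that sets_eq_imp_space_eq[OF that] by auto
    moreover have "- {-R..R} = {s. \<not> \<bar>s\<bar> \<le> R}"
      by auto
    ultimately show ?thesis
      using AE_iff_measurable[of "- {-R..R}" M "\<lambda>s. \<bar>s\<bar> \<le> R"] by auto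
  qed
  show ?thesis
  proof
    assume c: "compactly_supported_prob M"
    then obtain R where "AE s in M. \<bar>s\<bar> \<le> R"
      unfolding compactly_supported_prob_def using * by blast
    \<comment> \<open>The definition puts no sign on \<open>R\<close>, whereas the locale asks for
      \<open>R \<ge> 0\<close>.\<close>
    then have "AE s in M. \<bar>s\<bar> \<le> max R 0"
      by (rule eventually_mono) auto
    then have "bounded_law M (max R 0)"
      using c by (intro bounded_lawI) (auto simp: compactly_supported_prob_def)
    then show "\<exists>R. bounded_law M R" ..
  next
    assume "\<exists>R. bounded_law M R"
    then obtain R where "bounded_law M R" ..
    then interpret bounded_law M R .
    show "compactly_supported_prob M"
      unfolding compactly_supported_prob_def using * [OF sets_M] AE_bound prob_space_axioms sets_M by blast
  qed
qed

text \<open>The description by \<open>THE\<close> calls for uniqueness: the summands fix the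
  cumulants, these fix the moments, and the moments fix a compactly supported law.\<close>

lemma free_add_conv_eqI:
  assumes "is_free_add_conv \<mu> \<nu> \<rho>" "prob_space \<mu>" "prob_space \<nu>"
  shows "\<mu> \<boxplus> \<nu> = \<rho>"
  unfolding free_add_conv_def
proof (rule the_equality[where P = "is_free_add_conv \<mu> \<nu>"])
  fix \<rho>'
  assume *: "is_free_add_conv \<mu> \<nu> \<rho>'"
  obtain R k1 k2 k3 where 1: "bounded_law \<rho> R"
    "free_cumulants \<mu> k1" "free_cumulants \<nu> k2" "free_cumulants \<rho> k3" "\<forall>n\<ge>1. k3 n = k1 n + k2 n"
    using assms(1) unfolding is_free_add_conv_def compactly_supported_prob_iff by blast
  obtain R' l1 l2 l3 where 2: "bounded_law \<rho>' R'"
    "free_cumulants \<mu> l1" "free_cumulants \<nu> l2" "free_cumulants \<rho>' l3" "\<forall>n\<ge>1. l3 n = l1 n + l2 n"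
    using * unfolding is_free_add_conv_def compactly_supported_prob_iff by blast
  have p: "prob_space \<rho>" "prob_space \<rho>'"
    using 1(1) 2(1) by (auto simp: bounded_law_def)
  have "cgf k3 = cgf k1 + cgf k2" "cgf l3 = cgf l1 + cgf l2"
    using 1(5) 2(5) by (auto simp: fps_eq_iff cgf_def)
  then have "cgf k3 = cgf l3"
    using cgf_unique[OF assms(2) 1(2) 2(2)] cgf_unique[OF assms(3) 1(3) 2(3)] by simp
  then have "mgf \<rho>' = mgf \<rho>"
    using mgf_unique[OF p(1) 1(4) p(2) 2(4)] by simp
  then have "moment \<rho>' = moment \<rho>"
    by (auto simp: mgf_def fps_eq_iff)
  then show "\<rho>' = \<rho>"
    by (rule bounded_law_eqI[OF 2(1) 1(1)])
qed fact

section \<open>The Cauchy transform: size, derivative and imaginary part\<close>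

definition cauchy :: "real measure \<Rightarrow> complex \<Rightarrow> complex" where
  "cauchy M z = (\<integral>s. 1 / (z - of_real s) \<partial>M)"

text \<open>Up to the factor - \<open>Im z\<close> this is the imaginary part of the Cauchy
  transform; it decides whether \<open>H\<close> leaves \<open>z\<close> in the upper half
  plane.\<close>

definition cauchy_sq :: "real measure \<Rightarrow> complex \<Rightarrow> real" where
  "cauchy_sq M z = (\<integral>s. 1 / (cmod (z - of_real s))\<^sup>2 \<partial>M)"

lemma cauchy_sq_nonneg: "cauchy_sq M z \<ge> 0"
  unfolding cauchy_sq_def by (intro integral_nonneg_AE) auto

lemma inverse_square_le: "0 < d \<Longrightarrow> d \<le> x \<Longrightarrow> 1 / x\<^sup>2 \<le> 1 / (d::real)\<^sup>2"
  by (intro divide_left_mono power_mono mult_pos_pos) auto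

lemma Im_le_dist_real: "Im z \<le> cmod (z - of_real s)"
  using abs_Im_le_cmod[of "z - of_real s"] by simp

context bounded_measure
begin

lemma AE_dist_lower: "AE s in M. cmod z - R \<le> cmod (z - of_real s)"
  using AE_bound
proof eventually_elim
  case (elim s)
  then show ?case
    using norm_triangle_ineq2[of z "of_real s"] by simp
qed

lemma AE_dist_upper: "AE s in M. cmod (z - of_real s) \<le> cmod z + R"
  using AE_bound
proof eventually_elim
  case (elim s)
  then show ?case
    using norm_triangle_ineq4[of z "of_real s"] by simp
qed

text \<open>The distance \<open>d\<close> to almost every point of the measure is kept abstract,
  since two choices occur: d = \<open>Im z\<close> near the axis, and d a lower bound for |z| - R
  far from the support.\<close>

lemma integrable_cauchy:
  assumes "d > 0" "AE s in M. d \<le> cmod (z - of_real s)"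
  shows "integrable M (\<lambda>s. 1 / (z - of_real s))"
    and "integrable M (\<lambda>s. 1 / (cmod (z - of_real s))\<^sup>2)"
    and "cmod (cauchy M z) \<le> mass * (1 / d)"
    and "cauchy_sq M z \<le> mass * (1 / d\<^sup>2)"
proof -
  have 1: "AE s in M. cmod (1 / (z - of_real s)) \<le> 1 / d"
    using assms(2) by eventually_elim (use \<open>d > 0\<close> in \<open>simp add: norm_divide divide_simps\<close>)
  then show "integrable M (\<lambda>s. 1 / (z - of_real s))" "cmod (cauchy M z) \<le> mass * (1 / d)"
    unfolding cauchy_def by (intro integrable_bounded norm_integral_le; simp)+
  have 2: "AE s in M. norm (1 / (cmod (z - of_real s))\<^sup>2) \<le> 1 / d\<^sup>2"
    using assms(2)
    by eventually_elim (use \<open>d > 0\<close> inverse_square_le[of d] in \<open>auto simp: norm_divide\<close>)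
  then show "integrable M (\<lambda>s. 1 / (cmod (z - of_real s))\<^sup>2)"
    by (intro integrable_bounded) auto
  have "norm (cauchy_sq M z) \<le> mass * (1 / d\<^sup>2)"
    unfolding cauchy_sq_def using 2 by (intro norm_integral_le) auto
  then show "cauchy_sq M z \<le> mass * (1 / d\<^sup>2)"
    by simp
qed

text \<open>The difference quotient misses the derivative by exactly the integral of h / ((z + h -
  s) (z - s)^2), which is at most a multiple of |h| / d^3.\<close>

lemma cauchy_has_field_derivative:
  assumes d: "d > 0" "AE s in M. d \<le> cmod (z - of_real s)"
  shows "(cauchy M has_field_derivative - (\<integral>s. 1 / (z - of_real s)\<^sup>2 \<partial>M)) (at z)"
proof -
  let ?D = "\<integral>s. 1 / (z - of_real s)\<^sup>2 \<partial>M"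
  have intD: "integrable M (\<lambda>s. 1 / (z - of_real s)\<^sup>2)"
    by (rule integrable_bounded[where B = "1 / d\<^sup>2"], measurable)
      (use d inverse_square_le[of d] in \<open>auto simp: norm_divide norm_power elim!: eventually_mono\<close>)
  have bound: "cmod ((cauchy M (z + h) - cauchy M z) / h + ?D) \<le> mass * (2 / d ^ 3 * cmod h)"
    if h: "h \<noteq> 0" "cmod h < d / 2" for h
  proof -
    \<comment> \<open>Moving \<open>z\<close> by less than \<open>d / 2\<close> keeps half of the
      distance; hence the factor 2 in the bound.\<close>
    have d2: "AE s in M. d / 2 \<le> cmod (z + h - of_real s)"
      using d(2)
    proof eventually_elim
      case (elim s)
      then show ?case
        using h norm_diff_ineq[of "z - of_real s" h] by (simp add: algebra_simps)
    qed
    have pw: "AE s in M. (1 / (z + h - of_real s) - 1 / (z - of_real s)) / h + 1 / (z - of_real s)\<^sup>2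
        = h / ((z + h - of_real s) * (z - of_real s)\<^sup>2)"
      using d(2) d2
    proof eventually_elim
      case (elim s)
      then have "z + h - of_real s \<noteq> 0" "z - of_real s \<noteq> 0"
        using d(1) by auto
      moreover have "z - of_real s = u \<Longrightarrow> z + h - of_real s = u + h" for u
        by auto
      ultimately show ?case
        using h(1) by (simp add: divide_simps power2_eq_square) (simp add: algebra_simps)
    qed
    have "(cauchy M (z + h) - cauchy M z) / h + ?D
      = (\<integral>s. (1 / (z + h - of_real s) - 1 / (z - of_real s)) / h + 1 / (z - of_real s)\<^sup>2 \<partial>M)"
      unfolding cauchy_def using integrable_cauchy(1)[OF d] integrable_cauchy(1)[OF _ d2] d(1) intD
      by simp
    also have "\<dots> = (\<integral>s. h / ((z + h - of_real s) * (z - of_real s)\<^sup>2) \<partial>M)"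
      by (rule integral_cong_AE) (use pw in auto)
    also have "cmod \<dots> \<le> mass * (2 / d ^ 3 * cmod h)"
    proof (rule norm_integral_le)
      show "AE s in M. cmod (h / ((z + h - of_real s) * (z - of_real s)\<^sup>2)) \<le> 2 / d ^ 3 * cmod h"
        using d(2) d2
      proof eventually_elim
        case (elim s)
        have p: "cmod (z + h - of_real s) > 0" "cmod (z - of_real s) > 0"
          using elim d(1) by linarith+
        have "d / 2 * d\<^sup>2 \<le> cmod (z + h - of_real s) * cmod (z - of_real s) ^ 2"
          using elim d(1) by (intro mult_mono power_mono) auto
        then have "cmod h / (cmod (z + h - of_real s) * cmod (z - of_real s) ^ 2) \<le> cmod h / (d / 2 * d\<^sup>2)"
          using p d(1) by (intro divide_left_mono mult_pos_pos zero_less_power) auto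
        moreover have "cmod h / (d / 2 * d\<^sup>2) = cmod h * 2 / (d * (d * d))"
          using d(1) by (simp add: power3_eq_cube power2_eq_square)
        moreover have "cmod h * 2 / (d * (d * d)) = 2 / d ^ 3 * cmod h"
          using d(1) by (simp add: power3_eq_cube mult.assoc)
        ultimately show ?case
          by (simp only: norm_divide norm_mult norm_power)
      qed
    qed measurable
    finally show ?thesis .
  qed
  have "((\<lambda>h. (cauchy M (z + h) - cauchy M z) / h + ?D) \<longlongrightarrow> 0) (at 0)"
  proof (rule Lim_null_comparison)
    show "\<forall>\<^sub>F h in at 0. cmod ((cauchy M (z + h) - cauchy M z) / h + ?D) \<le> mass * (2 / d ^ 3 * cmod h)"
      unfolding eventually_at using bound d(1) by (intro exI[of _ "d / 2"]) auto
    show "((\<lambda>h. mass * (2 / d ^ 3 * cmod h)) \<longlongrightarrow> 0) (at (0::complex))"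
      using d(1) by (auto intro!: tendsto_eq_intros)
  qed
  from tendsto_diff[OF this tendsto_const[of ?D]] show ?thesis
    unfolding DERIV_def by simp
qed

lemma upper_dist: "Im z > 0 \<Longrightarrow> AE s in M. Im z \<le> cmod (z - of_real s)"
  using Im_le_dist_real by simp

lemmas integrable_upper = integrable_cauchy[OF _ upper_dist]

lemma holomorphic_cauchy: "cauchy M holomorphic_on {z. Im z > 0}"
  using cauchy_has_field_derivative[OF _ upper_dist]
  by (auto simp: holomorphic_on_def field_differentiable_def intro: has_field_derivative_at_within)

lemma Im_cauchy:
  assumes "d > 0" "AE s in M. d \<le> cmod (z - of_real s)"
  shows "Im (cauchy M z) = - Im z * cauchy_sq M z"
proof -
  have "Im (cauchy M z) = (\<integral>s. Im (1 / (z - of_real s)) \<partial>M)"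
    unfolding cauchy_def by (rule integral_Im[symmetric]) (rule integrable_cauchy[OF assms])
  also have "\<dots> = (\<integral>s. - Im z * (1 / (cmod (z - of_real s))\<^sup>2) \<partial>M)"
    by (intro Bochner_Integration.integral_cong) (simp_all add: Im_divide cmod_power2)
  also have "\<dots> = - Im z * cauchy_sq M z"
    unfolding cauchy_sq_def by (rule integral_mult_right_zero)
  finally show ?thesis .
qed

end

context bounded_law
begin

text \<open>Cauchy--Schwarz in the form \<open>f \<le> (1 / \<surd>\<tau> + \<surd>\<tau> f\<^sup>2) / 2\<close>.\<close>

lemma norm_cauchy_le:
  assumes "Im z > 0" "\<tau> > 0" "\<tau> * cauchy_sq M z \<le> 1"
  shows "\<tau> * cmod (cauchy M z) \<le> sqrt \<tau>"
proof -
  note I = integrable_upper[OF assms(1) assms(1)]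
  let ?f = "\<lambda>s. 1 / cmod (z - of_real s)"
  have "cmod (cauchy M z) \<le> (\<integral>s. cmod (1 / (z - of_real s)) \<partial>M)"
    unfolding cauchy_def by (rule integral_norm_bound)
  also have "\<dots> \<le> (\<integral>s. (1 / sqrt \<tau> + sqrt \<tau> * (1 / (cmod (z - of_real s))\<^sup>2)) / 2 \<partial>M)"
  proof (rule integral_mono)
    show "integrable M (\<lambda>s. cmod (1 / (z - of_real s)))"
      using I(1) by (rule integrable_norm)
    show "integrable M (\<lambda>s. (1 / sqrt \<tau> + sqrt \<tau> * (1 / (cmod (z - of_real s))\<^sup>2)) / 2)"
      by (intro integrable_divide_zero Bochner_Integration.integrable_add integrable_mult_right
          integrable_const I(2))
    fix s
    have "0 \<le> (1 - sqrt \<tau> * ?f s)\<^sup>2 / (2 * sqrt \<tau>)"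
      using \<open>\<tau> > 0\<close> by simp
    also have "\<dots> = (1 / sqrt \<tau> + sqrt \<tau> * (?f s)\<^sup>2) / 2 - ?f s"
      using \<open>\<tau> > 0\<close> by (simp add: power2_eq_square divide_simps) (simp add: algebra_simps)
    finally show "cmod (1 / (z - of_real s)) \<le> (1 / sqrt \<tau> + sqrt \<tau> * (1 / (cmod (z - of_real s))\<^sup>2)) / 2"
      by (simp add: norm_divide power_divide)
  qed
  also have "\<dots> = (1 / sqrt \<tau> + sqrt \<tau> * cauchy_sq M z) / 2"
  proof -
    have "(\<integral>s. (a + b * f s) / 2 \<partial>M) = (a + b * (\<integral>s. f s \<partial>M)) / 2" if "integrable M f" for a b :: real and f
      using that by (simp add: prob_space)
    from this[OF I(2)] show ?thesis
      unfolding cauchy_sq_def .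
  qed
  finally have "\<tau> * cmod (cauchy M z) \<le> \<tau> * ((1 / sqrt \<tau> + sqrt \<tau> * cauchy_sq M z) / 2)"
    using \<open>\<tau> > 0\<close> by (intro mult_left_mono) auto
  also have "\<dots> = (sqrt \<tau> + sqrt \<tau> * (\<tau> * cauchy_sq M z)) / 2"
    using \<open>\<tau> > 0\<close> by (simp add: field_simps flip: real_sqrt_mult)
  also have "\<dots> \<le> (sqrt \<tau> + sqrt \<tau> * 1) / 2"
    using assms by (intro divide_right_mono add_left_mono mult_left_mono) auto
  finally show ?thesis
    by simp
qed

end

section \<open>Subordination for the semicircular flow\<close>

text \<open>Polarization of |a - cnj b|^2. The subtracted square is the gain that makes
  \<open>H\<close> expansive.\<close>

lemma Re_mult_eq_cnj: "Re (a * b) = ((cmod a)\<^sup>2 + (cmod b)\<^sup>2 - (cmod (a - cnj b))\<^sup>2) / 2"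
  unfolding cmod_power2 by (simp add: power2_eq_square algebra_simps)

text \<open>Two points of the upper half plane are closer to each other than one is to the mirror
  image of the other.\<close>

lemma norm_diff_le_diff_cnj:
  assumes "Im z > 0" "Im z' > 0"
  shows "cmod (z - z') \<le> cmod (z - cnj z')"
  unfolding cmod_def using assms by (intro real_sqrt_le_mono) (simp add: power2_eq_square algebra_simps)

locale semicircular_flow = bounded_law +
  fixes \<tau> :: real
  assumes tau_pos: "\<tau> > 0"
begin

definition H :: "complex \<Rightarrow> complex" where
  "H z = z + \<tau> * cauchy M z"

lemma Im_H: "Im z > 0 \<Longrightarrow> Im (H z) = Im z * (1 - \<tau> * cauchy_sq M z)"
  unfolding H_def by (simp add: Im_cauchy[OF _ upper_dist] algebra_simps)

text \<open>Describes the region on which \<open>H\<close> is inverted: it is the range of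
  \<open>\<omega>\<close>.\<close>

lemma Im_H_pos_iff: "Im z > 0 \<Longrightarrow> Im (H z) > 0 \<longleftrightarrow> \<tau> * cauchy_sq M z < 1"
  unfolding Im_H by (simp add: zero_less_mult_iff)

text \<open>With a = 1 / (z - s), b = 1 / (z' - s), polarization bounds Re(a b) by the mean of |a|^2
  and |b|^2 minus half of |a - cnj b|^2. Both squares integrate to less than 1 /
  \<open>\<tau>\<close> because \<open>H\<close> maps the two points into the upper half plane, so
  the subtracted term survives as a lower bound for the real part of the difference quotient. It is
  quadratic in z - z', which produces the cube.\<close>

lemma H_expansive:
  assumes z: "Im z > 0" "Im (H z) > 0" and z': "Im z' > 0" "Im (H z') > 0"
  shows "\<tau> / 2 * cmod (z - z') ^ 3 \<le> cmod (H z - H z') * ((cmod z + R) * (cmod z' + R))\<^sup>2"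
proof -
  define N where "N = (cmod z + R) * (cmod z' + R)"
  have "cmod z > 0" "cmod z' > 0"
    using z z' by auto
  then have N: "N > 0"
    unfolding N_def using R_nonneg by (intro mult_pos_pos add_pos_nonneg)
  \<comment> \<open>A lower bound for |a - cnj b|^2 that holds for all s with |s| at most
    \<open>R\<close>: the mirror image is at least as far away as \<open>z'\<close>, and
    \<open>N\<close> bounds the product of the two denominators.\<close>
  define q where "q = (cmod (z - z') / N)\<^sup>2"
  let ?a = "\<lambda>s. 1 / (z - of_real s)" and ?b = "\<lambda>s. 1 / (z' - of_real s)"
  note I = integrable_upper[OF z(1) z(1)] and I' = integrable_upper[OF z'(1) z'(1)]
  have pos: "cmod (z - of_real s) > 0" "cmod (z' - of_real s) > 0" for s
    using Im_le_dist_real[of z s] Im_le_dist_real[of z' s] z z' by linarith+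
  have eq: "?a s - ?b s = (z' - z) * (?a s * ?b s)" for s
    using pos[of s] by (simp add: field_simps)
  have ab: "integrable M (\<lambda>s. ?a s * ?b s)"
  proof (rule integrable_bounded[where B = "1 / Im z * (1 / Im z')"])
    show "AE s in M. cmod (?a s * ?b s) \<le> 1 / Im z * (1 / Im z')"
    proof (rule AE_I2)
      fix s
      show "cmod (?a s * ?b s) \<le> 1 / Im z * (1 / Im z')"
        unfolding norm_mult norm_divide norm_one using z z' pos[of s]
        by (intro mult_mono divide_left_mono Im_le_dist_real mult_pos_pos) auto
    qed
  qed measurable
  have "H z - H z' = z - z' + \<tau> * (\<integral>s. ?a s - ?b s \<partial>M)"
    unfolding H_def cauchy_def using I(1) I'(1) by (simp add: algebra_simps)
  also have "(\<integral>s. ?a s - ?b s \<partial>M) = (z' - z) * (\<integral>s. ?a s * ?b s \<partial>M)"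
    unfolding eq by (rule integral_mult_right_zero)
  finally have H: "H z - H z' = (z - z') * (1 - \<tau> * (\<integral>s. ?a s * ?b s \<partial>M))"
    by (simp add: algebra_simps)
  have "Re (\<integral>s. ?a s * ?b s \<partial>M) = (\<integral>s. Re (?a s * ?b s) \<partial>M)"
    using ab by (rule integral_Re[symmetric])
  also have "\<dots> \<le> (\<integral>s. (1 / (cmod (z - of_real s))\<^sup>2 + 1 / (cmod (z' - of_real s))\<^sup>2 - q) / 2 \<partial>M)"
  proof (rule integral_mono_AE)
    show "integrable M (\<lambda>s. Re (?a s * ?b s))"
      using ab by (rule integrable_Re)
    show "integrable M (\<lambda>s. (1 / (cmod (z - of_real s))\<^sup>2 + 1 / (cmod (z' - of_real s))\<^sup>2 - q) / 2)"
      using I(2) I'(2) by simp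
    show "AE s in M. Re (?a s * ?b s)
      \<le> (1 / (cmod (z - of_real s))\<^sup>2 + 1 / (cmod (z' - of_real s))\<^sup>2 - q) / 2"
      using AE_dist_upper[of z] AE_dist_upper[of z']
    proof eventually_elim
      case (elim s)
      have "cnj z' \<noteq> of_real s"
        using z' by (auto simp: complex_eq_iff)
      have "1 / u - 1 / v = (v - u) / (u * v)" if "u \<noteq> 0" "v \<noteq> 0" for u v :: complex
        using that by (simp add: field_simps)
      from this[of "z - of_real s" "cnj z' - of_real s"] have "?a s - cnj (?b s) = (cnj z' - z) / ((z - of_real s) * cnj (z' - of_real s))"
        using pos[of s] \<open>cnj z' \<noteq> of_real s\<close> by simp
      then have "cmod (?a s - cnj (?b s)) = cmod (z - cnj z') / (cmod (z - of_real s) * cmod (z' - of_real s))"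
        by (simp only: norm_divide norm_mult complex_mod_cnj norm_minus_commute[of "cnj z'" z])
      moreover have "cmod (z - z') / N \<le> cmod (z - cnj z') / (cmod (z - of_real s) * cmod (z' - of_real s))"
        unfolding N_def using pos[of s] elim N[unfolded N_def] z z' R_nonneg
        by (intro frac_le norm_diff_le_diff_cnj mult_mono) auto
      ultimately have "q \<le> (cmod (?a s - cnj (?b s)))\<^sup>2"
        unfolding q_def using N by (intro power_mono) auto
      then show ?case
        unfolding Re_mult_eq_cnj by (simp add: norm_divide power_divide)
    qed
  qed
  also have "\<dots> = (cauchy_sq M z + cauchy_sq M z' - q) / 2"
    unfolding cauchy_sq_def using I(2) I'(2) by (simp add: prob_space)
  finally have "\<tau> * Re (\<integral>s. ?a s * ?b s \<partial>M) \<le> \<tau> * ((cauchy_sq M z + cauchy_sq M z' - q) / 2)"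
    using tau_pos by (intro mult_left_mono) auto
  then have "\<tau> / 2 * q \<le> Re (1 - \<tau> * (\<integral>s. ?a s * ?b s \<partial>M))"
    using z z' by (simp add: Im_H_pos_iff algebra_simps)
  also have "\<dots> \<le> cmod (1 - \<tau> * (\<integral>s. ?a s * ?b s \<partial>M))"
    by (rule complex_Re_le_cmod)
  finally have "cmod (z - z') * (\<tau> / 2 * q) \<le> cmod (H z - H z')"
    unfolding H norm_mult by (intro mult_left_mono) auto
  then have "cmod (z - z') * (\<tau> / 2 * q) * N\<^sup>2 \<le> cmod (H z - H z') * N\<^sup>2"
    by (intro mult_right_mono) auto
  moreover have "cmod (z - z') * (\<tau> / 2 * q) * N\<^sup>2 = \<tau> / 2 * cmod (z - z') ^ 3"
    unfolding q_def using N by (simp add: power_divide power3_eq_cube power2_eq_square)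
  ultimately show ?thesis
    unfolding N_def by (simp only:)
qed

lemma H_inj:
  assumes "Im z > 0" "Im z' > 0" "H z = H z'" "Im (H z) > 0"
  shows "z = z'"
proof -
  have "\<tau> / 2 * cmod (z - z') ^ 3 \<le> 0"
    using H_expansive[OF assms(1,4,2)] assms by simp
  then show ?thesis
    using tau_pos by (simp add: mult_le_0_iff power_le_zero_eq)
qed

text \<open>Brouwer's theorem for \<open>z \<mapsto> w - \<tau> G z\<close>, which increases imaginary parts.\<close>

lemma H_surj:
  assumes w: "Im w > 0"
  shows "\<exists>z. Im z > 0 \<and> H z = w"
proof -
  \<comment> \<open>The radius is forced by |G| <= 1 / \<open>Im z\<close> <= 1 /
    \<open>Im w\<close> on this half plane; the intersection with the disc makes the domain compact
    and convex.\<close>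
  define S where "S = {z. Im w \<le> Im z} \<inter> cball w (\<tau> / Im w)"
  have "compact S"
    unfolding S_def using closed_halfspace_Im_ge[of "Im w"] by (intro closed_Int_compact) auto
  moreover have "convex S"
    unfolding S_def using convex_halfspace_Im_ge[of "Im w"] by (intro convex_Int convex_cball) simp
  moreover have "w \<in> S"
    unfolding S_def using tau_pos w by simp
  moreover have "continuous_on S (\<lambda>z. w - \<tau> * cauchy M z)"
    using w by (intro continuous_intros holomorphic_on_imp_continuous_on
        holomorphic_on_subset[OF holomorphic_cauchy]) (auto simp: S_def)
  moreover have "(\<lambda>z. w - \<tau> * cauchy M z) \<in> S \<rightarrow> S"
  proof
    fix z assume z: "z \<in> S"
    then have Im: "Im w \<le> Im z"
      by (simp add: S_def)
    then have "cmod (cauchy M z) \<le> 1 / Im w"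
      using integrable_cauchy(3)[of "Im w" z] Im_le_dist_real[of z] w order_trans[OF Im Im_le_dist_real]
      by (simp add: prob_space)
    then have "\<tau> * cmod (cauchy M z) \<le> \<tau> / Im w"
      using tau_pos mult_left_mono[of "cmod (cauchy M z)" "1 / Im w" \<tau>] by simp
    moreover have "Im (cauchy M z) \<le> 0"
      using Im w cauchy_sq_nonneg[of M z] by (simp add: Im_cauchy[OF _ upper_dist])
    then have "\<tau> * Im (cauchy M z) \<le> 0"
      using tau_pos by (simp add: mult_le_0_iff)
    ultimately show "w - \<tau> * cauchy M z \<in> S"
      unfolding S_def using tau_pos by (simp add: dist_norm norm_mult)
  qed
  ultimately obtain z where z: "z \<in> S" "w - \<tau> * cauchy M z = z"
    using brouwer[of S "\<lambda>z. w - \<tau> * cauchy M z"] by blast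
  then have "H z = w"
    unfolding H_def by (simp add: algebra_simps)
  moreover have "Im z > 0"
    using z w by (simp add: S_def)
  ultimately show ?thesis
    by blast
qed

definition \<omega> :: "complex \<Rightarrow> complex" where
  "\<omega> w = (SOME z. Im z > 0 \<and> H z = w)"

lemma
  assumes "Im w > 0"
  shows Im_\<omega>: "Im (\<omega> w) > 0" and H_\<omega>: "H (\<omega> w) = w"
  using someI_ex[OF H_surj[OF assms]] unfolding \<omega>_def by auto

lemma \<omega>_H: "Im z > 0 \<Longrightarrow> Im (H z) > 0 \<Longrightarrow> \<omega> (H z) = z"
  using H_inj[of "\<omega> (H z)" z] Im_\<omega>[of "H z"] H_\<omega>[of "H z"] by simp

lemma cauchy_\<omega>: "Im w > 0 \<Longrightarrow> cauchy M (\<omega> w) = (w - \<omega> w) / \<tau>"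
  using H_\<omega>[of w] tau_pos by (simp add: H_def field_simps)

text \<open>Being mapped into the upper half plane by \<open>H\<close> gives
  \<open>\<tau> * cauchy_sq M (\<omega> w) < 1\<close>, and Cauchy--Schwarz applies. Unlike the
  radius \<open>\<tau> / Im w\<close> of the fixed point argument, this bound is uniform up to the
  real axis.\<close>

lemma norm_\<omega>_diff_le: "Im w > 0 \<Longrightarrow> cmod (w - \<omega> w) \<le> sqrt \<tau>"
  using norm_cauchy_le[of "\<omega> w" \<tau>] Im_H_pos_iff[of "\<omega> w"] Im_\<omega>[of w] H_\<omega>[of w] cauchy_\<omega>[of w] tau_pos
  by (simp add: norm_divide)

lemma norm_\<omega>_le: "Im w > 0 \<Longrightarrow> cmod (\<omega> w) \<le> cmod w + sqrt \<tau>"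
  using norm_\<omega>_diff_le[of w] norm_triangle_ineq2[of "\<omega> w" w] by (simp add: norm_minus_commute)

lemma norm_\<omega>_ge: "Im w > 0 \<Longrightarrow> cmod w - sqrt \<tau> \<le> cmod (\<omega> w)"
  using norm_\<omega>_diff_le[of w] norm_triangle_ineq2[of w "\<omega> w"] by simp

text \<open>\<open>\<omega>\<close> inverts \<open>H\<close> on the open set where \<open>H\<close>
  takes values in the upper half plane, and an injective holomorphic map has a holomorphic
  inverse.\<close>

lemma holomorphic_\<omega>: "\<omega> holomorphic_on {w. Im w > 0}"
proof -
  define S where "S = {z. Im z > 0} \<inter> H -` {w. Im w > 0}"
  have hol: "H holomorphic_on {z. Im z > 0}"
    unfolding H_def by (intro holomorphic_intros holomorphic_cauchy)
  have "open S"
    unfolding S_def using hol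
    by (intro continuous_open_preimage holomorphic_on_imp_continuous_on open_halfspace_Im_gt)
  moreover have "H holomorphic_on S"
    using hol by (rule holomorphic_on_subset) (auto simp: S_def)
  moreover have "inj_on H S"
    by (auto simp: inj_on_def S_def intro: H_inj)
  ultimately obtain g where g: "g holomorphic_on H ` S" "\<And>z. z \<in> S \<Longrightarrow> g (H z) = z"
    using holomorphic_has_inverse by metis
  have \<omega>S: "\<omega> w \<in> S" if "Im w > 0" for w
    using that by (simp add: S_def Im_\<omega> H_\<omega>)
  have g\<omega>: "g w = \<omega> w" "w \<in> H ` S" if "Im w > 0" for w
    using g(2)[OF \<omega>S[OF that]] \<omega>S[OF that] H_\<omega>[OF that] by (auto intro: rev_image_eqI)
  then have "g holomorphic_on {w. Im w > 0}"
    using g(1) by (rule_tac holomorphic_on_subset) auto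
  then show ?thesis
    by (rule holomorphic_transform) (simp add: g\<omega>)
qed

text \<open>The factor 2 / \<open>\<tau>\<close> times N^2 of \<open>H_expansive\<close>, where |w|
  <= L gives |\<omega> w| <= L + sqrt \<open>\<tau>\<close> and thus N <= (L + sqrt
  \<open>\<tau>\<close> + R)^2.\<close>

definition hoelder_const :: "real \<Rightarrow> real" where
  "hoelder_const L = 2 / \<tau> * (L + sqrt \<tau> + R) ^ 4"

lemma \<omega>_hoelder:
  assumes "Im w > 0" "Im w' > 0" "cmod w \<le> L" "cmod w' \<le> L"
  shows "cmod (\<omega> w - \<omega> w') ^ 3 \<le> hoelder_const L * cmod (w - w')"
proof -
  have "\<tau> / 2 * cmod (\<omega> w - \<omega> w') ^ 3 \<le> cmod (w - w') * ((cmod (\<omega> w) + R) * (cmod (\<omega> w') + R))\<^sup>2"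
    using H_expansive[of "\<omega> w" "\<omega> w'"] assms by (simp add: Im_\<omega> H_\<omega>)
  also have "\<dots> \<le> cmod (w - w') * ((L + sqrt \<tau> + R) * (L + sqrt \<tau> + R))\<^sup>2"
    using norm_\<omega>_le[of w] norm_\<omega>_le[of w'] assms R_nonneg tau_pos
    by (intro mult_left_mono power_mono mult_mono) (auto intro!: add_nonneg_nonneg intro: order_trans[OF norm_ge_zero])
  also have "\<dots> = \<tau> / 2 * (hoelder_const L * cmod (w - w'))"
    unfolding hoelder_const_def using tau_pos by (simp add: power2_eq_square power4_eq_xxxx)
  finally show ?thesis
    using tau_pos by simp
qed

end

section \<open>Boundary values and the density\<close>

lemma integral_inverse_square_plus:
  fixes x v :: real
  assumes "v > 0"
  shows "has_bochner_integral lborel (\<lambda>t. 1 / ((t - x)\<^sup>2 + v\<^sup>2)) (pi / v)"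
proof -
  let ?f = "\<lambda>t. 1 / ((t - x)\<^sup>2 + v\<^sup>2)" and ?F = "\<lambda>t. arctan ((t - x) / v) / v"
  have pos: "(t - x)\<^sup>2 + v\<^sup>2 > 0" for t
    using assms by (simp add: add_nonneg_pos)
  have der: "DERIV ?F t :> ?f t" for t
    using assms pos[of t]
    by (auto intro!: derivative_eq_intros simp: divide_simps power2_eq_square add_eq_0_iff)
  have "(?F \<longlongrightarrow> (pi / 2) / v) at_top"
    using assms by (intro tendsto_divide tendsto_const filterlim_compose[OF tendsto_arctan_at_top]) (auto, real_asymp)
  then have top: "(?F \<longlongrightarrow> pi / (2 * v)) at_top"
    by simp
  have "(?F \<longlongrightarrow> (- (pi / 2)) / v) at_bot"
    using assms by (intro tendsto_divide tendsto_const filterlim_compose[OF tendsto_arctan_at_bot]) (auto, real_asymp)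
  then have bot: "(?F \<longlongrightarrow> - (pi / (2 * v))) at_bot"
    by simp
  note FTC = interval_integral_FTC_nonneg[of "-\<infinity>" \<infinity> ?F ?f "- (pi / (2 * v))" "pi / (2 * v)"]
  have "set_integrable lborel (einterval (-\<infinity>) \<infinity>) ?f"
    using pos by (intro FTC(1) der) (auto simp: ereal_tendsto_simps bot top less_imp_le
        intro!: continuous_intros order.strict_implies_not_eq[symmetric])
  moreover have "(LBINT t=-\<infinity>..\<infinity>. ?f t) = pi / (2 * v) - (- (pi / (2 * v)))"
    using pos by (intro FTC(2) der) (auto simp: ereal_tendsto_simps bot top less_imp_le
        intro!: continuous_intros order.strict_implies_not_eq[symmetric])
  ultimately show ?thesis
    unfolding has_bochner_integral_iff
    by (simp add: interval_lebesgue_integral_def set_integrable_def set_lebesgue_integral_def add_divide_distrib[symmetric] field_simps)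
qed

text \<open>For |t - x| < \<open>\<delta>\<close> the oscillation of \<open>p\<close> is at most
  \<open>\<eta>\<close> and the kernel has mass pi / v. Elsewhere |p t - p x| <= 2 B, and the kernel
  is at most twice the one of width \<open>\<delta>\<close>, whose mass pi / \<open>\<delta>\<close>
  does not depend on v.\<close>

lemma poisson_approx:
  fixes p :: "real \<Rightarrow> real"
  assumes [measurable]: "p \<in> borel_measurable borel"
    and B: "\<And>t. \<bar>p t\<bar> \<le> B" and \<delta>: "\<delta> > 0" and v: "v > 0"
    and cont: "\<And>t. \<bar>t - x\<bar> < \<delta> \<Longrightarrow> \<bar>p t - p x\<bar> \<le> \<eta>"
  shows "integrable lborel (\<lambda>t. p t * (1 / ((t - x)\<^sup>2 + v\<^sup>2)))"
    and "\<bar>v * (\<integral>t. p t * (1 / ((t - x)\<^sup>2 + v\<^sup>2)) \<partial>lborel) - pi * p x\<bar> \<le> pi * \<eta> + 4 * B * v * (pi / \<delta>)"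
proof -
  note K = integral_inverse_square_plus[OF v, of x] and K' = integral_inverse_square_plus[OF \<delta>, of x]
  note I = integrable.intros[OF K] and I' = integrable.intros[OF K']
  show int: "integrable lborel (\<lambda>t. p t * (1 / ((t - x)\<^sup>2 + v\<^sup>2)))"
  proof (rule Bochner_Integration.integrable_bound)
    show "integrable lborel (\<lambda>t. B * (1 / ((t - x)\<^sup>2 + v\<^sup>2)))"
      using I by (rule integrable_mult_right)
    show "AE t in lborel. norm (p t * (1 / ((t - x)\<^sup>2 + v\<^sup>2))) \<le> norm (B * (1 / ((t - x)\<^sup>2 + v\<^sup>2)))"
      unfolding norm_mult using B by (intro AE_I2 mult_right_mono) (auto intro: order_trans[OF B])
  qed measurable
  have int2: "integrable lborel (\<lambda>t. v * ((p t - p x) * (1 / ((t - x)\<^sup>2 + v\<^sup>2))))"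
    unfolding left_diff_distrib by (intro integrable_mult_right Bochner_Integration.integrable_diff int I)
  have "(\<integral>t. v * ((p t - p x) * (1 / ((t - x)\<^sup>2 + v\<^sup>2))) \<partial>lborel)
      = v * ((\<integral>t. p t * (1 / ((t - x)\<^sup>2 + v\<^sup>2)) \<partial>lborel) - p x * (pi / v))"
    unfolding left_diff_distrib
    using Bochner_Integration.integral_diff[OF int integrable_mult_right[OF I, of "p x"]] has_bochner_integral_integral_eq[OF K]
    by (simp only: integral_mult_right_zero)
  then have "v * (\<integral>t. p t * (1 / ((t - x)\<^sup>2 + v\<^sup>2)) \<partial>lborel) - pi * p x
      = (\<integral>t. v * ((p t - p x) * (1 / ((t - x)\<^sup>2 + v\<^sup>2))) \<partial>lborel)"
    using v by (simp only: right_diff_distrib) (simp add: field_simps)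
  also have "\<bar>\<dots>\<bar> \<le> (\<integral>t. \<bar>v * ((p t - p x) * (1 / ((t - x)\<^sup>2 + v\<^sup>2)))\<bar> \<partial>lborel)"
    by (rule integral_abs_bound)
  also have "\<dots> \<le> (\<integral>t. \<eta> * v * (1 / ((t - x)\<^sup>2 + v\<^sup>2)) + 4 * B * v * (1 / ((t - x)\<^sup>2 + \<delta>\<^sup>2)) \<partial>lborel)"
  proof (rule integral_mono)
    show "integrable lborel (\<lambda>t. \<bar>v * ((p t - p x) * (1 / ((t - x)\<^sup>2 + v\<^sup>2)))\<bar>)"
      using int2 by (rule integrable_abs)
    show "integrable lborel (\<lambda>t. \<eta> * v * (1 / ((t - x)\<^sup>2 + v\<^sup>2)) + 4 * B * v * (1 / ((t - x)\<^sup>2 + \<delta>\<^sup>2)))"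
      by (intro Bochner_Integration.integrable_add integrable_mult_right I I')
    fix t
    have B0: "B \<ge> 0"
      using B[of 0] by linarith
    have \<eta>0: "\<eta> \<ge> 0"
      using cont[of x] \<delta> by simp
    have pos: "(t - x)\<^sup>2 + v\<^sup>2 > 0" "(t - x)\<^sup>2 + \<delta>\<^sup>2 > 0"
      using v \<delta> by (simp_all add: add_nonneg_pos)
    have "\<bar>p t - p x\<bar> * (1 / ((t - x)\<^sup>2 + v\<^sup>2)) \<le> \<eta> * (1 / ((t - x)\<^sup>2 + v\<^sup>2)) + 4 * B * (1 / ((t - x)\<^sup>2 + \<delta>\<^sup>2))"
    proof (cases "\<bar>t - x\<bar> < \<delta>")
      case True
      then have "\<bar>p t - p x\<bar> * (1 / ((t - x)\<^sup>2 + v\<^sup>2)) \<le> \<eta> * (1 / ((t - x)\<^sup>2 + v\<^sup>2))"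
        using cont pos by (intro mult_right_mono) auto
      then show ?thesis
        using B0 pos by (simp add: add_increasing2)
    next
      case False
      then have "\<delta>\<^sup>2 \<le> \<bar>t - x\<bar>\<^sup>2"
        using \<delta> by (intro power_mono) auto
      then have *: "(t - x)\<^sup>2 + \<delta>\<^sup>2 \<le> 2 * ((t - x)\<^sup>2 + v\<^sup>2)"
        by (simp add: add_increasing2)
      have "\<bar>p t - p x\<bar> \<le> 2 * B"
        using B[of t] B[of x] by linarith
      then have "\<bar>p t - p x\<bar> * (1 / ((t - x)\<^sup>2 + v\<^sup>2)) \<le> 2 * B * (1 / ((t - x)\<^sup>2 + v\<^sup>2))"
        using pos by (intro mult_right_mono) auto
      also have "1 / ((t - x)\<^sup>2 + v\<^sup>2) \<le> 2 * (1 / ((t - x)\<^sup>2 + \<delta>\<^sup>2))"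
        using pos * by (simp add: divide_simps)
      then have "2 * B * (1 / ((t - x)\<^sup>2 + v\<^sup>2)) \<le> 2 * B * (2 * (1 / ((t - x)\<^sup>2 + \<delta>\<^sup>2)))"
        using B0 by (intro mult_left_mono) auto
      finally show ?thesis
        using \<eta>0 pos by (simp add: add_increasing)
    qed
    from mult_left_mono[OF this, of v]
    have "v * (\<bar>p t - p x\<bar> * (1 / ((t - x)\<^sup>2 + v\<^sup>2)))
        \<le> \<eta> * v * (1 / ((t - x)\<^sup>2 + v\<^sup>2)) + 4 * B * v * (1 / ((t - x)\<^sup>2 + \<delta>\<^sup>2))"
      using v by (simp add: algebra_simps)
    then show "\<bar>v * ((p t - p x) * (1 / ((t - x)\<^sup>2 + v\<^sup>2)))\<bar>
        \<le> \<eta> * v * (1 / ((t - x)\<^sup>2 + v\<^sup>2)) + 4 * B * v * (1 / ((t - x)\<^sup>2 + \<delta>\<^sup>2))"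
      using v pos by (simp add: abs_mult)
  qed
  also have "\<dots> = \<eta> * v * (pi / v) + 4 * B * v * (pi / \<delta>)"
    using Bochner_Integration.integral_add[OF integrable_mult_right[OF I] integrable_mult_right[OF I'], of "\<eta> * v" "4 * B * v"]
      has_bochner_integral_integral_eq[OF K] has_bochner_integral_integral_eq[OF K']
    by (simp only: integral_mult_right_zero)
  finally show "\<bar>v * (\<integral>t. p t * (1 / ((t - x)\<^sup>2 + v\<^sup>2)) \<partial>lborel) - pi * p x\<bar> \<le> pi * \<eta> + 4 * B * v * (pi / \<delta>)"
    using v by (simp add: field_simps)
qed

context semicircular_flow
begin

definition above :: "complex \<Rightarrow> nat \<Rightarrow> complex" where
  "above w n = w + \<i> * of_real (inverse (real (Suc n)))"

text \<open>The limit is taken along one vertical sequence for every point of the closed half plane,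
  interior points included, so that a single Hoelder estimate covers interior and boundary
  together.\<close>

definition \<Omega> :: "complex \<Rightarrow> complex" where
  "\<Omega> w = lim (\<lambda>n. \<omega> (above w n))"

lemma Im_above: "Im (above w n) = Im w + inverse (real (Suc n))"
  by (simp add: above_def del: of_real_inverse of_nat_Suc)

lemma Im_above_pos: "Im w \<ge> 0 \<Longrightarrow> Im (above w n) > 0"
  unfolding Im_above by (intro add_nonneg_pos) auto

lemma above_tendsto: "above w \<longlonglongrightarrow> w"
proof -
  have "(\<lambda>n. w + \<i> * of_real (inverse (real (Suc n)))) \<longlonglongrightarrow> w + \<i> * of_real 0"
    by (intro tendsto_intros LIMSEQ_inverse_real_of_nat)
  then show ?thesis
    by (simp add: above_def[abs_def])
qed

lemma norm_above_le: "cmod (above w n) \<le> cmod w + 1"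
proof -
  have "cmod (\<i> * of_real x) = \<bar>x\<bar>" for x :: real
    by (simp add: norm_mult)
  from norm_triangle_ineq[of w "\<i> * of_real (inverse (real (Suc n)))", unfolded this]
  have "cmod (above w n) \<le> cmod w + \<bar>inverse (real (Suc n))\<bar>"
    unfolding above_def .
  moreover have "\<bar>inverse (real (Suc n))\<bar> \<le> 1"
    by (simp add: field_simps)
  ultimately show ?thesis
    by linarith
qed

lemma hoelder_const_nonneg: "hoelder_const L \<ge> 0"
  unfolding hoelder_const_def using tau_pos by simp

lemma \<Omega>_tendsto:
  assumes "Im w \<ge> 0"
  shows "(\<lambda>n. \<omega> (above w n)) \<longlonglongrightarrow> \<Omega> w"
proof -
  \<comment> \<open>\<open>cmod w + 1\<close> bounds the whole sequence \<open>above w\<close>; the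
    last summand makes \<open>K\<close> visibly positive, since e^3 is divided by it.\<close>
  define K where "K = hoelder_const (cmod w + 1) + 1"
  have K: "K > 0"
    unfolding K_def using hoelder_const_nonneg[of "cmod w + 1"] by simp
  have "Cauchy (\<lambda>n. \<omega> (above w n))"
  proof (rule metric_CauchyI)
    fix e :: real assume e: "e > 0"
    have "Cauchy (above w)"
      using above_tendsto by (rule LIMSEQ_imp_Cauchy)
    then obtain N where N: "\<And>m n. m \<ge> N \<Longrightarrow> n \<ge> N \<Longrightarrow> dist (above w m) (above w n) < e ^ 3 / K"
      using e K by (auto simp: Cauchy_def) (meson divide_pos_pos zero_less_power)
    have "dist (\<omega> (above w m)) (\<omega> (above w n)) < e" if "m \<ge> N" "n \<ge> N" for m n
    proof -
      have "cmod (\<omega> (above w m) - \<omega> (above w n)) ^ 3 \<le> hoelder_const (cmod w + 1) * cmod (above w m - above w n)"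
        using assms by (intro \<omega>_hoelder norm_above_le Im_above_pos)
      also have "\<dots> \<le> K * cmod (above w m - above w n)"
        unfolding K_def by (intro mult_right_mono) auto
      also have "\<dots> < e ^ 3"
        using N[OF that] K by (simp add: dist_norm pos_less_divide_eq mult.commute)
      finally show ?thesis
        unfolding dist_norm using e by (rule_tac power_less_imp_less_base) auto
    qed
    then show "\<exists>N. \<forall>m\<ge>N. \<forall>n\<ge>N. dist (\<omega> (above w m)) (\<omega> (above w n)) < e"
      by blast
  qed
  then show ?thesis
    unfolding \<Omega>_def by (simp add: Cauchy_convergent_iff convergent_LIMSEQ_iff)
qed

lemma \<Omega>_eq_\<omega>:
  assumes "Im w > 0"
  shows "\<Omega> w = \<omega> w"
proof -
  have "isCont \<omega> w"
    using holomorphic_\<omega> assms open_halfspace_Im_gt[of 0]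
    by (intro continuous_on_interior[of "{w. Im w > 0}"] holomorphic_on_imp_continuous_on)
      (auto simp: interior_open)
  then have "(\<lambda>n. \<omega> (above w n)) \<longlonglongrightarrow> \<omega> w"
    using above_tendsto by (rule isCont_tendsto_compose)
  then show ?thesis
    using \<Omega>_tendsto[of w] assms LIMSEQ_unique by auto
qed

lemma \<Omega>_hoelder:
  assumes "Im w \<ge> 0" "Im w' \<ge> 0" "cmod w \<le> L" "cmod w' \<le> L"
  shows "cmod (\<Omega> w - \<Omega> w') ^ 3 \<le> hoelder_const (L + 1) * cmod (w - w')"
proof (rule LIMSEQ_le)
  show "(\<lambda>n. cmod (\<omega> (above w n) - \<omega> (above w' n)) ^ 3) \<longlonglongrightarrow> cmod (\<Omega> w - \<Omega> w') ^ 3"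
    using assms by (intro tendsto_intros \<Omega>_tendsto)
  show "(\<lambda>n. hoelder_const (L + 1) * cmod (above w n - above w' n)) \<longlonglongrightarrow> hoelder_const (L + 1) * cmod (w - w')"
    by (intro tendsto_intros above_tendsto)
  have "cmod (\<omega> (above w n) - \<omega> (above w' n)) ^ 3 \<le> hoelder_const (L + 1) * cmod (above w n - above w' n)" for n
    using assms norm_above_le[of w n] norm_above_le[of w' n] by (intro \<omega>_hoelder Im_above_pos) auto
  then show "\<exists>N. \<forall>n\<ge>N. cmod (\<omega> (above w n) - \<omega> (above w' n)) ^ 3 \<le> hoelder_const (L + 1) * cmod (above w n - above w' n)"
    by blast
qed

lemma continuous_on_\<Omega>: "continuous_on {w. Im w \<ge> 0} \<Omega>"
  unfolding continuous_on_def
proof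
  fix w assume w: "w \<in> {w. Im w \<ge> 0}"
  have "((\<lambda>u. cmod (\<Omega> u - \<Omega> w) ^ 3) \<longlongrightarrow> 0) (at w within {w. Im w \<ge> 0})"
  proof (rule tendsto_sandwich[where f = "\<lambda>_. 0" and h = "\<lambda>u. hoelder_const (cmod w + 1 + 1) * cmod (u - w)"])
    have "\<forall>\<^sub>F u in at w within {w. Im w \<ge> 0}. u \<in> {w. Im w \<ge> 0} \<and> dist u w < 1"
      by (auto simp: eventually_at intro!: exI[of _ 1])
    then show "\<forall>\<^sub>F u in at w within {w. Im w \<ge> 0}. cmod (\<Omega> u - \<Omega> w) ^ 3 \<le> hoelder_const (cmod w + 1 + 1) * cmod (u - w)"
    proof eventually_elim
      case (elim u)
      then show ?case
        using w norm_triangle_ineq2[of u w] by (intro \<Omega>_hoelder) (auto simp: dist_norm)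
    qed
    have "((\<lambda>u. hoelder_const (cmod w + 1 + 1) * cmod (u - w)) \<longlongrightarrow> hoelder_const (cmod w + 1 + 1) * cmod (w - w)) (at w within {w. Im w \<ge> 0})"
      by (intro tendsto_intros)
    then show "((\<lambda>u. hoelder_const (cmod w + 1 + 1) * cmod (u - w)) \<longlongrightarrow> 0) (at w within {w. Im w \<ge> 0})"
      by simp
  qed auto
  then have "((\<lambda>u. root 3 (cmod (\<Omega> u - \<Omega> w) ^ 3)) \<longlongrightarrow> root 3 0) (at w within {w. Im w \<ge> 0})"
    by (rule tendsto_real_root)
  then show "(\<Omega> \<longlongrightarrow> \<Omega> w) (at w within {w. Im w \<ge> 0})"
    by (simp add: odd_real_root_power_cancel tendsto_norm_zero_iff LIM_zero_iff)
qed

lemma Im_\<Omega>_nonneg: "Im w \<ge> 0 \<Longrightarrow> Im (\<Omega> w) \<ge> 0"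
  using tendsto_Im[OF \<Omega>_tendsto] by (rule LIMSEQ_le_const) (auto intro!: less_imp_le Im_\<omega> Im_above_pos)

text \<open>|w| >= T forces |\<omega> w| >= R + sqrt(2 \<open>\<tau>\<close>). The distance to the
  support is then at least sqrt(2 \<open>\<tau>\<close>), so \<open>\<tau> * cauchy_sq\<close> is at
  most 1/2 and \<open>H\<close> at most halves imaginary parts. Consequently \<open>p\<close>
  vanishes beyond \<open>T\<close>.\<close>

definition T :: real where
  "T = R + sqrt \<tau> + sqrt (2 * \<tau>)"

lemma T_pos: "T > 0"
  unfolding T_def using R_nonneg tau_pos by (intro add_nonneg_pos add_nonneg_nonneg) auto

lemma Im_\<omega>_le:
  assumes "Im w > 0" "cmod w \<ge> T"
  shows "Im (\<omega> w) \<le> 2 * Im w"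
proof -
  define z where "z = \<omega> w"
  have z: "Im z > 0" "H z = w"
    unfolding z_def using assms by (auto simp: Im_\<omega> H_\<omega>)
  define d where "d = sqrt (2 * \<tau>)"
  have d: "d > 0" "AE s in M. d \<le> cmod (z - of_real s)"
  proof -
    show "d > 0"
      unfolding d_def using tau_pos by simp
    have "d \<le> cmod z - R"
      unfolding d_def z_def using assms norm_\<omega>_ge[of w] by (simp add: T_def)
    then show "AE s in M. d \<le> cmod (z - of_real s)"
      using AE_dist_lower[of z] by (auto elim!: eventually_mono)
  qed
  have "\<tau> * cauchy_sq M z \<le> \<tau> * (1 / d\<^sup>2)"
    using integrable_cauchy(4)[OF d] tau_pos by (intro mult_left_mono) (simp_all add: prob_space)
  also have "\<dots> = 1 / 2"
    unfolding d_def using tau_pos by simp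
  finally have "Im z * (1 / 2) \<le> Im (H z)"
    unfolding Im_H[OF z(1)] using z(1) by (intro mult_left_mono) auto
  then show ?thesis
    unfolding z(2) by (simp add: z_def)
qed

text \<open>Stieltjes inversion: the density should be - Im / pi of the boundary value of G(\<omega>
  w) = (w - \<omega> w) / \<open>\<tau>\<close>, and a real w contributes nothing to the imaginary
  part.\<close>

definition p :: "real \<Rightarrow> real" where
  "p t = Im (\<Omega> (of_real t)) / (pi * \<tau>)"

lemma p_nonneg: "p t \<ge> 0"
  unfolding p_def using tau_pos by (intro divide_nonneg_pos Im_\<Omega>_nonneg) auto

lemma continuous_p: "continuous_on UNIV p"
  unfolding p_def
  by (intro continuous_intros continuous_on_compose2[OF continuous_on_\<Omega>]) (use tau_pos in auto)

lemma p_eq_0: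
  assumes "\<bar>t\<bar> \<ge> T"
  shows "p t = 0"
proof -
  have "(\<lambda>n. Im (\<omega> (above (of_real t) n))) \<longlonglongrightarrow> Im (\<Omega> (of_real t))"
    by (intro tendsto_Im \<Omega>_tendsto) simp
  moreover have "(\<lambda>n. 2 * inverse (real (Suc n))) \<longlonglongrightarrow> 2 * 0"
    by (intro tendsto_intros LIMSEQ_inverse_real_of_nat)
  moreover have "Im (\<omega> (above (of_real t) n)) \<le> 2 * inverse (real (Suc n))" for n
  proof -
    have "T \<le> cmod (above (of_real t) n)"
      using assms abs_Re_le_cmod[of "above (of_real t) n"] by (simp add: above_def)
    then show ?thesis
      using Im_\<omega>_le[of "above (of_real t) n"] Im_above_pos[of "of_real t" n] by (simp add: Im_above)
  qed
  ultimately have "Im (\<Omega> (of_real t)) \<le> 2 * 0"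
    by (meson LIMSEQ_le)
  then have "Im (\<Omega> (of_real t)) = 0"
    using Im_\<Omega>_nonneg[of "of_real t"] by simp
  then show ?thesis
    by (simp add: p_def)
qed

lemma p_measurable [measurable]: "p \<in> borel_measurable borel"
  using continuous_p by (rule borel_measurable_continuous_onI)

lemma p_bounded: obtains B where "\<And>t. \<bar>p t\<bar> \<le> B"
proof -
  have "compact (p ` {-T..T})"
    by (intro compact_continuous_image continuous_on_subset[OF continuous_p]) auto
  then obtain B where B: "\<forall>x\<in>p ` {-T..T}. norm x \<le> B"
    using compact_imp_bounded bounded_iff by metis
  have "\<bar>p t\<bar> \<le> max B 0" for t
  proof (cases "\<bar>t\<bar> \<ge> T")
    case False
    then have "t \<in> {-T..T}"
      by auto
    then show ?thesis
      using B by force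
  qed (simp add: p_eq_0)
  then show ?thesis
    by (rule that)
qed

lemma p_uniformly_continuous:
  assumes "\<eta> > 0"
  obtains \<delta> where "\<delta> > 0" "\<And>s t. \<bar>s - t\<bar> < \<delta> \<Longrightarrow> \<bar>p s - p t\<bar> \<le> \<eta>"
proof -
  \<comment> \<open>Together with \<open>min d 1\<close> the margin 1 ensures that, as soon as one
    of two close points leaves this interval, both lie where \<open>p\<close> vanishes.\<close>
  have "uniformly_continuous_on {-T-1..T+1} p"
    by (intro compact_uniformly_continuous continuous_on_subset[OF continuous_p]) auto
  then obtain d where d: "d > 0" "\<And>s t. s \<in> {-T-1..T+1} \<Longrightarrow> t \<in> {-T-1..T+1} \<Longrightarrow> dist s t < d \<Longrightarrow> dist (p s) (p t) < \<eta>"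
    using assms unfolding uniformly_continuous_on_def by metis
  have "\<bar>p s - p t\<bar> \<le> \<eta>" if "\<bar>s - t\<bar> < min d 1" for s t
  proof (cases "s \<in> {-T-1..T+1} \<and> t \<in> {-T-1..T+1}")
    case True
    then show ?thesis
      using d(2)[of s t] that by (simp add: dist_real_def)
  next
    case False
    then have "\<bar>s\<bar> \<ge> T" "\<bar>t\<bar> \<ge> T"
      using that by auto
    then show ?thesis
      using p_eq_0 assms by simp
  qed
  then show ?thesis
    using d(1) by (intro that[of "min d 1"]) auto
qed

end

section \<open>Identification of the free convolution\<close>

text \<open>By the open mapping theorem the image would otherwise be open, and an open set is not
  contained in the real axis.\<close>

lemma holomorphic_constant_on_halfplane:
  assumes "f holomorphic_on {w. Im w > 0}" "\<And>w. Im w > 0 \<Longrightarrow> Im (f w) = 0"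
  shows "f constant_on {w. Im w > 0}"
proof (rule ccontr)
  let ?U = "{w. Im w > 0}"
  assume "\<not> f constant_on ?U"
  then have "open (f ` ?U)"
    using assms(1) convex_halfspace_Im_gt[of 0]
    by (intro open_mapping_thm[of f ?U]) (auto simp: open_halfspace_Im_gt convex_connected)
  moreover have "f \<i> \<in> f ` ?U"
    by auto
  ultimately obtain e where e: "e > 0" "ball (f \<i>) e \<subseteq> f ` ?U"
    unfolding open_contains_ball by blast
  have "f \<i> + \<i> * of_real (e / 2) \<in> ball (f \<i>) e"
    using e by (simp add: dist_norm norm_mult)
  then obtain u where "Im u > 0" "f \<i> + \<i> * of_real (e / 2) = f u"
    using e(2) by blast
  then have "Im (f \<i> + \<i> * of_real (e / 2)) = 0"
    using assms(2) by simp
  then show False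
    using assms(2)[of \<i>] e(1) by simp
qed

section \<open>Power series expansions at infinity\<close>

definition cmgf :: "real measure \<Rightarrow> complex fps" where
  "cmgf M = Abs_fps (\<lambda>n. of_real (moment M n))"

context bounded_measure
begin

lemma has_fps_expansion_cmgf: "(\<lambda>u. \<integral>s. 1 / (1 - u * of_real s) \<partial>M) has_fps_expansion cmgf M"
proof (rule has_fps_expansionI)
  \<comment> \<open>\<open>R + 1\<close> in place of \<open>R\<close> because \<open>R = 0\<close>
    occurs, for the point mass at the origin.\<close>
  have "\<forall>\<^sub>F u in nhds (0::complex). dist u 0 < inverse (R + 1)"
    using R_nonneg unfolding eventually_nhds_metric by (intro exI[of _ "inverse (R + 1)"]) auto
  then show "\<forall>\<^sub>F u in nhds 0. (\<lambda>n. cmgf M $ n * u ^ n) sums (\<integral>s. 1 / (1 - u * of_real s) \<partial>M)"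
  proof eventually_elim
    case (elim u)
    have uR: "cmod u * R < 1"
    proof -
      have "cmod u * R \<le> cmod u * (R + 1)"
        by (intro mult_left_mono) auto
      also have "\<dots> < 1"
        using elim R_nonneg by (simp add: field_simps)
      finally show ?thesis .
    qed
    have "summable (\<lambda>n. norm (u ^ n) * R ^ n)"
      using uR R_nonneg by (simp add: norm_power summable_geometric flip: power_mult_distrib)
    from moment_sums_integral[OF this]
    have "(\<lambda>n. u ^ n * of_real (moment M n)) sums (\<integral>s. (\<Sum>n. u ^ n * of_real s ^ n) \<partial>M)" .
    also have "(\<integral>s. (\<Sum>n. u ^ n * of_real s ^ n) \<partial>M) = (\<integral>s. 1 / (1 - u * of_real s) \<partial>M)"
    proof (rule integral_cong_AE)
      show "AE s in M. (\<Sum>n. u ^ n * of_real s ^ n) = 1 / (1 - u * of_real s)"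
        using AE_bound
      proof eventually_elim
        case (elim s)
        have "cmod (u * of_real s) \<le> cmod u * R"
          using elim by (simp add: norm_mult mult_left_mono)
        then show ?case
          using uR by (simp add: suminf_geometric flip: power_mult_distrib)
      qed
    qed measurable
    finally show ?case
      by (simp add: cmgf_def mult.commute)
  qed
qed

lemma cauchy_inverse: "u \<noteq> 0 \<Longrightarrow> cauchy M (1 / u) = u * (\<integral>s. 1 / (1 - u * of_real s) \<partial>M)"
  unfolding cauchy_def
  by (subst integral_mult_right_zero[symmetric]) (auto intro!: Bochner_Integration.integral_cong simp: field_simps)

end

text \<open>With u = 1 / z the upper half plane becomes the lower one, and only there is the
  subordination relation available; analytic continuation extends it to a full neighbourhood of
  0.\<close>

lemma has_fps_expansion_zero_on_lower_halfplane:
  assumes f: "f has_fps_expansion F" and 0: "\<forall>\<^sub>F u in nhds 0. Im u < 0 \<longrightarrow> f u = 0"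
  shows "F = 0"
proof -
  obtain S where S: "open S" "0 \<in> S" "f holomorphic_on S"
    using has_fps_expansion_imp_holomorphic[OF f] by metis
  obtain e where e: "e > 0" "ball 0 e \<subseteq> S"
    using S by (auto simp: open_contains_ball)
  obtain d where d: "d > 0" "\<And>u. dist u 0 < d \<Longrightarrow> Im u < 0 \<Longrightarrow> f u = 0"
    using 0 by (auto simp: eventually_nhds_metric)
  define r where "r = min d e"
  have r: "r > 0"
    unfolding r_def using d e by simp
  have zero: "f u = 0" if "u \<in> ball 0 r" for u
  proof (rule analytic_continuation_open[of "ball 0 r \<inter> {u. Im u < 0}" "ball 0 r" f "\<lambda>_. 0"])
    show "open (ball 0 r \<inter> {u. Im u < 0})"
      by (intro open_Int open_halfspace_Im_lt open_ball)
    have "- (\<i> * of_real (r / 2)) \<in> ball 0 r \<inter> {u. Im u < 0}"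
      using r by (simp add: dist_norm norm_mult)
    then show "ball 0 r \<inter> {u. Im u < 0} \<noteq> {}"
      by blast
    show "f holomorphic_on ball 0 r"
      by (rule holomorphic_on_subset[OF S(3)]) (use e r_def in auto)
  qed (use that d(2) in \<open>auto simp: r_def\<close>)
  have "\<forall>\<^sub>F u in nhds 0. u \<in> ball 0 r"
    using r by (intro eventually_nhds_in_open) auto
  then have "\<forall>\<^sub>F u in nhds 0. f u = 0"
    by eventually_elim (rule zero)
  then have "f has_fps_expansion 0"
    unfolding has_fps_expansion_def by (auto elim!: eventually_mono)
  with f show ?thesis
    by (rule fps_expansion_unique_complex)
qed

text \<open>Cumulants live in real series, whereas the comparison of expansions is complex; the
  injectivity of this embedding brings the result back.\<close>

definition fps_complex :: "real fps \<Rightarrow> complex fps" where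
  "fps_complex f = Abs_fps (\<lambda>n. of_real (f $ n))"

lemma fps_complex_nth [simp]: "fps_complex f $ n = of_real (f $ n)"
  by (simp add: fps_complex_def)

lemma fps_complex_inj: "fps_complex f = fps_complex g \<longleftrightarrow> f = g"
  by (simp add: fps_eq_iff)

lemma fps_complex_mult: "fps_complex (f * g) = fps_complex f * fps_complex g"
  by (simp add: fps_eq_iff fps_mult_nth)

lemma fps_complex_1: "fps_complex 1 = 1" and fps_complex_X: "fps_complex fps_X = fps_X"
  and fps_complex_const: "fps_complex (fps_const c) = fps_const (of_real c)"
  and fps_complex_add: "fps_complex (f + g) = fps_complex f + fps_complex g"
  by (simp_all add: fps_eq_iff)

lemma fps_complex_power: "fps_complex (f ^ n) = fps_complex f ^ n"
  by (induction n) (simp_all add: fps_complex_1 fps_complex_mult)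

lemma fps_complex_compose: "fps_complex (f oo g) = fps_complex f oo fps_complex g"
  by (simp add: fps_eq_iff fps_compose_nth flip: fps_complex_power)

lemma fps_complex_inverse:
  assumes "f $ 0 \<noteq> 0"
  shows "fps_complex (inverse f) = inverse (fps_complex f)"
proof -
  have "fps_complex f * fps_complex (inverse f) = 1"
    using inverse_mult_eq_1[OF assms] by (simp add: fps_complex_1 mult.commute flip: fps_complex_mult)
  then show ?thesis
    by (intro fps_inverse_unique[symmetric])
qed

lemma cmgf_eq: "cmgf M = fps_complex (mgf M)"
  by (simp add: fps_eq_iff cmgf_def mgf_def)

context semicircular_flow
begin

definition \<rho> :: "real measure" where
  "\<rho> = density lborel (\<lambda>t. ennreal (p t))"

lemma integrable_p: "integrable lborel p"
proof -
  obtain B where B: "\<And>t. \<bar>p t\<bar> \<le> B"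
    using p_bounded by blast
  have "integrable lborel (\<lambda>t. indicator {-T..T} t *\<^sub>R B)"
    by (rule integrable_indicator) (auto simp: emeasure_lborel_Icc_eq)
  then show ?thesis
  proof (rule Bochner_Integration.integrable_bound)
    have "norm (p t) \<le> norm (indicator {-T..T} t *\<^sub>R B)" for t
      using B[of t] p_eq_0[of t] by (auto simp: indicator_def)
    then show "AE t in lborel. norm (p t) \<le> norm (indicator {-T..T} t *\<^sub>R B)"
      by simp
  qed simp
qed

lemma \<rho>_bounded_measure: "bounded_measure \<rho> T"
  unfolding bounded_measure_def bounded_measure_axioms_def
proof (intro conjI finite_measureI)
  have "emeasure \<rho> (space \<rho>) = (\<integral>\<^sup>+t. ennreal (p t) \<partial>lborel)"
    unfolding \<rho>_def by (subst emeasure_density) auto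
  also have "\<dots> = ennreal (integral\<^sup>L lborel p)"
    using integrable_p p_nonneg by (intro nn_integral_eq_integral) auto
  finally show "emeasure \<rho> (space \<rho>) \<noteq> \<infinity>"
    by simp
  show "sets \<rho> = sets borel"
    by (simp add: \<rho>_def)
  show "0 \<le> T"
    using T_pos by simp
  show "AE s in \<rho>. \<bar>s\<bar> \<le> T"
  proof -
    have "ennreal (p s) > 0 \<longrightarrow> \<bar>s\<bar> \<le> T" for s
      using p_eq_0[of s] by (cases "\<bar>s\<bar> \<le> T") auto
    then show ?thesis
      unfolding \<rho>_def by (subst AE_density) auto
  qed
qed

sublocale \<rho>: bounded_measure \<rho> T
  by (rule \<rho>_bounded_measure)

lemma cauchy_sq_\<rho>: "cauchy_sq \<rho> (Complex x y) = (\<integral>t. p t * (1 / ((t - x)\<^sup>2 + y\<^sup>2)) \<partial>lborel)"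
  unfolding cauchy_sq_def \<rho>_def
  by (subst integral_density) (auto simp: p_nonneg cmod_power2 power2_commute)

text \<open>\<open>G\<^sub>\<rho>\<close> and \<open>G \<circ> \<omega>\<close> have the same imaginary part on the real line, by Poisson's formula,
  and both vanish at infinity; the maximum principle makes them equal.\<close>

definition defect :: "complex \<Rightarrow> complex" where
  "defect w = cauchy M (\<omega> w) - cauchy \<rho> w"

lemma defect_holomorphic: "defect holomorphic_on {w. Im w > 0}"
proof -
  have "(\<lambda>w. (w - \<omega> w) / \<tau>) holomorphic_on {w. Im w > 0}"
    using tau_pos by (intro holomorphic_intros holomorphic_\<omega>) auto
  then have "(\<lambda>w. (w - \<omega> w) / \<tau> - cauchy \<rho> w) holomorphic_on {w. Im w > 0}"
    by (intro holomorphic_on_diff \<rho>.holomorphic_cauchy)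
  then show ?thesis
    by (rule holomorphic_transform) (simp add: defect_def cauchy_\<omega>)
qed

text \<open>At distance at least d from the support a Cauchy transform is at most mass / d, and
  |\<omega> w| >= |w| - sqrt \<open>\<tau>\<close> carries this over to G(\<omega> w).\<close>

lemma defect_at_infinity:
  assumes "\<eta> > 0"
  obtains L where "L > 0" "\<And>w. Im w > 0 \<Longrightarrow> cmod w \<ge> L \<Longrightarrow> cmod (defect w) \<le> \<eta>"
proof -
  define m where "m = measure \<rho> (space \<rho>)"
  \<comment> \<open>Chosen so that 1 / d + m / d is at most \<open>\<eta>\<close>; the mass m of
    \<open>\<rho>\<close> is not yet known to be 1.\<close>
  define d where "d = (1 + m) / \<eta> + 1"
  have m: "m \<ge> 0"
    by (simp add: m_def)
  have d: "d > 0" "(1 + m) / d \<le> \<eta>"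
  proof -
    have "(1 + m) / \<eta> \<ge> 0"
      using m assms by simp
    then show "d > 0"
      by (simp add: d_def)
    have "1 + m \<le> \<eta> * d"
      unfolding d_def using assms m by (simp add: field_simps)
    then show "(1 + m) / d \<le> \<eta>"
      using \<open>d > 0\<close> by (simp add: divide_simps mult.commute)
  qed
  define L where "L = R + sqrt \<tau> + T + d"
  have "cmod (defect w) \<le> \<eta>" if w: "Im w > 0" "cmod w \<ge> L" for w
  proof -
    have "d \<le> cmod (\<omega> w) - R"
      using w norm_\<omega>_ge[of w] T_pos by (simp add: L_def)
    then have "AE s in M. d \<le> cmod (\<omega> w - of_real s)"
      using AE_dist_lower[of "\<omega> w"] by (auto elim!: eventually_mono)
    from integrable_cauchy(3)[OF d(1) this] have 1: "cmod (cauchy M (\<omega> w)) \<le> 1 / d"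
      by (simp add: prob_space)
    have "d \<le> cmod w - T"
      using w R_nonneg real_sqrt_gt_zero[OF tau_pos] unfolding L_def by linarith
    then have "AE s in \<rho>. d \<le> cmod (w - of_real s)"
      using \<rho>.AE_dist_lower[of w] by (auto elim!: eventually_mono)
    from \<rho>.integrable_cauchy(3)[OF d(1) this] have 2: "cmod (cauchy \<rho> w) \<le> m / d"
      by (simp add: m_def)
    have "cmod (defect w) \<le> 1 / d + m / d"
      unfolding defect_def using 1 2 norm_triangle_ineq4[of "cauchy M (\<omega> w)" "cauchy \<rho> w"] by linarith
    also have "\<dots> \<le> \<eta>"
      using d(2) by (simp add: add_divide_distrib)
    finally show ?thesis .
  qed
  moreover have "L > 0"
    unfolding L_def using R_nonneg tau_pos T_pos d(1) by (intro add_nonneg_pos) auto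
  ultimately show ?thesis
    using that by blast
qed

text \<open>At x + i y the imaginary part is y / \<open>\<tau>\<close> - Im \<omega> /
  \<open>\<tau>\<close> + y * \<open>cauchy_sq \<rho>\<close>. The second term tends to - pi p(x) by
  continuity of \<open>\<Omega>\<close>, the third to + pi p(x) as a Poisson integral, both
  uniformly for |x| <= L.\<close>

lemma Im_defect_at_boundary:
  assumes "\<eta> > 0"
  obtains e where "e > 0" "\<And>x y. \<bar>x\<bar> \<le> L \<Longrightarrow> 0 < y \<Longrightarrow> y \<le> e \<Longrightarrow> \<bar>Im (defect (Complex x y))\<bar> \<le> \<eta>"
proof -
  \<comment> \<open>The terms cost one share for y / \<open>\<tau>\<close>, one for
    \<open>\<omega>\<close> and two for the Poisson integral.\<close>
  define \<eta>' where "\<eta>' = \<eta> / 4"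
  have \<eta>': "\<eta>' > 0"
    using assms by (simp add: \<eta>'_def)
  obtain B where B: "\<And>t. \<bar>p t\<bar> \<le> B"
    using p_bounded by blast
  have B0: "B \<ge> 0"
    using B[of 0] by linarith
  obtain \<delta> where \<delta>: "\<delta> > 0" "\<And>s t. \<bar>s - t\<bar> < \<delta> \<Longrightarrow> \<bar>p s - p t\<bar> \<le> \<eta>' / pi"
    using p_uniformly_continuous[of "\<eta>' / pi"] \<eta>' by auto
  let ?S = "{w. Im w \<ge> 0} \<inter> cball 0 (\<bar>L\<bar> + 1)"
  have "compact ?S"
    using closed_halfspace_Im_ge[of 0] by (intro closed_Int_compact) auto
  then have "uniformly_continuous_on ?S \<Omega>"
    by (intro compact_uniformly_continuous continuous_on_subset[OF continuous_on_\<Omega>]) auto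
  then obtain \<delta>' where \<delta>': "\<delta>' > 0"
    "\<And>w w'. w \<in> ?S \<Longrightarrow> w' \<in> ?S \<Longrightarrow> dist w' w < \<delta>' \<Longrightarrow> dist (\<Omega> w') (\<Omega> w) < \<eta>' * \<tau>"
    using \<eta>' tau_pos unfolding uniformly_continuous_on_def by (metis mult_pos_pos)
  \<comment> \<open>In this order the entries keep the points in the compact set \<open>?S\<close>,
    bring \<open>\<Omega>\<close> close to its boundary value, make y / \<open>\<tau>\<close> small,
    and bound the far part of the Poisson integral.\<close>
  define e where "e = Min {1, \<delta>' / 2, \<eta>' * \<tau>, \<eta>' / (4 * (B + 1) * (pi / \<delta>))}"
  have "e > 0"
    unfolding e_def using \<delta>' \<delta> \<eta>' tau_pos B0 by (simp add: Min_gr_iff)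
  moreover have "\<bar>Im (defect (Complex x y))\<bar> \<le> \<eta>" if x: "\<bar>x\<bar> \<le> L" and y: "0 < y" "y \<le> e" for x y
  proof -
    have e: "y \<le> 1" "y < \<delta>'" "y \<le> \<eta>' * \<tau>" "y \<le> \<eta>' / (4 * (B + 1) * (pi / \<delta>))"
      using y \<delta>'(1) by (auto simp: e_def)
    let ?w = "Complex x y"
    have "cmod ?w \<le> \<bar>x\<bar> + \<bar>y\<bar>"
      using cmod_le[of ?w] by simp
    then have "?w \<in> ?S" "of_real x \<in> ?S"
      using x y e(1) by auto
    moreover have "dist ?w (of_real x) < \<delta>'"
      using y e(2) by (simp add: dist_norm complex_of_real_def cmod_def)
    ultimately have "dist (\<Omega> ?w) (\<Omega> (of_real x)) < \<eta>' * \<tau>"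
      using \<delta>'(2) by blast
    then have "\<bar>Im (\<omega> ?w) - Im (\<Omega> (of_real x))\<bar> \<le> \<eta>' * \<tau>"
      using abs_Im_le_cmod[of "\<Omega> ?w - \<Omega> (of_real x)"] y by (simp add: dist_norm \<Omega>_eq_\<omega>)
    then have 1: "\<bar>Im (\<omega> ?w) / \<tau> - pi * p x\<bar> \<le> \<eta>'"
      using tau_pos unfolding p_def by (simp add: abs_le_iff field_simps)
    have "\<bar>y * cauchy_sq \<rho> ?w - pi * p x\<bar> \<le> pi * (\<eta>' / pi) + 4 * B * y * (pi / \<delta>)"
      unfolding cauchy_sq_\<rho> using B \<delta> y by (intro poisson_approx) auto
    also have "4 * B * y * (pi / \<delta>) \<le> y * (4 * (B + 1) * (pi / \<delta>))"
      using y \<delta> by (simp add: field_simps)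
    also have "\<dots> \<le> \<eta>'"
      using e(4) B0 \<delta>(1) by (subst (asm) pos_le_divide_eq) auto
    finally have 2: "\<bar>y * cauchy_sq \<rho> ?w - pi * p x\<bar> \<le> \<eta>' + \<eta>'"
      by simp
    have "y / \<tau> \<le> \<eta>'"
      using e(3) tau_pos by (simp add: field_simps)
    moreover have "y / \<tau> \<ge> 0"
      using y tau_pos by simp
    moreover have "Im (defect ?w) = y / \<tau> - Im (\<omega> ?w) / \<tau> + y * cauchy_sq \<rho> ?w"
      unfolding defect_def using y by (simp add: cauchy_\<omega> \<rho>.Im_cauchy[OF _ \<rho>.upper_dist] diff_divide_distrib)
    ultimately show ?thesis
      using 1 2 unfolding \<eta>'_def by linarith
  qed
  ultimately show ?thesis
    using that by blast
qed

lemma Im_defect_eq_0: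
  assumes w: "Im w > 0"
  shows "Im (defect w) = 0"
proof -
  have "\<bar>Im (defect w)\<bar> \<le> \<eta>" if \<eta>: "\<eta> > 0" for \<eta>
  proof -
    obtain L0 where L0: "L0 > 0" "\<And>w. Im w > 0 \<Longrightarrow> cmod w \<ge> L0 \<Longrightarrow> cmod (defect w) \<le> \<eta>"
      using defect_at_infinity[OF \<eta>] by blast
    define L where "L = max L0 (cmod w + 1)"
    obtain e0 where e0: "e0 > 0" "\<And>x y. \<bar>x\<bar> \<le> L \<Longrightarrow> 0 < y \<Longrightarrow> y \<le> e0 \<Longrightarrow> \<bar>Im (defect (Complex x y))\<bar> \<le> \<eta>"
      using Im_defect_at_boundary[OF \<eta>, of L] by blast
    define e where "e = min e0 (Im w / 2)"
    have e: "e > 0" "e \<le> e0" "e < Im w"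
      unfolding e_def using e0 w by auto
    \<comment> \<open>The frontier consists of points at height \<open>e\<close>, where the boundary
      estimate applies, and points of modulus \<open>L\<close>, where the decay at infinity
      applies.\<close>
    define S where "S = {u. Im u > e} \<inter> ball 0 L"
    have "open S"
      unfolding S_def by (intro open_Int open_halfspace_Im_gt open_ball)
    then have int: "interior S = S"
      by (rule interior_open)
    have "closed ({u. Im u \<ge> e} \<inter> cball 0 L)"
      using closed_halfspace_Im_ge[of e] by (intro closed_Int) auto
    then have cl: "closure S \<subseteq> {u. Im u \<ge> e} \<inter> cball 0 L"
      by (intro closure_minimal) (auto simp: S_def)
    have fr: "\<bar>Im (defect u)\<bar> \<le> \<eta>" if "u \<in> frontier S" for u
    proof -
      have u: "Im u \<ge> e" "cmod u \<le> L" "\<not> (Im u > e \<and> cmod u < L)"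
      proof -
        have "u \<in> closure S" "u \<notin> S"
          using that unfolding frontier_def int by auto
        then show "Im u \<ge> e" "cmod u \<le> L" "\<not> (Im u > e \<and> cmod u < L)"
          using cl by auto (simp add: S_def)
      qed
      show ?thesis
      proof (cases "Im u > e")
        case True
        then have "cmod (defect u) \<le> \<eta>"
          using u e(1) by (intro L0(2)) (auto simp: L_def)
        then show ?thesis
          using abs_Im_le_cmod[of "defect u"] by linarith
      next
        case False
        then show ?thesis
          using e0(2)[of "Re u" "Im u"] u e abs_Re_le_cmod[of u] by (simp add: complex_surj)
      qed
    qed
    have hol: "defect holomorphic_on interior S"
      unfolding int using defect_holomorphic by (rule holomorphic_on_subset) (use e in \<open>auto simp: S_def\<close>)
    have cont: "continuous_on (closure S) defect"
      using cl e(1) by (intro holomorphic_on_imp_continuous_on holomorphic_on_subset[OF defect_holomorphic]) auto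
    have "bounded S"
      by (rule bounded_subset[of "ball 0 L"]) (auto simp: S_def)
    moreover have "w \<in> S"
      using e by (simp add: S_def L_def)
    \<comment> \<open>The maximum principle bounds real parts from above; multiplication by i and by
      -i gives both signs of the imaginary part.\<close>
    ultimately have "Re (c * defect w) \<le> \<eta>" if "c = \<i> \<or> c = - \<i>" for c
    proof (rule_tac maximum_real_frontier[of "\<lambda>u. c * defect u" S])
      show "(\<lambda>u. c * defect u) holomorphic_on interior S" "continuous_on (closure S) (\<lambda>u. c * defect u)"
        by (intro holomorphic_on_mult holomorphic_on_const hol continuous_on_mult continuous_on_const cont)+
      fix u assume "u \<in> frontier S"
      from fr[OF this] show "Re (c * defect u) \<le> \<eta>"
        using that by auto
    qed
    from this[of \<i>] this[of "- \<i>"] show ?thesis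
      by simp
  qed
  from this[of "\<bar>Im (defect w)\<bar> / 2"] show ?thesis
    by (cases "Im (defect w) = 0") auto
qed

lemma cauchy_\<rho>:
  assumes w: "Im w > 0"
  shows "cauchy \<rho> w = cauchy M (\<omega> w)"
proof -
  obtain c where c: "\<And>w. Im w > 0 \<Longrightarrow> defect w = c"
    using holomorphic_constant_on_halfplane[OF defect_holomorphic Im_defect_eq_0]
    unfolding constant_on_def by auto
  have "cmod c \<le> \<eta>" if \<eta>: "\<eta> > 0" for \<eta>
  proof -
    obtain L where L: "L > 0" "\<And>w. Im w > 0 \<Longrightarrow> cmod w \<ge> L \<Longrightarrow> cmod (defect w) \<le> \<eta>"
      using defect_at_infinity[OF \<eta>] by blast
    have "cmod (defect (\<i> * of_real L)) \<le> \<eta>"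
      using L(1) by (intro L(2)) (auto simp: norm_mult)
    then show ?thesis
      using c[of "\<i> * of_real L"] L(1) by simp
  qed
  from this[of "cmod c / 2"] have "c = 0"
    by (cases "c = 0") auto
  then show ?thesis
    using c[OF w] by (simp add: defect_def)
qed

text \<open>With u = 1 / z one has f(u) = G(z) and E(u) = 1 / H(z), so the claim is the expansion of
  G_rho(H z) = G(z). For large z in the upper half plane this is \<open>cauchy_\<rho>\<close> at w =
  H z, where \<omega>(H z) = z.\<close>

lemma mgf_subordination:
  "(fps_X * mgf \<rho>) oo (fps_X * inverse (1 + fps_const \<tau> * fps_X * (fps_X * mgf M))) = fps_X * mgf M"
proof -
  define f where "f u = u * (\<integral>s. 1 / (1 - u * of_real s) \<partial>M)" for u :: complex
  define g where "g u = u * (\<integral>s. 1 / (1 - u * of_real s) \<partial>\<rho>)" for u :: complex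
  define E where "E u = u * inverse (1 + of_real \<tau> * u * f u)" for u :: complex
  define FE :: "complex fps" where "FE = fps_X * inverse (1 + fps_const (of_real \<tau>) * fps_X * (fps_X * cmgf M))"
  have f: "f has_fps_expansion fps_X * cmgf M"
    unfolding f_def by (intro has_fps_expansion_mult has_fps_expansion_fps_X has_fps_expansion_cmgf)
  have g: "g has_fps_expansion fps_X * cmgf \<rho>"
    unfolding g_def by (intro has_fps_expansion_mult has_fps_expansion_fps_X \<rho>.has_fps_expansion_cmgf)
  have E: "E has_fps_expansion FE"
    unfolding E_def FE_def
    by (intro has_fps_expansion_mult has_fps_expansion_fps_X has_fps_expansion_inverse
        has_fps_expansion_add has_fps_expansion_1 has_fps_expansion_const f) simp
  have gE: "(g \<circ> E) has_fps_expansion ((fps_X * cmgf \<rho>) oo FE)"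
    by (intro has_fps_expansion_compose g E) (simp add: FE_def)
  have "(\<lambda>u. (g \<circ> E) u - f u) has_fps_expansion ((fps_X * cmgf \<rho>) oo FE) - fps_X * cmgf M"
    by (intro has_fps_expansion_diff gE f)
  then have "((fps_X * cmgf \<rho>) oo FE) - fps_X * cmgf M = 0"
  proof (rule has_fps_expansion_zero_on_lower_halfplane)
    \<comment> \<open>For |z| >= d the support is at distance at least sqrt(2
      \<open>\<tau>\<close>), so \<open>\<tau> * cauchy_sq M z\<close> is at most 1/2 and H z stays
      in the upper half plane.\<close>
    define d where "d = R + sqrt (2 * \<tau>)"
    have d: "d > 0"
      unfolding d_def using R_nonneg tau_pos by (intro add_nonneg_pos) auto
    then have "\<forall>\<^sub>F u in nhds (0::complex). dist u 0 < inverse d"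
      unfolding eventually_nhds_metric by (intro exI[of _ "inverse d"]) auto
    then show "\<forall>\<^sub>F u in nhds 0. Im u < 0 \<longrightarrow> (g \<circ> E) u - f u = 0"
    proof (eventually_elim, intro impI)
      fix u :: complex assume u: "dist u 0 < inverse d" "Im u < 0"
      then have u0: "u \<noteq> 0"
        by auto
      let ?z = "1 / u"
      have z: "Im ?z > 0"
        using u(2) u0 by (simp add: Im_divide divide_neg_pos sum_power2_gt_zero_iff complex_eq_iff)
      have "cmod ?z \<ge> d"
        using u(1) d u0 by (simp add: norm_divide field_simps)
      then have s: "sqrt (2 * \<tau>) > 0" "AE s in M. sqrt (2 * \<tau>) \<le> cmod (?z - of_real s)"
        using tau_pos AE_dist_lower[of ?z] by (auto simp: d_def elim!: eventually_mono)
      have "\<tau> * cauchy_sq M ?z \<le> \<tau> * (1 / (sqrt (2 * \<tau>))\<^sup>2)"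
        using integrable_cauchy(4)[OF s] tau_pos by (intro mult_left_mono) (simp_all add: prob_space)
      also have "\<dots> < 1"
        using tau_pos by simp
      finally have Hz: "Im (H ?z) > 0"
        using z by (simp add: Im_H_pos_iff)
      have fu: "f u = cauchy M ?z"
        unfolding f_def cauchy_inverse[OF u0] ..
      have Hu: "H ?z = 1 / E u"
        unfolding H_def E_def fu[symmetric] using u0 by (simp add: field_simps)
      have "E u \<noteq> 0"
        using Hz Hu by auto
      then have "g (E u) = cauchy \<rho> (H ?z)"
        unfolding Hu g_def by (rule \<rho>.cauchy_inverse[symmetric])
      also have "\<dots> = cauchy M ?z"
        using z Hz by (simp add: cauchy_\<rho> \<omega>_H)
      finally show "(g \<circ> E) u - f u = 0"
        by (simp add: fu)
    qed
  qed
  then have "(fps_X * fps_complex (mgf \<rho>)) oo (fps_X * inverse (1 + fps_const (of_real \<tau>) * fps_X * (fps_X * fps_complex (mgf M))))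
      = fps_X * fps_complex (mgf M)"
    by (simp add: FE_def cmgf_eq)
  also have "inverse (1 + fps_const (of_real \<tau>) * fps_X * (fps_X * fps_complex (mgf M)))
    = fps_complex (inverse (1 + fps_const \<tau> * fps_X * (fps_X * mgf M)))"
    by (subst fps_complex_inverse) (simp_all add: fps_complex_mult fps_complex_add fps_complex_1 fps_complex_X fps_complex_const)
  finally have "fps_complex ((fps_X * mgf \<rho>) oo (fps_X * inverse (1 + fps_const \<tau> * fps_X * (fps_X * mgf M))))
      = fps_complex (fps_X * mgf M)"
    by (simp only: fps_complex_compose fps_complex_mult fps_complex_X)
  then show ?thesis
    by (simp only: fps_complex_inj)
qed

text \<open>\<open>E\<close> and \<open>fps_X * mgf M\<close> both have linear coefficient 1, so
  comparing linear coefficients in the subordination identity yields the total mass of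
  \<open>\<rho>\<close>.\<close>

lemma bounded_law_\<rho>: "bounded_law \<rho> T"
proof -
  have "((fps_X * mgf \<rho>) oo (fps_X * inverse (1 + fps_const \<tau> * fps_X * (fps_X * mgf M)))) $ 1 = (fps_X * mgf M) $ 1"
    by (simp only: mgf_subordination)
  then have "moment \<rho> 0 = 1"
    using moment_0[OF prob_space_axioms] by (simp add: fps_compose_nth mgf_def)
  then have "measure \<rho> (space \<rho>) = 1"
    by (simp add: moment_def)
  then have "prob_space \<rho>"
    by (intro prob_spaceI) (simp add: \<rho>.emeasure_eq_measure)
  then show ?thesis
    using \<rho>_bounded_measure by (simp add: bounded_law_def)
qed

lemma free_cumulants_\<rho>:
  assumes "free_cumulants M \<kappa>"
  shows "free_cumulants \<rho> (\<lambda>n. \<kappa> n + (if n = 2 then \<tau> else 0))"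
  using bounded_law_\<rho>
  by (intro free_cumulants_subordinated[OF prob_space_axioms _ assms mgf_subordination]) (auto simp: bounded_law_def)

end

section \<open>The semicircle law as the flow started at a point mass\<close>

lemma semicircular_flow_dirac: "\<tau> > 0 \<Longrightarrow> semicircular_flow (return borel 0) 0 \<tau>"
  unfolding semicircular_flow_def semicircular_flow_axioms_def
  by (intro conjI bounded_lawI prob_space_return) (auto simp: AE_return)

text \<open>For the point mass G(z) = 1 / z, so \<open>\<omega>\<close> solves a quadratic equation
  that passes to the boundary. The imaginary part of the root of the closed upper half plane is the
  semicircle.\<close>

lemma semicircle_eq_\<rho>:
  assumes "\<tau> > 0"
  shows "semicircle \<tau> = semicircular_flow.\<rho> (return borel 0) \<tau>"
proof -
  interpret semicircular_flow "return borel 0" 0 \<tau>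
    using assms by (rule semicircular_flow_dirac)
  have cauchy: "cauchy (return borel 0) z = 1 / z" for z
    unfolding cauchy_def by (subst integral_return) auto
  have quadratic: "\<omega> w ^ 2 - w * \<omega> w + \<tau> = 0" if "Im w > 0" for w
  proof -
    have "\<omega> w + \<tau> / \<omega> w = w" "\<omega> w \<noteq> 0"
      using H_\<omega>[OF that] Im_\<omega>[OF that] by (auto simp: H_def cauchy)
    then show ?thesis
      by (simp add: field_simps power2_eq_square)
  qed
  have "p t = indicator {-2 * sqrt \<tau> .. 2 * sqrt \<tau>} t * (sqrt (4 * \<tau> - t\<^sup>2) / (2 * pi * \<tau>))" for t
  proof -
    let ?x = "of_real t :: complex"
    have "(\<lambda>n. \<omega> (above ?x n) ^ 2 - above ?x n * \<omega> (above ?x n) + \<tau>) \<longlonglongrightarrow> \<Omega> ?x ^ 2 - ?x * \<Omega> ?x + \<tau>"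
      by (intro tendsto_intros \<Omega>_tendsto above_tendsto) simp_all
    moreover have "(\<lambda>n. \<omega> (above ?x n) ^ 2 - above ?x n * \<omega> (above ?x n) + \<tau>) = (\<lambda>n. 0)"
      by (intro ext quadratic Im_above_pos) simp
    ultimately have *: "\<Omega> ?x ^ 2 - ?x * \<Omega> ?x + \<tau> = 0"
      by (simp add: LIMSEQ_const_iff)
    define a b where "a = Re (\<Omega> ?x)" and "b = Im (\<Omega> ?x)"
    have ab: "a\<^sup>2 - b\<^sup>2 - t * a + \<tau> = 0" "b * (2 * a - t) = 0"
      using arg_cong[OF *, of Re] arg_cong[OF *, of Im]
      by (simp_all add: a_def b_def power2_eq_square algebra_simps)
    have b0: "b \<ge> 0"
      unfolding b_def by (rule Im_\<Omega>_nonneg) simp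
    have iff: "t \<in> {-2 * sqrt \<tau> .. 2 * sqrt \<tau>} \<longleftrightarrow> t\<^sup>2 \<le> 4 * \<tau>"
    proof -
      have "t\<^sup>2 \<le> 4 * \<tau> \<longleftrightarrow> t\<^sup>2 \<le> (2 * sqrt \<tau>)\<^sup>2"
        using assms by (simp add: power_mult_distrib)
      also have "\<dots> \<longleftrightarrow> \<bar>t\<bar> \<le> 2 * sqrt \<tau>"
        using assms by (subst abs_le_square_iff[symmetric]) simp
      finally show ?thesis
        by (auto simp: abs_le_iff)
    qed
    have "b = indicator {-2 * sqrt \<tau> .. 2 * sqrt \<tau>} t * (sqrt (4 * \<tau> - t\<^sup>2) / 2)"
    proof (cases "b = 0")
      case True
      \<comment> \<open>A real root means a nonnegative discriminant; at t^2 = 4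
        \<open>\<tau>\<close> the square root in the claimed formula is 0 as well.\<close>
      then have "0 \<le> t\<^sup>2 - 4 * \<tau>"
        using ab(1) zero_le_power2[of "t - 2 * a"] by (simp add: power2_eq_square algebra_simps)
      then show ?thesis
        using True iff by (auto simp: indicator_def)
    next
      case False
      \<comment> \<open>Non-real roots are conjugate, so their real part is half of their sum
        t.\<close>
      then have t: "t = 2 * a"
        using ab(2) by simp
      have b2: "4 * \<tau> - t\<^sup>2 = (2 * b)\<^sup>2"
        using ab(1) unfolding t by (simp add: power2_eq_square algebra_simps)
      then have "t\<^sup>2 \<le> 4 * \<tau>"
        using zero_le_power2[of "2 * b"] by linarith
      then show ?thesis
        using iff b0 b2 by (simp add: real_sqrt_mult)
    qed
    then have "b / (pi * \<tau>) = indicator {-2 * sqrt \<tau> .. 2 * sqrt \<tau>} t * (sqrt (4 * \<tau> - t\<^sup>2) / 2) / (pi * \<tau>)"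
      by (rule arg_cong)
    then show ?thesis
      unfolding p_def b_def by (simp add: mult_ac)
  qed
  then show ?thesis
    unfolding semicircle_def \<rho>_def by simp
qed

text \<open>The point mass at 0 has moment series 1, hence zero cumulants, and the flow adds
  \<open>\<tau>\<close> to the second one.\<close>

lemma
  assumes "\<tau> > 0"
  shows prob_space_semicircle: "prob_space (semicircle \<tau>)"
    and free_cumulants_semicircle: "free_cumulants (semicircle \<tau>) (\<lambda>n. if n = 2 then \<tau> else 0)"
proof -
  interpret semicircular_flow "return borel 0" 0 \<tau>
    using assms by (rule semicircular_flow_dirac)
  show "prob_space (semicircle \<tau>)"
    unfolding semicircle_eq_\<rho>[OF assms] using bounded_law_\<rho> by (simp add: bounded_law_def)
  have "moment (return borel 0) n = 0 ^ n" for n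
    unfolding moment_def by (subst integral_return) auto
  then have "mgf (return borel 0) = 1"
    by (auto simp: fps_eq_iff mgf_def)
  moreover have "cgf (\<lambda>_. 0) = 0"
    by (simp add: fps_eq_iff cgf_def)
  ultimately have "free_cumulants (return borel 0) (\<lambda>_. 0)"
    unfolding free_cumulants_iff[OF prob_space_axioms] by simp
  from free_cumulants_\<rho>[OF this]
  show "free_cumulants (semicircle \<tau>) (\<lambda>n. if n = 2 then \<tau> else 0)"
    unfolding semicircle_eq_\<rho>[OF assms] by simp
qed

lemma (in semicircular_flow) free_add_conv_semicircle: "M \<boxplus> semicircle \<tau> = \<rho>"
proof (rule free_add_conv_eqI)
  obtain \<kappa> where \<kappa>: "free_cumulants M \<kappa>"
    using free_cumulants_exists[OF prob_space_axioms] ..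
  have "compactly_supported_prob \<rho>"
    unfolding compactly_supported_prob_iff using bounded_law_\<rho> by blast
  then show "is_free_add_conv M (semicircle \<tau>) \<rho>"
    unfolding is_free_add_conv_def
    using \<kappa> free_cumulants_semicircle[OF tau_pos] free_cumulants_\<rho>[OF \<kappa>]
    by (intro conjI exI[of _ \<kappa>] exI[of _ "\<lambda>n. if n = 2 then \<tau> else 0"] exI[of _ "\<lambda>n. \<kappa> n + (if n = 2 then \<tau> else 0)"]) auto
qed (rule prob_space_axioms prob_space_semicircle[OF tau_pos])+

section \<open>Local analysis at a zero of the density\<close>

text \<open>Dominates the integrand of \<open>Q\<close> near 0: a square root Hoelder bound divided
  by |u|.\<close>

lemma integrable_inverse_sqrt:
  fixes \<delta> :: real
  assumes "\<delta> > 0"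
  shows "integrable lborel (\<lambda>u. indicator {0<..<\<delta>} u / sqrt u)"
proof -
  have F0: "((\<lambda>u. 2 * sqrt u) \<longlongrightarrow> 2 * sqrt 0) (at_right 0)"
    by (intro tendsto_intros)
  have F1: "((\<lambda>u. 2 * sqrt u) \<longlongrightarrow> 2 * sqrt \<delta>) (at_left \<delta>)"
    by (intro tendsto_intros)
  have der: "DERIV (\<lambda>u. 2 * sqrt u) u :> 1 / sqrt u" if "u > 0" for u
    using that by (auto intro!: derivative_eq_intros simp: field_simps)
  have "set_integrable lborel (einterval (ereal 0) (ereal \<delta>)) (\<lambda>u. 1 / sqrt u)"
    using assms F0 F1
    by (intro interval_integral_FTC_nonneg(1)[where F = "\<lambda>u. 2 * sqrt u" and A = 0 and B = "2 * sqrt \<delta>"] der)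
      (auto simp: ereal_tendsto_simps intro!: continuous_intros)
  then show ?thesis
    by (simp add: set_integrable_def)
qed

lemma lborel_integral_shift_reflect:
  fixes f :: "real \<Rightarrow> real"
  shows "(\<integral>s. f s \<partial>lborel) = (\<integral>u. f (x + u) \<partial>lborel)" "(\<integral>s. f s \<partial>lborel) = (\<integral>u. f (x - u) \<partial>lborel)"
    and "integrable lborel f \<Longrightarrow> integrable lborel (\<lambda>u. f (x + u))"
    and "integrable lborel f \<Longrightarrow> integrable lborel (\<lambda>u. f (x - u))"
  using lborel_integral_real_affine[of 1 f x] lborel_integral_real_affine[of "-1" f x]
    lborel_integrable_real_affine[of f 1 x] lborel_integrable_real_affine[of f "-1" x] by auto

text \<open>The bound on the second difference of \<open>\<phi>\<close> is scale invariant, so that it holds both for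
  smooth \<open>\<phi>\<close> and for \<open>\<phi>\<close> with a square root singularity at \<open>xs\<close>.\<close>

locale vanishing_density = semicircular_flow +
  fixes \<psi> \<phi> :: "real \<Rightarrow> real" and xs \<delta> B :: real
  assumes M_eq: "M = density lborel (\<lambda>s. ennreal (\<psi> s))"
    and \<psi>_nonneg: "\<And>s. \<psi> s \<ge> 0"
    and \<psi>_continuous: "continuous_on UNIV \<psi>"
    and \<psi>_eq: "\<And>s. \<psi> s = (s - xs)\<^sup>2 * \<phi> s"
    and \<phi>_measurable [measurable]: "\<phi> \<in> borel_measurable borel"
    and \<phi>_bound: "\<And>s. \<bar>\<phi> s\<bar> \<le> B"
    and \<phi>_integrable: "integrable lborel \<phi>"
    and \<delta>_pos: "\<delta> > 0"
    and \<phi>_hoelder: "\<And>a b. \<bar>a - xs\<bar> \<le> 2 * \<delta> \<Longrightarrow> \<bar>b - xs\<bar> \<le> 2 * \<delta> \<Longrightarrow> \<bar>\<phi> a - \<phi> b\<bar> \<le> B * sqrt \<bar>a - b\<bar>"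
    and \<phi>_second_diff: "\<And>x u. x \<noteq> xs \<Longrightarrow> \<bar>x - xs\<bar> \<le> \<delta> \<Longrightarrow> \<bar>u\<bar> \<le> \<bar>x - xs\<bar> / 2 \<Longrightarrow>
      \<bar>\<phi> (x + u) + \<phi> (x - u) - 2 * \<phi> x\<bar> \<le> B * (u\<^sup>2 / (x - xs)\<^sup>2)"
    and subcritical: "\<tau> * (\<integral>s. \<phi> s \<partial>lborel) < 1"
begin

lemma B_nonneg: "B \<ge> 0"
  using \<phi>_bound[of 0] by linarith

lemma \<psi>_measurable [measurable]: "\<psi> \<in> borel_measurable borel"
  using \<psi>_continuous by (rule borel_measurable_continuous_onI)

lemma \<psi>_integrable: "integrable lborel \<psi>"
proof -
  have "integrable M (\<lambda>_. 1 :: real)"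
    by simp
  then show ?thesis
    unfolding M_eq by (subst (asm) integrable_density) (auto simp: \<psi>_nonneg)
qed

definition A :: real where
  "A = (\<integral>s. \<phi> s \<partial>lborel)"

text \<open>The Cauchy transform of \<open>\<phi>\<close> at x + i v is - \<open>Q x v\<close> - i v
  \<open>P x v\<close>.\<close>

definition P :: "real \<Rightarrow> real \<Rightarrow> real" where
  "P x v = (\<integral>s. \<phi> s * (1 / ((s - x)\<^sup>2 + v\<^sup>2)) \<partial>lborel)"

definition Q :: "real \<Rightarrow> real \<Rightarrow> real" where
  "Q x v = (\<integral>s. \<phi> s * ((s - x) / ((s - x)\<^sup>2 + v\<^sup>2)) \<partial>lborel)"

lemma P_integrable: "v > 0 \<Longrightarrow> integrable lborel (\<lambda>s. \<phi> s * (1 / ((s - x)\<^sup>2 + v\<^sup>2)))"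
proof (rule Bochner_Integration.integrable_bound)
  assume v: "v > 0"
  show "integrable lborel (\<lambda>s. B * (1 / ((s - x)\<^sup>2 + v\<^sup>2)))"
    by (intro integrable_mult_right integrable.intros[OF integral_inverse_square_plus[OF v]])
  show "AE s in lborel. norm (\<phi> s * (1 / ((s - x)\<^sup>2 + v\<^sup>2))) \<le> norm (B * (1 / ((s - x)\<^sup>2 + v\<^sup>2)))"
    unfolding norm_mult using \<phi>_bound B_nonneg by (intro AE_I2 mult_right_mono) auto
qed measurable

lemma vP_bound:
  assumes v: "v > 0"
  shows "\<bar>v * P x v\<bar> \<le> pi * B"
proof -
  note K = integral_inverse_square_plus[OF v, of x]
  have "\<bar>P x v\<bar> \<le> (\<integral>s. \<bar>\<phi> s * (1 / ((s - x)\<^sup>2 + v\<^sup>2))\<bar> \<partial>lborel)"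
    unfolding P_def by (rule integral_abs_bound)
  also have "\<dots> \<le> (\<integral>s. B * (1 / ((s - x)\<^sup>2 + v\<^sup>2)) \<partial>lborel)"
  proof (rule integral_mono)
    show "integrable lborel (\<lambda>s. \<bar>\<phi> s * (1 / ((s - x)\<^sup>2 + v\<^sup>2))\<bar>)"
      using P_integrable[OF v] by (rule integrable_abs)
    show "integrable lborel (\<lambda>s. B * (1 / ((s - x)\<^sup>2 + v\<^sup>2)))"
      by (intro integrable_mult_right integrable.intros[OF K])
    show "\<bar>\<phi> s * (1 / ((s - x)\<^sup>2 + v\<^sup>2))\<bar> \<le> B * (1 / ((s - x)\<^sup>2 + v\<^sup>2))" for s
      unfolding abs_mult using \<phi>_bound by (intro mult_mono) (auto simp: B_nonneg)
  qed
  also have "\<dots> = B * (pi / v)"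
    using has_bochner_integral_integral_eq[OF K] by (simp only: integral_mult_right_zero)
  finally show ?thesis
    using v by (simp add: abs_mult field_simps)
qed

text \<open>Averaging over s = x + u and s = x - u replaces \<open>\<phi>\<close> by its second
  difference. With r = |x - xs|, for |u| <= r / 2 the bound u^2 / r^2 cancels the kernel singularity
  whatever v is; for larger u the kernel is already at most of order 1 / r^2. Both ranges fit under
  a kernel of width r, of mass pi / r.\<close>

lemma P_approx:
  assumes v: "v > 0" and x: "x \<noteq> xs" "\<bar>x - xs\<bar> \<le> \<delta>"
  shows "\<bar>P x v - pi * \<phi> x / v\<bar> \<le> 10 * pi * B / \<bar>x - xs\<bar>"
proof -
  define r where "r = \<bar>x - xs\<bar>"
  have r: "r > 0"
    using x by (simp add: r_def)
  note K = integral_inverse_square_plus[OF v, of 0, simplified]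
  note Kr = integral_inverse_square_plus[OF r, of 0, simplified]
  note I = P_integrable[OF v, of x]
  let ?D = "\<lambda>u. \<phi> (x + u) + \<phi> (x - u) - 2 * \<phi> x"
  have 1: "P x v = (\<integral>u. \<phi> (x + u) * (1 / (u\<^sup>2 + v\<^sup>2)) \<partial>lborel)" "integrable lborel (\<lambda>u. \<phi> (x + u) * (1 / (u\<^sup>2 + v\<^sup>2)))"
    using lborel_integral_shift_reflect(1)[of "\<lambda>s. \<phi> s * (1 / ((s - x)\<^sup>2 + v\<^sup>2))" x]
      lborel_integral_shift_reflect(3)[OF I, of x] by (simp_all add: P_def)
  have 2: "P x v = (\<integral>u. \<phi> (x - u) * (1 / (u\<^sup>2 + v\<^sup>2)) \<partial>lborel)" "integrable lborel (\<lambda>u. \<phi> (x - u) * (1 / (u\<^sup>2 + v\<^sup>2)))"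
    using lborel_integral_shift_reflect(2)[of "\<lambda>s. \<phi> s * (1 / ((s - x)\<^sup>2 + v\<^sup>2))" x]
      lborel_integral_shift_reflect(4)[OF I, of x] by (simp_all add: P_def)
  have 3: "has_bochner_integral lborel (\<lambda>u. 2 * \<phi> x * (1 / (u\<^sup>2 + v\<^sup>2))) (2 * \<phi> x * (pi / v))"
    by (intro has_bochner_integral_mult_right K)
  have "has_bochner_integral lborel (\<lambda>u. \<phi> (x + u) * (1 / (u\<^sup>2 + v\<^sup>2)) + \<phi> (x - u) * (1 / (u\<^sup>2 + v\<^sup>2)) - 2 * \<phi> x * (1 / (u\<^sup>2 + v\<^sup>2)))
      (P x v + P x v - 2 * \<phi> x * (pi / v))"
    using has_bochner_integral_integrable[OF 1(2)] has_bochner_integral_integrable[OF 2(2)]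
    unfolding 1(1)[symmetric] 2(1)[symmetric]
    by (intro has_bochner_integral_diff has_bochner_integral_add 3)
  then have D: "has_bochner_integral lborel (\<lambda>u. ?D u * (1 / (u\<^sup>2 + v\<^sup>2))) (2 * (P x v - pi * \<phi> x / v))"
    by (simp add: algebra_simps add_divide_distrib diff_divide_distrib)
  have "\<bar>2 * (P x v - pi * \<phi> x / v)\<bar> \<le> (\<integral>u. \<bar>?D u * (1 / (u\<^sup>2 + v\<^sup>2))\<bar> \<partial>lborel)"
    unfolding has_bochner_integral_integral_eq[OF D, symmetric] by (rule integral_abs_bound)
  \<comment> \<open>20 = 4 * 5 is dictated by |u| > r / 2: the second difference is at most 4 B, and
    u^2 + r^2 <= 5 u^2.\<close>
  also have "\<dots> \<le> (\<integral>u. 20 * B * (1 / (u\<^sup>2 + r\<^sup>2)) \<partial>lborel)"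
  proof (rule integral_mono)
    show "integrable lborel (\<lambda>u. \<bar>?D u * (1 / (u\<^sup>2 + v\<^sup>2))\<bar>)"
      using integrable.intros[OF D] by (rule integrable_abs)
    show "integrable lborel (\<lambda>u. 20 * B * (1 / (u\<^sup>2 + r\<^sup>2)))"
      by (intro integrable_mult_right integrable.intros[OF Kr])
    fix u :: real
    have v2: "v\<^sup>2 > 0" and r2: "r\<^sup>2 > 0"
      using v r by auto
    have pos: "u\<^sup>2 + v\<^sup>2 > 0" "u\<^sup>2 + r\<^sup>2 > 0"
      using v r by (simp_all add: add_nonneg_pos)
    show "\<bar>?D u * (1 / (u\<^sup>2 + v\<^sup>2))\<bar> \<le> 20 * B * (1 / (u\<^sup>2 + r\<^sup>2))"
    proof (cases "\<bar>u\<bar> \<le> r / 2")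
      case True
      then have u2: "u\<^sup>2 \<le> (r / 2)\<^sup>2"
        by (intro abs_le_square_iff[THEN iffD1]) (use r in auto)
      have "\<bar>?D u\<bar> \<le> B * (u\<^sup>2 / r\<^sup>2)"
        using \<phi>_second_diff[OF x, of u] True by (simp add: r_def)
      then have "\<bar>?D u * (1 / (u\<^sup>2 + v\<^sup>2))\<bar> \<le> B * (u\<^sup>2 / r\<^sup>2) * (1 / (u\<^sup>2 + v\<^sup>2))"
        unfolding abs_mult using pos by (intro mult_mono) (auto simp: B_nonneg)
      also have "\<dots> = B * (1 / r\<^sup>2) * (u\<^sup>2 / (u\<^sup>2 + v\<^sup>2))"
        by simp
      also have "\<dots> \<le> B * (1 / r\<^sup>2) * 1"
        using pos v2 B_nonneg by (intro mult_left_mono) auto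
      also have "\<dots> \<le> B * (20 * (1 / (u\<^sup>2 + r\<^sup>2)))"
        unfolding mult_1_right
      proof (rule mult_left_mono[OF _ B_nonneg])
        have "u\<^sup>2 + r\<^sup>2 \<le> 20 * r\<^sup>2"
        proof -
          have "(r / 2)\<^sup>2 = r\<^sup>2 / 4"
            by (simp add: power_divide)
          then show ?thesis
            using u2 r2 by linarith
        qed
        then show "1 / r\<^sup>2 \<le> 20 * (1 / (u\<^sup>2 + r\<^sup>2))"
          using pos r2 by (simp add: divide_simps mult.commute)
      qed
      finally show ?thesis
        by (simp add: mult.commute)
    next
      case False
      then have "(r / 2)\<^sup>2 \<le> u\<^sup>2"
        by (intro abs_le_square_iff[THEN iffD1]) (use r in auto)
      then have u2: "u\<^sup>2 + r\<^sup>2 \<le> 5 * (u\<^sup>2 + v\<^sup>2)"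
      proof -
        have "r\<^sup>2 \<le> 4 * u\<^sup>2"
          using \<open>(r / 2)\<^sup>2 \<le> u\<^sup>2\<close> by (simp add: power_divide)
        then have "u\<^sup>2 + r\<^sup>2 \<le> u\<^sup>2 + 4 * u\<^sup>2"
          by (rule add_left_mono)
        also have "\<dots> \<le> 5 * (u\<^sup>2 + v\<^sup>2)"
          by simp
        finally show ?thesis .
      qed
      have "\<bar>?D u\<bar> \<le> 4 * B"
        using \<phi>_bound[of "x + u"] \<phi>_bound[of "x - u"] \<phi>_bound[of x] by linarith
      then have "\<bar>?D u * (1 / (u\<^sup>2 + v\<^sup>2))\<bar> \<le> 4 * B * (1 / (u\<^sup>2 + v\<^sup>2))"
        unfolding abs_mult using pos by (intro mult_mono) (auto simp: B_nonneg)
      also have "\<dots> \<le> 4 * B * (5 * (1 / (u\<^sup>2 + r\<^sup>2)))"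
        using pos u2 B_nonneg by (intro mult_left_mono) (auto simp: divide_simps mult.commute)
      finally show ?thesis
        by simp
    qed
  qed
  also have "\<dots> = 20 * B * (pi / r)"
    using has_bochner_integral_integral_eq[OF Kr] by (simp only: integral_mult_right_zero)
  also have "\<dots> = 2 * (10 * pi * B / r)"
    by simp
  finally have "2 * \<bar>P x v - pi * \<phi> x / v\<bar> \<le> 2 * (10 * pi * B / r)"
    by (simp only: abs_mult abs_numeral)
  then show ?thesis
    unfolding r_def by (rule mult_left_le_imp_le) simp
qed

lemma Q_integrable:
  assumes "v > 0"
  shows "integrable lborel (\<lambda>s. \<phi> s * ((s - x) / ((s - x)\<^sup>2 + v\<^sup>2)))"
proof (rule Bochner_Integration.integrable_bound)
  show "integrable lborel (\<lambda>s. \<phi> s * (1 / v))"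
    using \<phi>_integrable by (rule integrable_mult_left)
  have "\<bar>(s - x) / ((s - x)\<^sup>2 + v\<^sup>2)\<bar> \<le> 1 / v" for s
  proof -
    have "0 \<le> (\<bar>s - x\<bar> - v)\<^sup>2 + \<bar>s - x\<bar> * v"
      using assms by simp
    then have "\<bar>s - x\<bar> * v \<le> (s - x)\<^sup>2 + v\<^sup>2"
      by (simp add: power2_eq_square algebra_simps)
    moreover have "(s - x)\<^sup>2 + v\<^sup>2 > 0"
      using assms by (simp add: add_nonneg_pos)
    ultimately show ?thesis
      using assms by (simp add: field_simps)
  qed
  then show "AE s in lborel. norm (\<phi> s * ((s - x) / ((s - x)\<^sup>2 + v\<^sup>2))) \<le> norm (\<phi> s * (1 / v))"
    unfolding norm_mult using assms by (intro AE_I2 mult_left_mono) auto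
qed measurable

text \<open>The kernel is odd in s - x, so only \<open>\<phi> (x + u) - \<phi> (x - u)\<close>
  enters. For |u| < \<open>\<delta>\<close> the Hoelder bound leaves the integrable 1 / sqrt |u|;
  beyond that the kernel is at most 1 / \<open>\<delta>\<close>. No bound depends on v.\<close>

lemma Q_bound:
  obtains C where "\<And>x v. v > 0 \<Longrightarrow> \<bar>x - xs\<bar> \<le> \<delta> \<Longrightarrow> \<bar>Q x v\<bar> \<le> C"
proof -
  let ?g = "\<lambda>u. indicator {0<..<\<delta>} u / sqrt u :: real"
  note g = integrable_inverse_sqrt[OF \<delta>_pos]
  have g': "integrable lborel (\<lambda>u. ?g (- u))"
    using lborel_integral_shift_reflect(4)[OF g, of 0] by simp
  define J where "J = (\<integral>u. ?g u + ?g (- u) \<partial>lborel)"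
  define N where "N = (\<integral>s. \<bar>\<phi> s\<bar> \<partial>lborel)"
  have "\<bar>Q x v\<bar> \<le> 2 * B * J + (N + N) / \<delta>" if v: "v > 0" and x: "\<bar>x - xs\<bar> \<le> \<delta>" for x v
  proof -
    note I = Q_integrable[OF v, of x]
    have 1: "Q x v = (\<integral>u. \<phi> (x + u) * (u / (u\<^sup>2 + v\<^sup>2)) \<partial>lborel)" "integrable lborel (\<lambda>u. \<phi> (x + u) * (u / (u\<^sup>2 + v\<^sup>2)))"
      using lborel_integral_shift_reflect(1)[of "\<lambda>s. \<phi> s * ((s - x) / ((s - x)\<^sup>2 + v\<^sup>2))" x]
        lborel_integral_shift_reflect(3)[OF I, of x] by (simp_all add: Q_def)
    have 2: "Q x v = (\<integral>u. - (\<phi> (x - u) * (u / (u\<^sup>2 + v\<^sup>2))) \<partial>lborel)" "integrable lborel (\<lambda>u. - (\<phi> (x - u) * (u / (u\<^sup>2 + v\<^sup>2))))"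
      using lborel_integral_shift_reflect(2)[of "\<lambda>s. \<phi> s * ((s - x) / ((s - x)\<^sup>2 + v\<^sup>2))" x]
        lborel_integral_shift_reflect(4)[OF I, of x] by (simp_all add: Q_def)
    have "has_bochner_integral lborel (\<lambda>u. \<phi> (x + u) * (u / (u\<^sup>2 + v\<^sup>2)) + - (\<phi> (x - u) * (u / (u\<^sup>2 + v\<^sup>2)))) (Q x v + Q x v)"
      using has_bochner_integral_integrable[OF 1(2)] has_bochner_integral_integrable[OF 2(2)]
      unfolding 1(1)[symmetric] 2(1)[symmetric] by (rule has_bochner_integral_add)
    then have D: "has_bochner_integral lborel (\<lambda>u. (\<phi> (x + u) - \<phi> (x - u)) * (u / (u\<^sup>2 + v\<^sup>2))) (2 * Q x v)"
      by (simp add: algebra_simps diff_divide_distrib)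
    note \<phi>1 = lborel_integral_shift_reflect(3)[OF integrable_abs[OF \<phi>_integrable], of x]
    note \<phi>2 = lborel_integral_shift_reflect(4)[OF integrable_abs[OF \<phi>_integrable], of x]
    let ?b = "\<lambda>u. 2 * B * (?g u + ?g (- u)) + (\<bar>\<phi> (x + u)\<bar> + \<bar>\<phi> (x - u)\<bar>) / \<delta>"
    have bI: "integrable lborel ?b"
      by (intro Bochner_Integration.integrable_add integrable_mult_right integrable_divide_zero g g' \<phi>1 \<phi>2)
    have "\<bar>2 * Q x v\<bar> \<le> (\<integral>u. \<bar>(\<phi> (x + u) - \<phi> (x - u)) * (u / (u\<^sup>2 + v\<^sup>2))\<bar> \<partial>lborel)"
      unfolding has_bochner_integral_integral_eq[OF D, symmetric] by (rule integral_abs_bound)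
    also have "\<dots> \<le> (\<integral>u. ?b u \<partial>lborel)"
    proof (rule integral_mono)
      show "integrable lborel (\<lambda>u. \<bar>(\<phi> (x + u) - \<phi> (x - u)) * (u / (u\<^sup>2 + v\<^sup>2))\<bar>)"
        using integrable.intros[OF D] by (rule integrable_abs)
      show "integrable lborel ?b"
        by (rule bI)
      fix u :: real
      have nn: "?g u + ?g (- u) \<ge> 0" "(\<bar>\<phi> (x + u)\<bar> + \<bar>\<phi> (x - u)\<bar>) / \<delta> \<ge> 0"
        using \<delta>_pos by (auto simp: indicator_def)
      have k: "\<bar>u / (u\<^sup>2 + v\<^sup>2)\<bar> \<le> 1 / \<bar>u\<bar>" if "u \<noteq> 0"
      proof -
        have "\<bar>u\<bar> * \<bar>u\<bar> \<le> u\<^sup>2 + v\<^sup>2"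
          by (simp add: power2_eq_square)
        moreover have "u\<^sup>2 + v\<^sup>2 > 0"
          using v by (simp add: add_nonneg_pos)
        ultimately show ?thesis
          using that by (simp add: divide_simps)
      qed
      show "\<bar>(\<phi> (x + u) - \<phi> (x - u)) * (u / (u\<^sup>2 + v\<^sup>2))\<bar> \<le> ?b u"
      proof (cases "u = 0")
        case True
        then show ?thesis
          using nn B_nonneg by simp
      next
        case u0: False
        show ?thesis
        proof (cases "\<bar>u\<bar> < \<delta>")
          case True
          \<comment> \<open>Both x - xs and u are at most \<open>\<delta>\<close> in modulus, hence
            the range 2 \<open>\<delta>\<close> in the Hoelder condition of the locale.\<close>
          have "\<bar>\<phi> (x + u) - \<phi> (x - u)\<bar> \<le> B * sqrt \<bar>x + u - (x - u)\<bar>"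
            using True x by (intro \<phi>_hoelder) auto
          also have "\<dots> \<le> B * (2 * sqrt \<bar>u\<bar>)"
          proof (rule mult_left_mono[OF _ B_nonneg])
            have "sqrt \<bar>x + u - (x - u)\<bar> \<le> sqrt (4 * \<bar>u\<bar>)"
              by (rule real_sqrt_le_mono) simp
            then show "sqrt \<bar>x + u - (x - u)\<bar> \<le> 2 * sqrt \<bar>u\<bar>"
              by (simp add: real_sqrt_mult)
          qed
          finally have "\<bar>(\<phi> (x + u) - \<phi> (x - u)) * (u / (u\<^sup>2 + v\<^sup>2))\<bar> \<le> B * (2 * sqrt \<bar>u\<bar>) * (1 / \<bar>u\<bar>)"
            unfolding abs_mult using k[OF u0] B_nonneg by (intro mult_mono) auto
          also have "\<dots> = 2 * B * (1 / sqrt \<bar>u\<bar>)"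
            using u0 by (simp add: real_sqrt_divide field_simps flip: real_sqrt_mult_self[of "\<bar>u\<bar>"])
          also have "1 / sqrt \<bar>u\<bar> = ?g u + ?g (- u)"
            using u0 True by (auto simp: indicator_def)
          finally show ?thesis
            using nn by linarith
        next
          case False
          have "1 / \<bar>u\<bar> \<le> 1 / \<delta>"
            using False \<delta>_pos by (intro divide_left_mono) auto
          then have "\<bar>(\<phi> (x + u) - \<phi> (x - u)) * (u / (u\<^sup>2 + v\<^sup>2))\<bar> \<le> (\<bar>\<phi> (x + u)\<bar> + \<bar>\<phi> (x - u)\<bar>) * (1 / \<delta>)"
            unfolding abs_mult using k[OF u0] by (intro mult_mono) auto
          then show ?thesis
            using mult_nonneg_nonneg[OF _ nn(1), of "2 * B"] B_nonneg by simp
        qed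
      qed
    qed
    also have "\<dots> = 2 * B * J + (N + N) / \<delta>"
    proof -
      have "(\<integral>u. \<bar>\<phi> (x + u)\<bar> \<partial>lborel) = N" "(\<integral>u. \<bar>\<phi> (x - u)\<bar> \<partial>lborel) = N"
        unfolding N_def by (rule lborel_integral_shift_reflect(1)[symmetric] lborel_integral_shift_reflect(2)[symmetric])+
      then show ?thesis
        unfolding J_def
        by (simp only: Bochner_Integration.integral_add integrable_mult_right integrable_divide_zero g g' \<phi>1 \<phi>2
            Bochner_Integration.integrable_add integral_mult_right_zero integral_divide_zero)
    qed
    finally show ?thesis
      by linarith
  qed
  then show ?thesis
    by (rule that)
qed

lemma first_moment_integrable: "integrable lborel (\<lambda>s. (s - xs) * \<phi> s)"
proof (rule Bochner_Integration.integrable_bound)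
  show "integrable lborel (\<lambda>s. \<bar>\<phi> s\<bar> + \<psi> s)"
    by (intro Bochner_Integration.integrable_add integrable_abs \<phi>_integrable \<psi>_integrable)
  have "\<bar>(s - xs) * \<phi> s\<bar> \<le> \<bar>\<phi> s\<bar> + \<psi> s" for s
  proof -
    have "\<bar>s - xs\<bar> \<le> 1 + (s - xs)\<^sup>2"
    proof -
      have "0 \<le> (\<bar>s - xs\<bar> - 1)\<^sup>2 + \<bar>s - xs\<bar>"
        by simp
      then show ?thesis
        by (simp add: power2_eq_square algebra_simps)
    qed
    then have "\<bar>s - xs\<bar> * \<bar>\<phi> s\<bar> \<le> (1 + (s - xs)\<^sup>2) * \<bar>\<phi> s\<bar>"
      by (rule mult_right_mono) simp
    also have "(s - xs)\<^sup>2 * \<bar>\<phi> s\<bar> = \<psi> s"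
    proof -
      have "\<bar>\<psi> s\<bar> = (s - xs)\<^sup>2 * \<bar>\<phi> s\<bar>"
        by (simp only: \<psi>_eq abs_mult abs_power2)
      then show ?thesis
        using \<psi>_nonneg[of s] by simp
    qed
    then have "(1 + (s - xs)\<^sup>2) * \<bar>\<phi> s\<bar> = \<bar>\<phi> s\<bar> + \<psi> s"
      by (simp add: algebra_simps)
    finally show ?thesis
      by (simp add: abs_mult)
  qed
  then show "AE s in lborel. norm ((s - xs) * \<phi> s) \<le> norm (\<bar>\<phi> s\<bar> + \<psi> s)"
    using \<psi>_nonneg by (intro AE_I2) (auto intro: order_trans)
qed measurable

text \<open>The Cauchy transform at \<open>xs\<close> itself, written through \<open>\<phi>\<close>;
  it determines the shift from \<open>xs\<close> to \<open>xt\<close>.\<close>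

definition G0 :: real where
  "G0 = - (\<integral>s. (s - xs) * \<phi> s \<partial>lborel)"

definition \<Phi> :: "complex \<Rightarrow> complex" where
  "\<Phi> z = Complex (- Q (Re z) (Im z)) (- (Im z * P (Re z) (Im z)))"

text \<open>Obtained from \<open>\<sigma>\<^sup>2 / (Z - \<sigma>) = - \<sigma> - Z + Z\<^sup>2 / (Z - \<sigma>)\<close> with \<open>\<sigma> = s - xs\<close>, \<open>Z = z - xs\<close>.\<close>

lemma cauchy_expansion:
  assumes z: "Im z > 0"
  shows "cauchy M z = of_real G0 - of_real A * (z - of_real xs) + (z - of_real xs)\<^sup>2 * \<Phi> z"
proof -
  let ?Z = "z - of_real xs"
  have \<Phi>: "has_bochner_integral lborel (\<lambda>s. of_real (\<phi> s) * (1 / (z - of_real s))) (\<Phi> z)"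
  proof -
    have "has_bochner_integral lborel (\<lambda>s. complex_of_real (- (\<phi> s * ((s - Re z) / ((s - Re z)\<^sup>2 + (Im z)\<^sup>2))))
        + \<i> * complex_of_real (- (Im z * (\<phi> s * (1 / ((s - Re z)\<^sup>2 + (Im z)\<^sup>2))))))
      (complex_of_real (- Q (Re z) (Im z)) + \<i> * complex_of_real (- (Im z * P (Re z) (Im z))))"
      unfolding P_def Q_def
      by (intro has_bochner_integral_add has_bochner_integral_mult_right has_bochner_integral_of_real
          has_bochner_integral_minus has_bochner_integral_integrable P_integrable Q_integrable z)
    also have "(\<lambda>s. complex_of_real (- (\<phi> s * ((s - Re z) / ((s - Re z)\<^sup>2 + (Im z)\<^sup>2))))
        + \<i> * complex_of_real (- (Im z * (\<phi> s * (1 / ((s - Re z)\<^sup>2 + (Im z)\<^sup>2))))))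
      = (\<lambda>s. of_real (\<phi> s) * (1 / (z - of_real s)))"
    proof
      fix s
      define d where "d = (s - Re z)\<^sup>2 + (Im z)\<^sup>2"
      have "(Re z - s)\<^sup>2 + (Im z)\<^sup>2 = d"
        unfolding d_def by (simp only: power2_commute)
      then have "1 / (z - of_real s) = Complex ((Re z - s) / d) (- (Im z * (1 / d)))"
        by (simp add: complex_eq_iff Re_divide Im_divide)
      also have "(Re z - s) / d = - ((s - Re z) / d)"
        by (metis minus_diff_eq minus_divide_left)
      finally have "1 / (z - of_real s) = Complex (- ((s - Re z) / d)) (- (Im z * (1 / d)))" .
      then show "complex_of_real (- (\<phi> s * ((s - Re z) / ((s - Re z)\<^sup>2 + (Im z)\<^sup>2))))
        + \<i> * complex_of_real (- (Im z * (\<phi> s * (1 / ((s - Re z)\<^sup>2 + (Im z)\<^sup>2)))))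
        = of_real (\<phi> s) * (1 / (z - of_real s))"
        unfolding d_def[symmetric] by (simp only:) (simp add: complex_eq_iff del: of_real_divide)
    qed
    also have "complex_of_real (- Q (Re z) (Im z)) + \<i> * complex_of_real (- (Im z * P (Re z) (Im z))) = \<Phi> z"
      by (simp add: \<Phi>_def complex_eq_iff)
    finally show ?thesis .
  qed
  have 1: "has_bochner_integral lborel (\<lambda>s. complex_of_real ((s - xs) * \<phi> s)) (of_real (- G0))"
    unfolding G0_def using first_moment_integrable
    by (intro has_bochner_integral_of_real) (simp add: has_bochner_integral_iff)
  have 2: "has_bochner_integral lborel (\<lambda>s. complex_of_real (\<phi> s)) (of_real A)"
    unfolding A_def using \<phi>_integrable
    by (intro has_bochner_integral_of_real) (simp add: has_bochner_integral_iff)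
  have "has_bochner_integral lborel
      (\<lambda>s. - complex_of_real ((s - xs) * \<phi> s) - ?Z * complex_of_real (\<phi> s) + ?Z\<^sup>2 * (of_real (\<phi> s) * (1 / (z - of_real s))))
      (- of_real (- G0) - ?Z * of_real A + ?Z\<^sup>2 * \<Phi> z)"
    by (intro has_bochner_integral_add has_bochner_integral_diff has_bochner_integral_minus
        has_bochner_integral_mult_right 1 2 \<Phi>)
  also have "(\<lambda>s. - complex_of_real ((s - xs) * \<phi> s) - ?Z * complex_of_real (\<phi> s) + ?Z\<^sup>2 * (of_real (\<phi> s) * (1 / (z - of_real s))))
    = (\<lambda>s. \<psi> s *\<^sub>R (1 / (z - of_real s)))"
  proof
    fix s
    have nz: "z - of_real s \<noteq> 0"
      using z by (auto simp: complex_eq_iff)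
    define \<sigma> where "\<sigma> = complex_of_real (s - xs)"
    have "\<sigma>\<^sup>2 * (1 / (z - of_real s)) = - \<sigma> - ?Z + ?Z\<^sup>2 * (1 / (z - of_real s))"
    proof -
      have "\<sigma>\<^sup>2 * (1 / w) = - \<sigma> - (w + \<sigma>) + (w + \<sigma>)\<^sup>2 * (1 / w)" if "w \<noteq> 0" for w
        using that by (simp add: field_simps power2_eq_square)
      note * = this[OF nz]
      have Z: "z - of_real s + \<sigma> = ?Z"
        by (simp add: \<sigma>_def)
      show ?thesis
        using * unfolding Z .
    qed
    then have "of_real (\<phi> s) * (\<sigma>\<^sup>2 * (1 / (z - of_real s))) = of_real (\<phi> s) * (- \<sigma> - ?Z + ?Z\<^sup>2 * (1 / (z - of_real s)))"
      by (rule arg_cong)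
    then show "- complex_of_real ((s - xs) * \<phi> s) - ?Z * complex_of_real (\<phi> s) + ?Z\<^sup>2 * (of_real (\<phi> s) * (1 / (z - of_real s)))
      = \<psi> s *\<^sub>R (1 / (z - of_real s))"
      by (simp add: \<psi>_eq scaleR_conv_of_real \<sigma>_def algebra_simps)
  qed
  finally have "(\<integral>s. \<psi> s *\<^sub>R (1 / (z - of_real s)) \<partial>lborel) = - of_real (- G0) - ?Z * of_real A + ?Z\<^sup>2 * \<Phi> z"
    by (rule has_bochner_integral_integral_eq)
  moreover have "cauchy M z = (\<integral>s. \<psi> s *\<^sub>R (1 / (z - of_real s)) \<partial>lborel)"
    unfolding cauchy_def M_eq by (rule integral_density) (auto simp: \<psi>_nonneg)
  ultimately show ?thesis
    by (simp add: mult.commute)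
qed

text \<open>Expand (s - xs)^2 around x and divide by (s - x)^2 + v^2. Since Im H is
  \<open>Im z\<close> times 1 - \<open>\<tau> * cauchy_sq\<close>, errors made here enter Im H with
  an additional factor v, which taking imaginary parts in \<open>cauchy_expansion\<close> would not
  show.\<close>

lemma cauchy_sq_expansion:
  assumes v: "v > 0"
  shows "cauchy_sq M (Complex x v) = A - v\<^sup>2 * P x v + 2 * (x - xs) * Q x v + (x - xs)\<^sup>2 * P x v"
proof -
  have "has_bochner_integral lborel
      (\<lambda>s. \<phi> s - v\<^sup>2 * (\<phi> s * (1 / ((s - x)\<^sup>2 + v\<^sup>2))) + 2 * (x - xs) * (\<phi> s * ((s - x) / ((s - x)\<^sup>2 + v\<^sup>2)))
        + (x - xs)\<^sup>2 * (\<phi> s * (1 / ((s - x)\<^sup>2 + v\<^sup>2))))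
      (A - v\<^sup>2 * P x v + 2 * (x - xs) * Q x v + (x - xs)\<^sup>2 * P x v)"
    unfolding A_def P_def Q_def
    by (intro has_bochner_integral_add has_bochner_integral_diff has_bochner_integral_mult_right
        has_bochner_integral_integrable P_integrable Q_integrable \<phi>_integrable v)
  also have "(\<lambda>s. \<phi> s - v\<^sup>2 * (\<phi> s * (1 / ((s - x)\<^sup>2 + v\<^sup>2))) + 2 * (x - xs) * (\<phi> s * ((s - x) / ((s - x)\<^sup>2 + v\<^sup>2)))
        + (x - xs)\<^sup>2 * (\<phi> s * (1 / ((s - x)\<^sup>2 + v\<^sup>2))))
      = (\<lambda>s. \<psi> s *\<^sub>R (1 / (cmod (Complex x v - of_real s))\<^sup>2))"
  proof
    fix s
    define d where "d = (s - x)\<^sup>2 + v\<^sup>2"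
    have d: "d > 0"
      unfolding d_def using v by (simp add: add_nonneg_pos)
    have "(s - xs)\<^sup>2 = d - v\<^sup>2 + 2 * (x - xs) * (s - x) + (x - xs)\<^sup>2"
      unfolding d_def by (simp add: power2_eq_square algebra_simps)
    then have "(s - xs)\<^sup>2 * (1 / d) = 1 - v\<^sup>2 * (1 / d) + 2 * (x - xs) * ((s - x) / d) + (x - xs)\<^sup>2 * (1 / d)"
      using d by (simp add: divide_simps)
    then have *: "\<phi> s * ((s - xs)\<^sup>2 * (1 / d)) = \<phi> s * (1 - v\<^sup>2 * (1 / d) + 2 * (x - xs) * ((s - x) / d) + (x - xs)\<^sup>2 * (1 / d))"
      by (rule arg_cong)
    moreover have "(cmod (Complex x v - of_real s))\<^sup>2 = d"
      unfolding d_def by (simp add: cmod_power2 power2_commute)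
    ultimately show "\<phi> s - v\<^sup>2 * (\<phi> s * (1 / ((s - x)\<^sup>2 + v\<^sup>2))) + 2 * (x - xs) * (\<phi> s * ((s - x) / ((s - x)\<^sup>2 + v\<^sup>2)))
        + (x - xs)\<^sup>2 * (\<phi> s * (1 / ((s - x)\<^sup>2 + v\<^sup>2)))
      = \<psi> s *\<^sub>R (1 / (cmod (Complex x v - of_real s))\<^sup>2)"
    proof -
      have "f - c * (f * q) + e * (f * k) + y * (f * q) = f * (1 - c * q + e * k + y * q)" for f c q e k y :: real
        by (simp add: algebra_simps)
      from this[of "\<phi> s" "v\<^sup>2" "1 / d" "2 * (x - xs)" "(s - x) / d" "(x - xs)\<^sup>2"]
      show ?thesis
        using * \<open>(cmod (Complex x v - of_real s))\<^sup>2 = d\<close>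
        unfolding d_def[symmetric] by (simp only: \<psi>_eq real_scaleR_def mult_ac)
    qed
  qed
  finally have "(\<integral>s. \<psi> s *\<^sub>R (1 / (cmod (Complex x v - of_real s))\<^sup>2) \<partial>lborel)
      = A - v\<^sup>2 * P x v + 2 * (x - xs) * Q x v + (x - xs)\<^sup>2 * P x v"
    by (rule has_bochner_integral_integral_eq)
  then show ?thesis
    unfolding cauchy_sq_def M_eq by (subst integral_density) (auto simp: \<psi>_nonneg)
qed

text \<open>The linear coefficient of \<open>H\<close> at \<open>xs\<close>, positive exactly in the
  subcritical regime.\<close>

definition a :: real where
  "a = 1 - \<tau> * A"

definition xt :: real where
  "xt = xs + \<tau> * G0"

lemma a_pos: "a > 0"
  using subcritical by (simp add: a_def A_def)

lemma H_expansion: "Im z > 0 \<Longrightarrow> H z = of_real xt + of_real a * (z - of_real xs) + of_real \<tau> * (z - of_real xs)\<^sup>2 * \<Phi> z"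
  unfolding H_def by (subst cauchy_expansion) (auto simp: xt_def a_def algebra_simps)

text \<open>The second estimate has to carry the factor \<open>Im z\<close>: an error of size |z -
  xs|^2, as in the first, could hide \<open>\<psi>\<close> completely. The main term comes from (x -
  xs)^2 P, which is close to pi \<open>\<psi>\<close> / v.\<close>

lemma local_estimates:
  obtains C where "C \<ge> 0"
    "\<And>z. Im z > 0 \<Longrightarrow> \<bar>Re z - xs\<bar> \<le> \<delta> \<Longrightarrow>
      cmod (H z - of_real xt - of_real a * (z - of_real xs)) \<le> C * (cmod (z - of_real xs))\<^sup>2"
    "\<And>z. Im z > 0 \<Longrightarrow> \<bar>Re z - xs\<bar> \<le> \<delta> \<Longrightarrow>
      \<bar>a * Im z - \<tau> * pi * \<psi> (Re z) - Im (H z)\<bar> \<le> C * Im z * cmod (z - of_real xs)"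
proof -
  obtain D where D: "\<And>x v. v > 0 \<Longrightarrow> \<bar>x - xs\<bar> \<le> \<delta> \<Longrightarrow> \<bar>Q x v\<bar> \<le> D"
    using Q_bound by blast
  have D0: "D \<ge> 0"
    using D[of 1 xs] \<delta>_pos by simp
  \<comment> \<open>2 D accounts for the term with \<open>Q\<close>; 11 = 10 + 1 adds the error of
    \<open>P_approx\<close> and the bound on v^2 P.\<close>
  define C where "C = \<tau> * (2 * D + 11 * pi * B)"
  have C0: "C \<ge> 0"
    unfolding C_def using tau_pos D0 B_nonneg by (intro mult_nonneg_nonneg add_nonneg_nonneg) auto
  have "cmod (H z - of_real xt - of_real a * (z - of_real xs)) \<le> C * (cmod (z - of_real xs))\<^sup>2"
    if z: "Im z > 0" "\<bar>Re z - xs\<bar> \<le> \<delta>" for z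
  proof -
    have "cmod (\<Phi> z) \<le> \<bar>Q (Re z) (Im z)\<bar> + \<bar>Im z * P (Re z) (Im z)\<bar>"
      using cmod_le[of "\<Phi> z"] by (simp add: \<Phi>_def)
    also have "\<dots> \<le> D + pi * B"
      using D[OF z] vP_bound[OF z(1)] by (rule add_mono)
    also have "\<dots> \<le> 2 * D + 11 * pi * B"
      using D0 B_nonneg by simp
    finally have "\<tau> * cmod (\<Phi> z) \<le> C"
      unfolding C_def using tau_pos by (intro mult_left_mono) auto
    then have "\<tau> * cmod (\<Phi> z) * (cmod (z - of_real xs))\<^sup>2 \<le> C * (cmod (z - of_real xs))\<^sup>2"
      by (rule mult_right_mono) simp
    moreover have "H z - of_real xt - of_real a * (z - of_real xs) = of_real \<tau> * (z - of_real xs)\<^sup>2 * \<Phi> z"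
      using H_expansion[OF z(1)] by simp
    ultimately show ?thesis
      using tau_pos by (simp add: norm_mult norm_power mult_ac)
  qed
  moreover have "\<bar>a * Im z - \<tau> * pi * \<psi> (Re z) - Im (H z)\<bar> \<le> C * Im z * cmod (z - of_real xs)"
    if z: "Im z > 0" "\<bar>Re z - xs\<bar> \<le> \<delta>" for z
  proof -
    define x v X where "x = Re z" and "v = Im z" and "X = x - xs"
    have zxv: "z = Complex x v"
      by (simp add: x_def v_def)
    have v: "v > 0" and x: "\<bar>X\<bar> \<le> \<delta>"
      using z by (simp_all add: x_def v_def X_def)
    have nX: "\<bar>X\<bar> \<le> cmod (z - of_real xs)" and nv: "v \<le> cmod (z - of_real xs)"
      using abs_Re_le_cmod[of "z - of_real xs"] abs_Im_le_cmod[of "z - of_real xs"] by (simp_all add: x_def v_def X_def)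
    have P: "\<bar>X\<^sup>2 * P x v - pi * \<psi> x / v\<bar> \<le> 10 * pi * B * \<bar>X\<bar>"
    proof (cases "X = 0")
      case True
      then show ?thesis
        by (simp add: \<psi>_eq X_def)
    next
      case False
      then have "\<bar>P x v - pi * \<phi> x / v\<bar> \<le> 10 * pi * B / \<bar>X\<bar>"
        using P_approx[OF v, of x] x by (simp add: X_def)
      then have "X\<^sup>2 * \<bar>P x v - pi * \<phi> x / v\<bar> \<le> X\<^sup>2 * (10 * pi * B / \<bar>X\<bar>)"
        by (rule mult_left_mono) simp
      moreover have "X\<^sup>2 * (10 * pi * B / \<bar>X\<bar>) = 10 * pi * B * \<bar>X\<bar>"
      proof -
        have "y * y * (c / y) = c * y" if "y \<noteq> 0" for y c :: real
          using that by simp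
        from this[of "\<bar>X\<bar>" "10 * pi * B"] False show ?thesis
          by (simp only: abs_mult_self_eq power2_eq_square)
      qed
      moreover have "X\<^sup>2 * \<bar>P x v - pi * \<phi> x / v\<bar> = \<bar>X\<^sup>2 * P x v - pi * \<psi> x / v\<bar>"
      proof -
        have "\<psi> x = X\<^sup>2 * \<phi> x"
          by (simp add: \<psi>_eq X_def)
        then have "X\<^sup>2 * P x v - pi * \<psi> x / v = X\<^sup>2 * (P x v - pi * \<phi> x / v)"
          by (simp add: right_diff_distrib)
        then show ?thesis
          by (simp only: abs_mult abs_power2)
      qed
      ultimately show ?thesis
        by simp
    qed
    have "\<bar>v\<^sup>2 * P x v\<bar> = v * \<bar>v * P x v\<bar>"
      using v by (simp add: abs_mult power2_eq_square)
    also have "\<dots> \<le> v * (pi * B)"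
      using vP_bound[OF v] v by (intro mult_left_mono) auto
    finally have P2: "\<bar>v\<^sup>2 * P x v\<bar> \<le> pi * B * v"
      by (simp add: mult_ac)
    have "\<bar>2 * X * Q x v\<bar> = 2 * (\<bar>X\<bar> * \<bar>Q x v\<bar>)"
      by (simp add: abs_mult)
    also have "\<dots> \<le> 2 * (\<bar>X\<bar> * D)"
      using D[OF v, of x] x by (intro mult_left_mono) (auto simp: X_def)
    finally have Q: "\<bar>2 * X * Q x v\<bar> \<le> 2 * D * \<bar>X\<bar>"
      by (simp add: mult_ac)
    have "\<bar>cauchy_sq M z - A - pi * \<psi> x / v\<bar> \<le> pi * B * v + 2 * D * \<bar>X\<bar> + 10 * pi * B * \<bar>X\<bar>"
      unfolding zxv cauchy_sq_expansion[OF v] X_def[symmetric] using P P2 Q by (simp add: abs_le_iff)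
    also have "\<dots> \<le> (2 * D + 11 * pi * B) * cmod (z - of_real xs)"
    proof -
      have "pi * B * v \<le> pi * B * cmod (z - of_real xs)" "2 * D * \<bar>X\<bar> \<le> 2 * D * cmod (z - of_real xs)"
        "10 * pi * B * \<bar>X\<bar> \<le> 10 * pi * B * cmod (z - of_real xs)"
        using nX nv D0 B_nonneg by (intro mult_left_mono; simp)+
      then show ?thesis
        by (simp add: algebra_simps)
    qed
    finally have "\<tau> * v * \<bar>cauchy_sq M z - A - pi * \<psi> x / v\<bar> \<le> \<tau> * v * ((2 * D + 11 * pi * B) * cmod (z - of_real xs))"
      using v tau_pos by (intro mult_left_mono) auto
    moreover have "a * v - \<tau> * pi * \<psi> x - Im (H z) = \<tau> * v * (cauchy_sq M z - A - pi * \<psi> x / v)"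
      unfolding Im_H[OF z(1)] v_def[symmetric] a_def using v by (simp add: field_simps)
    ultimately show ?thesis
      unfolding C_def x_def[symmetric] v_def[symmetric] using v tau_pos by (simp add: abs_mult mult_ac)
  qed
  ultimately show ?thesis
    using C0 that by blast
qed

text \<open>On the vertical line through \<open>xs\<close> only - v^2 P is left in the expansion,
  and P is nonnegative there. So this line lies in the region where \<open>H\<close> maps into the
  upper half plane.\<close>

lemma cauchy_sq_le_A:
  assumes v: "v > 0"
  shows "cauchy_sq M (Complex xs v) \<le> A"
proof -
  have "0 \<le> P xs v"
    unfolding P_def
  proof (rule integral_nonneg_AE, rule AE_mp[OF AE_lborel_singleton[of xs]], intro AE_I2 impI)
    fix s assume "s \<noteq> xs"
    \<comment> \<open>At \<open>xs\<close> the sign of \<open>\<phi>\<close> cannot be read off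
      \<open>\<psi>\<close>, hence the exclusion of that null point.\<close>
    then have "\<phi> s \<ge> 0"
      using \<psi>_nonneg[of s] by (simp add: \<psi>_eq zero_le_mult_iff)
    then show "0 \<le> \<phi> s * (1 / ((s - xs)\<^sup>2 + v\<^sup>2))"
      by simp
  qed
  then show ?thesis
    using cauchy_sq_expansion[OF v, of xs] by simp
qed

text \<open>Along z = xs + i / (n + 1) one has H z -> xt and \<omega>(H z) = z -> xs; continuity of
  \<open>\<Omega>\<close> identifies the limit.\<close>

lemma \<Omega>_xt: "\<Omega> (of_real xt) = of_real xs"
proof -
  obtain C where C: "C \<ge> 0" "\<And>z. Im z > 0 \<Longrightarrow> \<bar>Re z - xs\<bar> \<le> \<delta> \<Longrightarrow>
      cmod (H z - of_real xt - of_real a * (z - of_real xs)) \<le> C * (cmod (z - of_real xs))\<^sup>2"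
    using local_estimates by metis
  define z where "z n = above (of_real xs) n" for n
  have Imz: "Im (z n) > 0" for n
    unfolding z_def by (rule Im_above_pos) simp
  have Rez: "Re (z n) = xs" for n
    unfolding z_def above_def by simp
  have z: "z \<longlonglongrightarrow> of_real xs"
    unfolding z_def by (rule above_tendsto)
  have HIm: "Im (H (z n)) > 0" for n
  proof -
    have "z n = Complex xs (Im (z n))"
      using Rez[of n] by (simp add: complex_eq_iff)
    then have "\<tau> * cauchy_sq M (z n) \<le> \<tau> * A"
      using cauchy_sq_le_A[OF Imz[of n]] tau_pos by simp
    also have "\<dots> < 1"
      using a_pos by (simp add: a_def)
    finally show ?thesis
      using Imz by (simp add: Im_H_pos_iff)
  qed
  have "(\<lambda>n. H (z n) - of_real xt - of_real a * (z n - of_real xs)) \<longlonglongrightarrow> 0"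
  proof (rule Lim_null_comparison)
    show "\<forall>\<^sub>F n in sequentially. cmod (H (z n) - of_real xt - of_real a * (z n - of_real xs)) \<le> C * (cmod (z n - of_real xs))\<^sup>2"
      using C(2) Imz Rez \<delta>_pos by simp
    have "(\<lambda>n. C * (cmod (z n - of_real xs))\<^sup>2) \<longlonglongrightarrow> C * (cmod (of_real xs - of_real xs))\<^sup>2"
      by (intro tendsto_intros z)
    then show "(\<lambda>n. C * (cmod (z n - of_real xs))\<^sup>2) \<longlonglongrightarrow> 0"
      by simp
  qed
  then have "(\<lambda>n. H (z n) - of_real xt - of_real a * (z n - of_real xs) + (of_real xt + of_real a * (z n - of_real xs)))
      \<longlonglongrightarrow> 0 + (of_real xt + of_real a * (of_real xs - of_real xs))"
    by (intro tendsto_intros z)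
  then have Hz: "(\<lambda>n. H (z n)) \<longlonglongrightarrow> of_real xt"
    by simp
  have "(\<lambda>n. \<Omega> (H (z n))) \<longlonglongrightarrow> \<Omega> (of_real xt)"
    using HIm by (intro continuous_on_tendsto_compose[OF continuous_on_\<Omega> Hz]) (auto intro!: always_eventually less_imp_le)
  moreover have "\<Omega> (H (z n)) = z n" for n
    using HIm Imz by (simp add: \<Omega>_eq_\<omega> \<omega>_H)
  ultimately show ?thesis
    using z LIMSEQ_unique by fastforce
qed

text \<open>The estimates at \<open>\<omega> (t + \<i> / n)\<close> pass to the limit.\<close>

lemma boundary_estimates:
  obtains C where "C \<ge> 0"
    "\<And>t. \<bar>Re (\<Omega> (of_real t)) - xs\<bar> < \<delta> \<Longrightarrow>
      cmod (of_real t - of_real xt - of_real a * (\<Omega> (of_real t) - of_real xs)) \<le> C * (cmod (\<Omega> (of_real t) - of_real xs))\<^sup>2"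
    "\<And>t. \<bar>Re (\<Omega> (of_real t)) - xs\<bar> < \<delta> \<Longrightarrow>
      \<bar>a * Im (\<Omega> (of_real t)) - \<tau> * pi * \<psi> (Re (\<Omega> (of_real t)))\<bar>
        \<le> C * Im (\<Omega> (of_real t)) * cmod (\<Omega> (of_real t) - of_real xs)"
proof -
  obtain C where C: "C \<ge> 0"
    "\<And>z. Im z > 0 \<Longrightarrow> \<bar>Re z - xs\<bar> \<le> \<delta> \<Longrightarrow>
      cmod (H z - of_real xt - of_real a * (z - of_real xs)) \<le> C * (cmod (z - of_real xs))\<^sup>2"
    "\<And>z. Im z > 0 \<Longrightarrow> \<bar>Re z - xs\<bar> \<le> \<delta> \<Longrightarrow>
      \<bar>a * Im z - \<tau> * pi * \<psi> (Re z) - Im (H z)\<bar> \<le> C * Im z * cmod (z - of_real xs)"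
    using local_estimates by metis
  have est: "cmod (of_real t - of_real xt - of_real a * (\<Omega> (of_real t) - of_real xs)) \<le> C * (cmod (\<Omega> (of_real t) - of_real xs))\<^sup>2
    \<and> \<bar>a * Im (\<Omega> (of_real t)) - \<tau> * pi * \<psi> (Re (\<Omega> (of_real t)))\<bar>
        \<le> C * Im (\<Omega> (of_real t)) * cmod (\<Omega> (of_real t) - of_real xs)"
    if t: "\<bar>Re (\<Omega> (of_real t)) - xs\<bar> < \<delta>" for t
  proof -
    define w z where "w n = above (of_real t) n" and "z n = \<omega> (w n)" for n
    have w: "w \<longlonglongrightarrow> of_real t" and Imw: "Im (w n) > 0" for n
      unfolding w_def by (auto intro: above_tendsto Im_above_pos)
    have z: "z \<longlonglongrightarrow> \<Omega> (of_real t)"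
      unfolding z_def w_def by (rule \<Omega>_tendsto) simp
    have Imz: "Im (z n) > 0" and Hz: "H (z n) = w n" for n
      using Imw by (simp_all add: z_def Im_\<omega> H_\<omega>)
    have "(\<lambda>n. \<bar>Re (z n) - xs\<bar>) \<longlonglongrightarrow> \<bar>Re (\<Omega> (of_real t)) - xs\<bar>"
      by (intro tendsto_intros z)
    then have ev: "\<forall>\<^sub>F n in sequentially. \<bar>Re (z n) - xs\<bar> < \<delta>"
      using t by (rule order_tendstoD)
    have \<psi>: "(\<lambda>n. \<psi> (Re (z n))) \<longlonglongrightarrow> \<psi> (Re (\<Omega> (of_real t)))"
      by (intro continuous_on_tendsto_compose[OF \<psi>_continuous] tendsto_intros z) auto
    have 1: "(\<lambda>n. cmod (w n - of_real xt - of_real a * (z n - of_real xs)))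
        \<longlonglongrightarrow> cmod (of_real t - of_real xt - of_real a * (\<Omega> (of_real t) - of_real xs))"
      by (intro tendsto_intros z w)
    have 2: "(\<lambda>n. C * (cmod (z n - of_real xs))\<^sup>2) \<longlonglongrightarrow> C * (cmod (\<Omega> (of_real t) - of_real xs))\<^sup>2"
      by (intro tendsto_intros z)
    have 3: "(\<lambda>n. \<bar>a * Im (z n) - \<tau> * pi * \<psi> (Re (z n)) - Im (w n)\<bar>)
        \<longlonglongrightarrow> \<bar>a * Im (\<Omega> (of_real t)) - \<tau> * pi * \<psi> (Re (\<Omega> (of_real t))) - Im (of_real t)\<bar>"
      by (intro tendsto_intros z w \<psi>)
    have 4: "(\<lambda>n. C * Im (z n) * cmod (z n - of_real xs)) \<longlonglongrightarrow> C * Im (\<Omega> (of_real t)) * cmod (\<Omega> (of_real t) - of_real xs)"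
      by (intro tendsto_intros z)
    have e1: "\<forall>\<^sub>F n in sequentially. cmod (w n - of_real xt - of_real a * (z n - of_real xs)) \<le> C * (cmod (z n - of_real xs))\<^sup>2"
      using ev by eventually_elim (use C(2)[OF Imz] Hz in \<open>simp add: less_imp_le\<close>)
    have e2: "\<forall>\<^sub>F n in sequentially. \<bar>a * Im (z n) - \<tau> * pi * \<psi> (Re (z n)) - Im (w n)\<bar> \<le> C * Im (z n) * cmod (z n - of_real xs)"
      using ev by eventually_elim (use C(3)[OF Imz] Hz in \<open>simp add: less_imp_le\<close>)
    show ?thesis
      using tendsto_le[OF _ 2 1 e1] tendsto_le[OF _ 4 3 e2] by simp
  qed
  then show ?thesis
    using C(1) that by blast
qed

end

section \<open>Asymptotics of the density along the real axis\<close>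

lemma bigo_mult_minus_1:
  fixes f g e :: "'a \<Rightarrow> real"
  assumes "(\<lambda>x. f x - 1) \<in> O[F](e)" "(\<lambda>x. g x - 1) \<in> O[F](e)" "e \<in> O[F](\<lambda>_. 1)"
  shows "(\<lambda>x. f x * g x - 1) \<in> O[F](e)"
proof -
  have "(\<lambda>x. (f x - 1) * (g x - 1)) \<in> O[F](\<lambda>x. e x * 1)"
    by (intro landau_o.big.mult assms(1) landau_o.big_trans[OF assms(2,3)])
  then have "(\<lambda>x. (f x - 1) * (g x - 1) + (f x - 1) + (g x - 1)) \<in> O[F](e)"
    by (intro sum_in_bigo(1)[OF sum_in_bigo(1)[OF _ assms(1)] assms(2)]) simp
  then show ?thesis
    by (simp add: algebra_simps)
qed

lemma powr_minus_1_bound: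
  fixes r :: real
  obtains d K where "d > 0" "\<And>y. \<bar>y - 1\<bar> < d \<Longrightarrow> \<bar>y powr r - 1\<bar> \<le> K * \<bar>y - 1\<bar>"
proof -
  have "((\<lambda>y. y powr r) has_real_derivative r * 1 powr (r - 1)) (at 1)"
    by (rule has_real_derivative_powr) simp
  then have "((\<lambda>h. ((1 + h) powr r - 1) / h) \<longlongrightarrow> r) (at 0)"
    by (simp add: DERIV_def)
  then have "\<forall>\<^sub>F h in at 0. dist (((1 + h) powr r - 1) / h) r < 1"
    by (rule tendstoD) simp
  then obtain d where d: "d > 0" "\<And>h. h \<noteq> 0 \<Longrightarrow> dist h 0 < d \<Longrightarrow> dist (((1 + h) powr r - 1) / h) r < 1"
    by (auto simp: eventually_at)
  have "\<bar>y powr r - 1\<bar> \<le> (\<bar>r\<bar> + 1) * \<bar>y - 1\<bar>" if "\<bar>y - 1\<bar> < d" for y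
  proof (cases "y = 1")
    case False
    then have "\<bar>(y powr r - 1) / (y - 1) - r\<bar> < 1"
      using d(2)[of "y - 1"] that by (simp add: dist_real_def)
    then have "\<bar>(y powr r - 1) / (y - 1)\<bar> \<le> \<bar>r\<bar> + 1"
      by linarith
    then show ?thesis
      using False by (simp add: abs_divide divide_simps)
  qed simp
  with d(1) show ?thesis
    by (rule that)
qed

context vanishing_density
begin

definition X :: "real \<Rightarrow> real" where
  "X t = Re (\<Omega> (of_real t)) - xs"

definition V :: "real \<Rightarrow> real" where
  "V t = Im (\<Omega> (of_real t))"

lemma V_nonneg: "V t \<ge> 0"
  unfolding V_def by (rule Im_\<Omega>_nonneg) simp

lemma X_tendsto: "(X \<longlongrightarrow> 0) (nhds xt)" and V_tendsto: "(V \<longlongrightarrow> 0) (nhds xt)"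
proof -
  have "isCont (\<lambda>t. \<Omega> (of_real t)) xt"
  proof -
    have "continuous_on UNIV (\<lambda>t. \<Omega> (of_real t))"
      by (intro continuous_on_compose2[OF continuous_on_\<Omega>] continuous_intros) auto
    then show ?thesis
      by (simp add: continuous_on_eq_continuous_at)
  qed
  then have *: "((\<lambda>t. \<Omega> (of_real t)) \<longlongrightarrow> of_real xs) (nhds xt)"
    using tendsto_at_iff_tendsto_nhds[of "\<lambda>t. \<Omega> (of_real t)" xt] by (simp add: isCont_def \<Omega>_xt)
  have "((\<lambda>t. Re (\<Omega> (of_real t)) - xs) \<longlongrightarrow> Re (of_real xs) - xs) (nhds xt)"
    by (intro tendsto_intros *)
  then show "(X \<longlongrightarrow> 0) (nhds xt)"
    by (simp add: X_def[abs_def])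
  have "((\<lambda>t. Im (\<Omega> (of_real t))) \<longlongrightarrow> Im (of_real xs)) (nhds xt)"
    by (intro tendsto_intros *)
  then show "(V \<longlongrightarrow> 0) (nhds xt)"
    by (simp add: V_def[abs_def])
qed

text \<open>A bootstrap: near \<open>xt\<close> the error term in the imaginary part is absorbed
  into half of a V, giving V <= K X^2. Then |\<Omega> - xs| is at most (1 + K) |X|, and all errors
  are expressed by X alone. The last conjunct allows the same absorption later.\<close>

lemma local_expansion:
  obtains C where "C \<ge> 0"
    "\<forall>\<^sub>F t in nhds xt. \<bar>X t\<bar> < \<delta> \<and> \<bar>t - xt - a * X t\<bar> \<le> C * (X t)\<^sup>2 \<and>
      \<bar>a * V t - \<tau> * pi * \<psi> (xs + X t)\<bar> \<le> C * V t * \<bar>X t\<bar> \<and> C * \<bar>X t\<bar> \<le> a / 2"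
proof -
  obtain C where C: "C \<ge> 0"
    "\<And>t. \<bar>Re (\<Omega> (of_real t)) - xs\<bar> < \<delta> \<Longrightarrow>
      cmod (of_real t - of_real xt - of_real a * (\<Omega> (of_real t) - of_real xs)) \<le> C * (cmod (\<Omega> (of_real t) - of_real xs))\<^sup>2"
    "\<And>t. \<bar>Re (\<Omega> (of_real t)) - xs\<bar> < \<delta> \<Longrightarrow>
      \<bar>a * Im (\<Omega> (of_real t)) - \<tau> * pi * \<psi> (Re (\<Omega> (of_real t)))\<bar>
        \<le> C * Im (\<Omega> (of_real t)) * cmod (\<Omega> (of_real t) - of_real xs)"
    using boundary_estimates by metis
  \<comment> \<open>From (a / 2) V <= \<open>\<tau>\<close> pi \<open>\<psi>\<close> <=
    \<open>\<tau>\<close> pi B X^2.\<close>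
  define K where "K = 2 / a * (\<tau> * pi * B)"
  have K: "K \<ge> 0"
    unfolding K_def using a_pos tau_pos B_nonneg by simp
  define C' where "C' = C * (1 + K)\<^sup>2"
  have C': "C' \<ge> 0" "C * (1 + K) \<le> C'"
    unfolding C'_def using C(1) K by (auto simp: power2_eq_square mult_left_mono)
  have "((\<lambda>t. C * (\<bar>X t\<bar> + V t)) \<longlongrightarrow> C * (\<bar>0\<bar> + 0)) (nhds xt)"
    by (intro tendsto_intros X_tendsto V_tendsto)
  then have e1: "\<forall>\<^sub>F t in nhds xt. C * (\<bar>X t\<bar> + V t) < a / 2"
    using a_pos by (intro order_tendstoD(2)) auto
  have "((\<lambda>t. C' * \<bar>X t\<bar>) \<longlongrightarrow> C' * \<bar>0\<bar>) (nhds xt)"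
    by (intro tendsto_intros X_tendsto)
  then have e2: "\<forall>\<^sub>F t in nhds xt. C' * \<bar>X t\<bar> < a / 2"
    using a_pos by (intro order_tendstoD(2)) auto
  have "((\<lambda>t. \<bar>X t\<bar>) \<longlongrightarrow> \<bar>0\<bar>) (nhds xt)"
    by (intro tendsto_intros X_tendsto)
  then have e3: "\<forall>\<^sub>F t in nhds xt. \<bar>X t\<bar> < min 1 \<delta>"
    using \<delta>_pos by (intro order_tendstoD(2)) auto
  have "\<forall>\<^sub>F t in nhds xt. \<bar>X t\<bar> < \<delta> \<and> \<bar>t - xt - a * X t\<bar> \<le> C' * (X t)\<^sup>2 \<and>
      \<bar>a * V t - \<tau> * pi * \<psi> (xs + X t)\<bar> \<le> C' * V t * \<bar>X t\<bar> \<and> C' * \<bar>X t\<bar> \<le> a / 2"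
    using e1 e2 e3
  proof eventually_elim
    case (elim t)
    let ?m = "cmod (\<Omega> (of_real t) - of_real xs)"
    have m: "?m \<le> \<bar>X t\<bar> + V t"
      using cmod_le[of "\<Omega> (of_real t) - of_real xs"] V_nonneg[of t] by (simp add: X_def V_def)
    have X\<delta>: "\<bar>Re (\<Omega> (of_real t)) - xs\<bar> < \<delta>"
      using elim(3) by (simp add: X_def)
    have est: "\<bar>a * V t - \<tau> * pi * \<psi> (xs + X t)\<bar> \<le> C * V t * ?m"
      using C(3)[OF X\<delta>] by (simp add: X_def V_def)
    have "C * ?m \<le> a / 2"
      using mult_left_mono[OF m C(1)] elim(1) by linarith
    then have "V t * (C * ?m) \<le> V t * (a / 2)"
      using V_nonneg by (rule mult_left_mono)
    then have "a / 2 * V t \<le> \<tau> * pi * \<psi> (xs + X t)"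
      using est by (simp add: mult_ac abs_le_iff)
    also have "\<dots> \<le> \<tau> * pi * (B * (X t)\<^sup>2)"
    proof (intro mult_left_mono)
      have "(X t)\<^sup>2 * \<phi> (xs + X t) \<le> (X t)\<^sup>2 * B"
        using \<phi>_bound[of "xs + X t"] by (intro mult_left_mono) auto
      then show "\<psi> (xs + X t) \<le> B * (X t)\<^sup>2"
        by (simp add: \<psi>_eq mult.commute)
    qed (use tau_pos in auto)
    finally have V: "V t \<le> K * (X t)\<^sup>2"
      unfolding K_def using a_pos by (simp add: field_simps)
    also have "\<dots> \<le> K * \<bar>X t\<bar>"
    proof (rule mult_left_mono[OF _ K])
      have "\<bar>X t\<bar> * \<bar>X t\<bar> \<le> 1 * \<bar>X t\<bar>"
        using elim(3) by (intro mult_right_mono) auto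
      then show "(X t)\<^sup>2 \<le> \<bar>X t\<bar>"
        by (simp add: power2_eq_square)
    qed
    finally have m': "?m \<le> (1 + K) * \<bar>X t\<bar>"
      using m by (simp add: algebra_simps)
    have "\<bar>t - xt - a * X t\<bar> \<le> cmod (of_real t - of_real xt - of_real a * (\<Omega> (of_real t) - of_real xs))"
      using abs_Re_le_cmod[of "of_real t - of_real xt - of_real a * (\<Omega> (of_real t) - of_real xs)"]
      by (simp add: X_def)
    also have "\<dots> \<le> C * ?m\<^sup>2"
      by (rule C(2)[OF X\<delta>])
    also have "\<dots> \<le> C * ((1 + K) * \<bar>X t\<bar>)\<^sup>2"
      using m' C(1) by (intro mult_left_mono power_mono) auto
    also have "\<dots> = C' * (X t)\<^sup>2"
      by (simp add: C'_def power_mult_distrib)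
    finally have 1: "\<bar>t - xt - a * X t\<bar> \<le> C' * (X t)\<^sup>2" .
    have "C * V t * ?m \<le> C * V t * ((1 + K) * \<bar>X t\<bar>)"
      using m' C(1) V_nonneg by (intro mult_left_mono) auto
    also have "\<dots> = C * (1 + K) * (V t * \<bar>X t\<bar>)"
      by simp
    also have "\<dots> \<le> C' * (V t * \<bar>X t\<bar>)"
      using C'(2) V_nonneg by (intro mult_right_mono) auto
    finally have "\<bar>a * V t - \<tau> * pi * \<psi> (xs + X t)\<bar> \<le> C' * V t * \<bar>X t\<bar>"
      using est by (simp add: mult_ac)
    with 1 show ?case
      using elim by auto
  qed
  with C'(1) show ?thesis
    by (rule that)
qed

text \<open>The quadratic error is at most half of a |X|, so t - xt has the sign of X and modulus at
  least a |X| / 2.\<close>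

lemma X_comparable:
  "\<forall>\<^sub>F t in nhds xt. \<bar>X t\<bar> \<le> 2 / a * \<bar>t - xt\<bar> \<and> (X t > 0 \<longleftrightarrow> t > xt) \<and> (X t = 0 \<longleftrightarrow> t = xt)"
proof -
  obtain C where C: "C \<ge> 0" "\<forall>\<^sub>F t in nhds xt. \<bar>X t\<bar> < \<delta> \<and> \<bar>t - xt - a * X t\<bar> \<le> C * (X t)\<^sup>2 \<and>
      \<bar>a * V t - \<tau> * pi * \<psi> (xs + X t)\<bar> \<le> C * V t * \<bar>X t\<bar> \<and> C * \<bar>X t\<bar> \<le> a / 2"
    by (rule local_expansion)
  from C(2) show ?thesis
  proof eventually_elim
    case (elim t)
    have "C * \<bar>X t\<bar> * \<bar>X t\<bar> \<le> a / 2 * \<bar>X t\<bar>"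
      using elim by (intro mult_right_mono) auto
    then have *: "\<bar>t - xt - a * X t\<bar> \<le> a / 2 * \<bar>X t\<bar>"
      using elim by (simp add: power2_eq_square mult.assoc)
    moreover have "a / 2 * \<bar>X t\<bar> = a * \<bar>X t\<bar> / 2"
      by simp
    moreover have "a * \<bar>X t\<bar> = \<bar>a * X t\<bar>"
      using a_pos by (simp add: abs_mult)
    moreover have "\<bar>a * X t\<bar> \<le> \<bar>t - xt\<bar> + \<bar>t - xt - a * X t\<bar>"
      by linarith
    ultimately have "a * \<bar>X t\<bar> \<le> 2 * \<bar>t - xt\<bar>"
      by linarith
    then have 1: "\<bar>X t\<bar> \<le> 2 / a * \<bar>t - xt\<bar>"
      using a_pos by (simp add: field_simps)
    have **: "\<bar>t - xt - a * X t\<bar> \<le> \<bar>a * X t\<bar> / 2"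
      using * a_pos by (simp add: abs_mult)
    have 2: "t > xt" if "X t > 0"
    proof -
      have "a * X t > 0"
        using that a_pos by simp
      then show ?thesis
        using ** by linarith
    qed
    have 3: "t < xt" if "X t < 0"
    proof -
      have "a * X t < 0"
        using that a_pos by (simp add: mult_less_0_iff)
      then show ?thesis
        using ** by linarith
    qed
    have 4: "t = xt" if "X t = 0"
      using * that by simp
    from 1 2 3 4 show ?case
      by (metis abs_le_zero_iff abs_zero diff_self less_irrefl linorder_less_linear mult_zero_right order_less_asym)
  qed
qed

lemma p_eq_V: "p t = V t / (pi * \<tau>)"
  by (simp add: p_def V_def)

text \<open>The error in a V ~ \<open>\<tau>\<close> pi \<open>\<psi>\<close> is itself proportional
  to V with a factor below a, so vanishing passes in both directions.\<close>

lemma p_zero_iff: "\<forall>\<^sub>F t in nhds xt. p t = 0 \<longleftrightarrow> \<psi> (xs + X t) = 0"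
proof -
  obtain C where C: "C \<ge> 0" "\<forall>\<^sub>F t in nhds xt. \<bar>X t\<bar> < \<delta> \<and> \<bar>t - xt - a * X t\<bar> \<le> C * (X t)\<^sup>2 \<and>
      \<bar>a * V t - \<tau> * pi * \<psi> (xs + X t)\<bar> \<le> C * V t * \<bar>X t\<bar> \<and> C * \<bar>X t\<bar> \<le> a / 2"
    by (rule local_expansion)
  from C(2) show ?thesis
  proof eventually_elim
    case (elim t)
    have "C * \<bar>X t\<bar> * V t \<le> a / 2 * V t"
      using elim V_nonneg by (intro mult_right_mono) auto
    then have "\<bar>a * V t - \<tau> * pi * \<psi> (xs + X t)\<bar> \<le> a / 2 * V t"
      using elim by (simp add: mult_ac)
    then have "V t = 0" if "\<psi> (xs + X t) = 0"
      using that a_pos V_nonneg[of t] by (simp add: abs_mult)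
    moreover have "\<psi> (xs + X t) = 0" if "V t = 0"
      using elim that tau_pos by simp
    ultimately show ?case
      using tau_pos by (auto simp: p_eq_V)
  qed
qed

text \<open>The quotient factors as \<open>f1 t * f2 t * y t powr r\<close>: imaginary parts, the
  analytic factor and the rescaling of X, each 1 + O(t - xt). A filter \<open>F\<close> is used
  because the even zero is approached from both sides and the edge only from the left.\<close>

lemma p_asymptotics:
  fixes h :: "real \<Rightarrow> real" and c r L :: real
  assumes F: "F \<le> at xt" and c: "c > 0" and L: "L \<ge> 0"
    and h: "\<And>x. \<bar>x - xs\<bar> < \<delta> \<Longrightarrow> \<bar>h x - 1\<bar> \<le> L * \<bar>x - xs\<bar>"
    and \<psi>: "\<forall>\<^sub>F t in F. \<psi> (xs + X t) = c powr (r + 1) * \<bar>X t\<bar> powr r * h (xs + X t)"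
  shows "(\<lambda>t. p t / ((c / a) powr (r + 1) * \<bar>t - xt\<bar> powr r) - 1) \<in> O[F](\<lambda>t. t - xt)"
proof -
  have nhds: "eventually Pr F" if "eventually Pr (nhds xt)" for Pr
    using that F by (meson at_le filter_leD eventually_nhds_conv_at le_filter_def)
  obtain C where C: "C \<ge> 0" and "\<forall>\<^sub>F t in nhds xt. \<bar>X t\<bar> < \<delta> \<and> \<bar>t - xt - a * X t\<bar> \<le> C * (X t)\<^sup>2 \<and>
      \<bar>a * V t - \<tau> * pi * \<psi> (xs + X t)\<bar> \<le> C * V t * \<bar>X t\<bar> \<and> C * \<bar>X t\<bar> \<le> a / 2"
    by (rule local_expansion)
  then have est: "\<forall>\<^sub>F t in F. \<bar>X t\<bar> < \<delta> \<and> \<bar>t - xt - a * X t\<bar> \<le> C * (X t)\<^sup>2 \<and>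
      \<bar>a * V t - \<tau> * pi * \<psi> (xs + X t)\<bar> \<le> C * V t * \<bar>X t\<bar> \<and> C * \<bar>X t\<bar> \<le> a / 2"
    by (intro nhds)
  have comp: "\<forall>\<^sub>F t in F. \<bar>X t\<bar> \<le> 2 / a * \<bar>t - xt\<bar> \<and> (X t > 0 \<longleftrightarrow> t > xt) \<and> (X t = 0 \<longleftrightarrow> t = xt)"
    by (rule nhds[OF X_comparable])
  have neq: "\<forall>\<^sub>F t in F. t \<noteq> xt"
    using F by (rule filter_leD) (simp add: eventually_at_filter)
  have "((\<lambda>t. L * \<bar>X t\<bar>) \<longlongrightarrow> L * \<bar>0\<bar>) (nhds xt)"
    by (intro tendsto_intros X_tendsto)
  then have "\<forall>\<^sub>F t in nhds xt. L * \<bar>X t\<bar> < 1 / 2"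
    by (intro order_tendstoD(2)) auto
  then have small: "\<forall>\<^sub>F t in F. L * \<bar>X t\<bar> < 1 / 2"
    by (rule nhds)
  define f1 where "f1 t = a * V t / (\<tau> * pi * \<psi> (xs + X t))" for t
  define f2 where "f2 t = h (xs + X t)" for t
  define y where "y t = a * \<bar>X t\<bar> / \<bar>t - xt\<bar>" for t
  have pos: "\<forall>\<^sub>F t in F. h (xs + X t) > 0 \<and> \<psi> (xs + X t) > 0"
    using est comp neq small \<psi>
  proof eventually_elim
    case (elim t)
    have "\<bar>h (xs + X t) - 1\<bar> \<le> L * \<bar>X t\<bar>"
      using h[of "xs + X t"] elim by simp
    then have "h (xs + X t) > 0"
      using elim(4) by linarith
    then show ?case
      using elim c by auto
  qed
  have f1: "(\<lambda>t. f1 t - 1) \<in> O[F](\<lambda>t. t - xt)"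
  proof (rule bigoI[of _ "C * (2 / a) * (2 / a)"])
    show "\<forall>\<^sub>F t in F. norm (f1 t - 1) \<le> C * (2 / a) * (2 / a) * norm (t - xt)"
      using est comp pos
    proof eventually_elim
      case (elim t)
      let ?d = "\<tau> * pi * \<psi> (xs + X t)"
      have d: "?d > 0"
        using elim tau_pos by simp
      have "C * \<bar>X t\<bar> * V t \<le> a / 2 * V t"
        using elim V_nonneg by (intro mult_right_mono) auto
      then have "a / 2 * V t \<le> ?d"
        using elim by (simp add: mult_ac abs_le_iff)
      then have V: "V t \<le> 2 / a * ?d"
        using a_pos by (simp add: field_simps)
      have "\<bar>a * V t - ?d\<bar> \<le> C * \<bar>X t\<bar> * V t"
        using elim by (simp add: mult_ac)
      also have "\<dots> \<le> C * (2 / a * \<bar>t - xt\<bar>) * (2 / a * ?d)"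
        using elim V C a_pos V_nonneg by (intro mult_mono mult_nonneg_nonneg) auto
      finally have "\<bar>a * V t - ?d\<bar> \<le> C * (2 / a) * (2 / a) * \<bar>t - xt\<bar> * ?d"
        by (simp add: mult_ac)
      moreover have "f1 t - 1 = (a * V t - ?d) / ?d"
      proof -
        have "?d / ?d = 1"
          using d by (intro divide_self) linarith
        then show ?thesis
          by (simp only: f1_def diff_divide_distrib)
      qed
      ultimately show ?case
        using d by (simp add: abs_divide divide_le_eq)
    qed
  qed
  have f2: "(\<lambda>t. f2 t - 1) \<in> O[F](\<lambda>t. t - xt)"
  proof (rule bigoI[of _ "L * (2 / a)"])
    show "\<forall>\<^sub>F t in F. norm (f2 t - 1) \<le> L * (2 / a) * norm (t - xt)"
      using est comp
    proof eventually_elim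
      case (elim t)
      have "\<bar>h (xs + X t) - 1\<bar> \<le> L * \<bar>X t\<bar>"
        using h[of "xs + X t"] elim by simp
      also have "\<dots> \<le> L * (2 / a * \<bar>t - xt\<bar>)"
        using elim L by (intro mult_left_mono) auto
      finally show ?case
        by (simp add: f2_def)
    qed
  qed
  define K where "K = C * (2 / a) * (2 / a)"
  have K: "K \<ge> 0"
    unfolding K_def using C a_pos by simp
  have y: "\<forall>\<^sub>F t in F. \<bar>y t - 1\<bar> \<le> K * \<bar>t - xt\<bar>"
    using est comp neq
  proof eventually_elim
    case (elim t)
    have T: "\<bar>t - xt\<bar> > 0"
      using elim by simp
    have "y t - 1 = (a * \<bar>X t\<bar> - \<bar>t - xt\<bar>) / \<bar>t - xt\<bar>"
      unfolding y_def using T by (simp add: diff_divide_distrib)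
    moreover have "\<bar>a * \<bar>X t\<bar> - \<bar>t - xt\<bar>\<bar> \<le> K * \<bar>t - xt\<bar> * \<bar>t - xt\<bar>"
    proof -
      have "\<bar>a * \<bar>X t\<bar> - \<bar>t - xt\<bar>\<bar> \<le> \<bar>t - xt - a * X t\<bar>"
        using a_pos abs_triangle_ineq3[of "a * X t" "t - xt"] by (simp add: abs_mult abs_minus_commute)
      also have "\<dots> \<le> C * (\<bar>X t\<bar> * \<bar>X t\<bar>)"
        using elim by (simp add: power2_eq_square)
      also have "\<dots> \<le> C * ((2 / a * \<bar>t - xt\<bar>) * (2 / a * \<bar>t - xt\<bar>))"
        using elim C a_pos by (intro mult_left_mono mult_mono) auto
      finally show ?thesis
        by (simp add: K_def mult_ac)
    qed
    ultimately show ?case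
      using T by (simp add: abs_divide divide_le_eq)
  qed
  obtain d D where D: "d > 0" "\<And>y. \<bar>y - 1\<bar> < d \<Longrightarrow> \<bar>y powr r - 1\<bar> \<le> D * \<bar>y - 1\<bar>"
    using powr_minus_1_bound[of r] by blast
  \<comment> \<open>The bound itself does not state the sign of \<open>D\<close>; testing it at y =
    1 + d / 2 yields it.\<close>
  have D0: "D \<ge> 0"
  proof -
    have "0 \<le> D * \<bar>1 + d / 2 - 1\<bar>"
      using D(2)[of "1 + d / 2"] D(1) by (intro order_trans[OF abs_ge_zero]) auto
    then show ?thesis
      using D(1) by (simp add: zero_le_mult_iff)
  qed
  have "((\<lambda>t. K * \<bar>t - xt\<bar>) \<longlongrightarrow> K * \<bar>xt - xt\<bar>) (nhds xt)"
    by (intro tendsto_intros filterlim_ident)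
  then have "\<forall>\<^sub>F t in nhds xt. K * \<bar>t - xt\<bar> < d"
    using D(1) by (intro order_tendstoD(2)) auto
  then have "\<forall>\<^sub>F t in F. K * \<bar>t - xt\<bar> < d"
    by (rule nhds)
  then have "\<forall>\<^sub>F t in F. norm (y t powr r - 1) \<le> D * K * norm (t - xt)"
    using y
  proof eventually_elim
    case (elim t)
    then have "\<bar>y t powr r - 1\<bar> \<le> D * \<bar>y t - 1\<bar>"
      by (intro D(2)) linarith
    also have "\<dots> \<le> D * (K * \<bar>t - xt\<bar>)"
      using elim D0 by (intro mult_left_mono) auto
    finally show ?case
      by simp
  qed
  then have f3: "(\<lambda>t. y t powr r - 1) \<in> O[F](\<lambda>t. t - xt)"
    by (rule bigoI)
  have one: "(\<lambda>t. t - xt) \<in> O[F](\<lambda>_. 1)"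
  proof (rule bigoI[of _ 1], rule nhds)
    show "\<forall>\<^sub>F t in nhds xt. norm (t - xt) \<le> 1 * norm (1 :: real)"
      unfolding eventually_nhds_metric by (intro exI[of _ 1]) (auto simp: dist_real_def)
  qed
  have "(\<lambda>t. f1 t * f2 t * y t powr r - 1) \<in> O[F](\<lambda>t. t - xt)"
    by (intro bigo_mult_minus_1 f1 f2 f3 one)
  also have "?this \<longleftrightarrow> ?thesis"
  proof (rule landau_o.big.in_cong)
    show "\<forall>\<^sub>F t in F. f1 t * f2 t * y t powr r - 1 = p t / ((c / a) powr (r + 1) * \<bar>t - xt\<bar> powr r) - 1"
      using pos neq comp \<psi>
    proof eventually_elim
      case (elim t)
      define q where "q = \<bar>X t\<bar> powr r * h (xs + X t)"
      have q: "q > 0"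
        unfolding q_def using elim by auto
      have \<psi>': "\<psi> (xs + X t) = c powr (r + 1) * q"
        using elim by (simp add: q_def)
      have "f2 t * y t powr r = q * a powr r / \<bar>t - xt\<bar> powr r"
        unfolding f2_def y_def q_def using a_pos by (simp add: powr_divide powr_mult)
      then have "f1 t * f2 t * y t powr r = a * V t / (\<tau> * pi * (c powr (r + 1) * q)) * (q * a powr r / \<bar>t - xt\<bar> powr r)"
        unfolding f1_def \<psi>' by (simp add: mult.assoc)
      also have "\<dots> = V t / (pi * \<tau>) * (a powr r * a / c powr (r + 1)) / \<bar>t - xt\<bar> powr r"
        using q by (simp add: mult_ac)
      \<comment> \<open>One factor \<open>a\<close> stems from the imaginary parts and
        \<open>a powr r\<close> from rescaling X; this is why the constant has exponent r +
        1.\<close>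
      also have "a powr r * a / c powr (r + 1) = 1 / (c / a) powr (r + 1)"
        using a_pos c by (simp add: powr_divide powr_add)
      finally show ?case
        by (simp add: p_eq_V)
    qed
  qed
  finally show ?thesis .
qed

end

section \<open>Supports, analytic functions and square root cusps\<close>

lemma msupp_density:
  fixes \<psi> :: "real \<Rightarrow> real"
  assumes cont: "continuous_on UNIV \<psi>" and nonneg: "\<And>s. \<psi> s \<ge> 0"
  shows "msupp (density lborel (\<lambda>s. ennreal (\<psi> s))) = closure {s. \<psi> s > 0}"
proof -
  let ?M = "density lborel (\<lambda>s. ennreal (\<psi> s))"
  have [measurable]: "\<psi> \<in> borel_measurable borel"
    using cont by (rule borel_measurable_continuous_onI)
  have emeasure: "emeasure ?M (ball x e) = (\<integral>\<^sup>+s. ennreal (\<psi> s) * indicator (ball x e) s \<partial>lborel)" for x e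
    by (rule emeasure_density) auto
  have "emeasure ?M (ball x e) > 0 \<longleftrightarrow> (\<exists>y\<in>{s. \<psi> s > 0}. dist y x < e)" for x e
  proof
    assume *: "emeasure ?M (ball x e) > 0"
    show "\<exists>y\<in>{s. \<psi> s > 0}. dist y x < e"
    proof (rule ccontr)
      assume "\<not> ?thesis"
      then have "\<not> \<psi> s > 0" if "s \<in> ball x e" for s
        using that by (auto simp: dist_commute)
      then have "\<psi> s = 0" if "s \<in> ball x e" for s
        using that nonneg[of s] by (simp add: order_antisym not_less)
      then have "ennreal (\<psi> s) * indicator (ball x e) s = 0" for s
        by (cases "s \<in> ball x e") auto
      then have "emeasure ?M (ball x e) = (\<integral>\<^sup>+(s::real). 0 \<partial>lborel)"
        unfolding emeasure by (simp only:)
      then show False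
        using * by simp
    qed
  next
    assume "\<exists>y\<in>{s. \<psi> s > 0}. dist y x < e"
    then obtain y where y: "\<psi> y > 0" "y \<in> ball x e"
      by (auto simp: dist_commute)
    have "open (ball x e \<inter> {s. \<psi> s > \<psi> y / 2})"
      by (intro open_Int open_ball open_Collect_less continuous_on_const cont)
    moreover have "y \<in> ball x e \<inter> {s. \<psi> s > \<psi> y / 2}"
      using y by simp
    ultimately obtain r where r: "r > 0" "cball y r \<subseteq> ball x e \<inter> {s. \<psi> s > \<psi> y / 2}"
      using open_contains_cball by metis
    have "0 < ennreal (\<psi> y / 2) * emeasure lborel {y - r..y + r}"
      using y r by (simp add: ennreal_zero_less_mult_iff)
    also have "\<dots> = (\<integral>\<^sup>+s. ennreal (\<psi> y / 2) * indicator {y - r..y + r} s \<partial>lborel)"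
      by (simp add: nn_integral_cmult_indicator)
    also have "\<dots> \<le> emeasure ?M (ball x e)"
      unfolding emeasure
    proof (intro nn_integral_mono)
      fix s
      show "ennreal (\<psi> y / 2) * indicator {y - r..y + r} s \<le> ennreal (\<psi> s) * indicator (ball x e) s"
      proof (cases "s \<in> {y - r..y + r}")
        case True
        then have "s \<in> cball y r"
          by (auto simp: dist_real_def)
        then have "s \<in> ball x e" "\<psi> s > \<psi> y / 2"
          using r(2) by auto
        then show ?thesis
          using True y by (simp add: ennreal_leI)
      qed simp
    qed
    finally show "emeasure ?M (ball x e) > 0" .
  qed
  then show ?thesis
    by (intro set_eqI) (simp add: msupp_def closure_approachable)
qed

text \<open>The series and its first two derivatives are bounded on a compact interval inside the
  disc of convergence; one \<open>B\<close> serves for all three estimates.\<close>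

lemma has_fps_expansion_real_bounds:
  fixes f :: "real \<Rightarrow> real"
  assumes "f has_fps_expansion F"
  obtains d B where "d > 0" "B \<ge> 0" "\<And>x. \<bar>x\<bar> \<le> d \<Longrightarrow> \<bar>f x\<bar> \<le> B"
    "\<And>x y. \<bar>x\<bar> \<le> d \<Longrightarrow> \<bar>y\<bar> \<le> d \<Longrightarrow> \<bar>f x - f y\<bar> \<le> B * \<bar>x - y\<bar>"
    "\<And>x u. \<bar>x\<bar> + \<bar>u\<bar> \<le> d \<Longrightarrow> \<bar>f (x + u) + f (x - u) - 2 * f x\<bar> \<le> B * u\<^sup>2"
proof -
  from assms have rad: "fps_conv_radius F > 0" and "\<forall>\<^sub>F z in nhds 0. eval_fps F z = f z"
    by (auto simp: has_fps_expansion_def)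
  then obtain d1 where d1: "d1 > 0" "\<And>x. \<bar>x\<bar> < d1 \<Longrightarrow> eval_fps F x = f x"
    by (auto simp: eventually_nhds_metric dist_real_def)
  obtain d2 where d2: "d2 > 0" "ereal d2 < fps_conv_radius F"
    using ereal_dense2[OF rad] by (metis ereal_less(2))
  define d where "d = min (d1 / 2) d2"
  have d: "d > 0" "d < d1" "ereal d < fps_conv_radius F"
    unfolding d_def using d1 d2 by (auto simp: min_def intro: le_less_trans[OF _ d2(2)])
  define F1 where "F1 = fps_deriv F"
  define F2 where "F2 = fps_deriv F1"
  have in0: "ereal \<bar>x\<bar> < fps_conv_radius F" if "\<bar>x\<bar> \<le> d" for x
    using that d(3) by (meson ereal_less_eq(3) le_less_trans)
  have in1: "ereal \<bar>x\<bar> < fps_conv_radius F1" if "\<bar>x\<bar> \<le> d" for x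
    unfolding F1_def using in0[OF that] fps_conv_radius_deriv[of F] by (rule less_le_trans)
  have in2: "ereal \<bar>x\<bar> < fps_conv_radius F2" if "\<bar>x\<bar> \<le> d" for x
    unfolding F2_def using in1[OF that] fps_conv_radius_deriv[of F1] by (rule less_le_trans)
  have bdd: "\<exists>C\<ge>0. \<forall>x. \<bar>x\<bar> \<le> d \<longrightarrow> \<bar>eval_fps G x\<bar> \<le> C"
    if "\<And>x. \<bar>x\<bar> \<le> d \<Longrightarrow> ereal \<bar>x\<bar> < fps_conv_radius G" for G :: "real fps"
  proof -
    have "continuous_on {-d..d} (eval_fps G)"
      using that by (intro continuous_on_eval_fps' continuous_on_id) auto
    then have "compact (eval_fps G ` {-d..d})"
      by (intro compact_continuous_image) auto
    then obtain C where "\<forall>y\<in>eval_fps G ` {-d..d}. norm y \<le> C"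
      using compact_imp_bounded bounded_iff by metis
    then show ?thesis
      by (intro exI[of _ "max C 0"]) (auto simp: abs_le_iff le_max_iff_disj)
  qed
  obtain B0 where B0: "B0 \<ge> 0" "\<And>x. \<bar>x\<bar> \<le> d \<Longrightarrow> \<bar>eval_fps F x\<bar> \<le> B0"
    using bdd[OF in0] by blast
  obtain B1 where B1: "B1 \<ge> 0" "\<And>x. \<bar>x\<bar> \<le> d \<Longrightarrow> \<bar>eval_fps F1 x\<bar> \<le> B1"
    using bdd[OF in1] by blast
  obtain B2 where B2: "B2 \<ge> 0" "\<And>x. \<bar>x\<bar> \<le> d \<Longrightarrow> \<bar>eval_fps F2 x\<bar> \<le> B2"
    using bdd[OF in2] by blast
  have D0: "(eval_fps F has_real_derivative eval_fps F1 x) (at x)" if "\<bar>x\<bar> \<le> d" for x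
    unfolding F1_def using in0[OF that] by (intro has_field_derivative_eval_fps) simp
  have D1: "(eval_fps F1 has_real_derivative eval_fps F2 x) (at x)" if "\<bar>x\<bar> \<le> d" for x
    unfolding F2_def using in1[OF that] by (intro has_field_derivative_eval_fps) simp
  have lip: "\<bar>eval_fps F x - eval_fps F y\<bar> \<le> B1 * \<bar>x - y\<bar>" if "\<bar>x\<bar> \<le> d" "\<bar>y\<bar> \<le> d" for x y
    unfolding real_norm_def[symmetric]
    by (rule field_differentiable_bound[where S = "{-d..d}" and f' = "eval_fps F1"])
      (use that in \<open>auto intro!: has_field_derivative_at_within D0 B1(2)\<close>)
  have lip1: "\<bar>eval_fps F1 x - eval_fps F1 y\<bar> \<le> B2 * \<bar>x - y\<bar>" if "\<bar>x\<bar> \<le> d" "\<bar>y\<bar> \<le> d" for x y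
    unfolding real_norm_def[symmetric]
    by (rule field_differentiable_bound[where S = "{-d..d}" and f' = "eval_fps F2"])
      (use that in \<open>auto intro!: has_field_derivative_at_within D1 B2(2)\<close>)
  have second: "\<bar>eval_fps F (x + u) + eval_fps F (x - u) - 2 * eval_fps F x\<bar> \<le> 2 * B2 * u\<^sup>2"
    if xu: "\<bar>x\<bar> + \<bar>u\<bar> \<le> d" for x u
  proof -
    \<comment> \<open>The second difference is the increment of this function from 0 to u; its
      derivative is a difference of first derivatives, of size at most 2 B2 |u|.\<close>
    let ?k = "\<lambda>t. eval_fps F (x + t) + eval_fps F (x - t)"
    have der: "(?k has_real_derivative eval_fps F1 (x + t) - eval_fps F1 (x - t)) (at t within {-\<bar>u\<bar>..\<bar>u\<bar>})"
      if "t \<in> {-\<bar>u\<bar>..\<bar>u\<bar>}" for t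
    proof (rule has_field_derivative_at_within)
      have *: "\<bar>x + t\<bar> \<le> d" "\<bar>x - t\<bar> \<le> d"
        using that xu by auto
      have "((\<lambda>t. eval_fps F (x + t)) has_real_derivative eval_fps F1 (x + t) * 1) (at t)"
        by (rule DERIV_chain2[where g = "\<lambda>t. x + t", OF D0[OF *(1)]]) (auto intro!: derivative_eq_intros)
      moreover have "((\<lambda>t. eval_fps F (x - t)) has_real_derivative eval_fps F1 (x - t) * (- 1)) (at t)"
        by (rule DERIV_chain2[where g = "\<lambda>t. x - t", OF D0[OF *(2)]]) (auto intro!: derivative_eq_intros)
      ultimately show "(?k has_real_derivative eval_fps F1 (x + t) - eval_fps F1 (x - t)) (at t)"
        using DERIV_add by fastforce
    qed
    have "\<bar>?k u - ?k 0\<bar> \<le> 2 * B2 * \<bar>u\<bar> * \<bar>u - 0\<bar>"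
      unfolding real_norm_def[symmetric]
    proof (rule field_differentiable_bound[OF _ der])
      fix t assume t: "t \<in> {-\<bar>u\<bar>..\<bar>u\<bar>}"
      have "\<bar>eval_fps F1 (x + t) - eval_fps F1 (x - t)\<bar> \<le> B2 * \<bar>x + t - (x - t)\<bar>"
        using t xu by (intro lip1) auto
      also have "\<dots> \<le> B2 * (2 * \<bar>u\<bar>)"
        using t B2(1) by (intro mult_left_mono) auto
      finally show "norm (eval_fps F1 (x + t) - eval_fps F1 (x - t)) \<le> 2 * B2 * norm u"
        by simp
    qed auto
    then show ?thesis
      by (simp add: power2_eq_square)
  qed
  define B where "B = B0 + B1 + 2 * B2"
  have B: "B \<ge> 0" "B0 \<le> B" "B1 \<le> B" "2 * B2 \<le> B"
    using B0(1) B1(1) B2(1) by (auto simp: B_def)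
  have f: "f x = eval_fps F x" if "\<bar>x\<bar> \<le> d" for x
    using d1(2)[of x] that d(2) by simp
  show ?thesis
  proof (rule that[OF d(1) B(1)])
    fix x assume "\<bar>x\<bar> \<le> d"
    then show "\<bar>f x\<bar> \<le> B"
      using B0(2)[of x] B(2) by (simp add: f)
  next
    fix x y assume xy: "\<bar>x\<bar> \<le> d" "\<bar>y\<bar> \<le> d"
    have "B1 * \<bar>x - y\<bar> \<le> B * \<bar>x - y\<bar>"
      using B(3) by (intro mult_right_mono) auto
    then show "\<bar>f x - f y\<bar> \<le> B * \<bar>x - y\<bar>"
      using lip[OF xy] xy by (simp add: f)
  next
    fix x u assume xu: "\<bar>x\<bar> + \<bar>u\<bar> \<le> d"
    have "2 * B2 * u\<^sup>2 \<le> B * u\<^sup>2"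
      using B(4) by (intro mult_right_mono) auto
    moreover have "f (x + u) = eval_fps F (x + u)" "f (x - u) = eval_fps F (x - u)" "f x = eval_fps F x"
      using xu by (auto intro!: f)
    ultimately show "\<bar>f (x + u) + f (x - u) - 2 * f x\<bar> \<le> B * u\<^sup>2"
      using second[OF xu] by simp
  qed
qed

lemma real_analytic_has_fps_expansion:
  assumes "real_analytic_on U h" "x \<in> U"
  obtains F where "(\<lambda>u. h (x + u)) has_fps_expansion F"
proof -
  obtain \<delta> a where "\<delta> > 0" and a: "\<And>s. \<bar>s - x\<bar> < \<delta> \<Longrightarrow> (\<lambda>n. a n * (s - x) ^ n) sums h s"
    using assms unfolding real_analytic_on_def by blast
  have "(\<lambda>n. Abs_fps a $ n * u ^ n) sums h (x + u)" if "dist u 0 < \<delta>" for u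
    using that a[of "x + u"] by (simp add: dist_real_def)
  then have "\<forall>\<^sub>F u in nhds 0. (\<lambda>n. Abs_fps a $ n * u ^ n) sums h (x + u)"
    unfolding eventually_nhds_metric using \<open>\<delta> > 0\<close> by blast
  then show ?thesis
    by (intro that has_fps_expansionI)
qed

lemma abs_sqrt_diff_le:
  assumes "x \<ge> 0" "y \<ge> 0"
  shows "\<bar>sqrt x - sqrt y\<bar> \<le> sqrt \<bar>x - y\<bar>"
proof -
  have *: "sqrt u - sqrt v \<le> sqrt (u - v)" if "0 \<le> v" "v \<le> u" for u v :: real
    using sqrt_add_le_add_sqrt[of "u - v" v] that by simp
  show ?thesis
    using *[of x y] *[of y x] assms by (cases "x \<le> y") auto
qed

text \<open>The natural scale is u^2 / y^(3/2); y <= 1 gives y <= sqrt y and weakens it to the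
  scale-invariant u^2 / y^2.\<close>

lemma sqrt_second_difference:
  fixes y u :: real
  assumes y: "0 < y" "y \<le> 1" and u: "\<bar>u\<bar> \<le> y / 2"
  shows "\<bar>sqrt (y + u) - sqrt y\<bar> \<le> \<bar>u\<bar> / y"
    and "\<bar>sqrt (y + u) + sqrt (y - u) - 2 * sqrt y\<bar> \<le> u\<^sup>2 / y\<^sup>2"
proof -
  define p q r where "p = sqrt (y + u)" and "q = sqrt (y - u)" and "r = sqrt y"
  have nn: "p \<ge> 0" "q \<ge> 0" "r > 0"
    using y u by (auto simp: p_def q_def r_def)
  have sq: "p * p = y + u" "q * q = y - u" "r * r = y"
    using y u by (auto simp: p_def q_def r_def)
  have ry: "y \<le> r"
  proof -
    have "r \<le> 1"
      using y by (simp add: r_def)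
    then have "r * r \<le> r * 1"
      using nn by (intro mult_left_mono) auto
    then show ?thesis
      using sq by simp
  qed
  have "\<bar>p - r\<bar> * y \<le> \<bar>p - r\<bar> * (p + r)"
    using ry nn by (intro mult_left_mono) auto
  also have "\<dots> = \<bar>(p - r) * (p + r)\<bar>"
    using nn by (simp add: abs_mult)
  also have "(p - r) * (p + r) = u"
    using sq by (simp add: algebra_simps)
  finally show "\<bar>sqrt (y + u) - sqrt y\<bar> \<le> \<bar>u\<bar> / y"
    using y by (simp add: p_def r_def field_simps)
  define e where "e = 2 * r - (p + q)"
  \<comment> \<open>Rationalizes twice: the first factor turns e into 2 (y - p q), the second turns
    this into 2 (y^2 - (y^2 - u^2)).\<close>
  define W where "W = (2 * r + (p + q)) * (y + p * q)"
  have "e * W = (4 * (r * r) - (p * p + q * q + 2 * (p * q))) * (y + p * q)"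
    by (simp add: e_def W_def algebra_simps)
  also have "\<dots> = 2 * (y * y - (p * q) * (p * q))"
    unfolding sq by (simp add: algebra_simps)
  also have "(p * q) * (p * q) = (p * p) * (q * q)"
    by simp
  also have "2 * (y * y - (p * p) * (q * q)) = 2 * u\<^sup>2"
    unfolding sq by (simp add: algebra_simps power2_eq_square)
  finally have eW: "e * W = 2 * u\<^sup>2" .
  have "2 * r * y \<le> W"
    unfolding W_def using nn y by (intro mult_mono) auto
  moreover have "2 * y * y \<le> 2 * r * y"
    using ry y by (intro mult_right_mono) auto
  ultimately have W: "2 * y\<^sup>2 \<le> W"
    by (simp add: power2_eq_square)
  have "W > 0"
    using W y by (smt (verit) zero_less_power)
  then have e0: "e \<ge> 0"
    using eW by (metis linorder_not_le mult_neg_pos not_less zero_le_mult_iff zero_le_numeral zero_le_power2)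
  have "e * (2 * y\<^sup>2) \<le> e * W"
    using W e0 by (rule mult_left_mono)
  then have "e \<le> u\<^sup>2 / y\<^sup>2"
    using eW y by (simp add: field_simps)
  then show "\<bar>sqrt (y + u) + sqrt (y - u) - 2 * sqrt y\<bar> \<le> u\<^sup>2 / y\<^sup>2"
    using e0 by (simp add: e_def p_def q_def r_def)
qed

lemma abs_le_sqrt_abs: "\<bar>x\<bar> \<le> 1 \<Longrightarrow> \<bar>x\<bar> \<le> sqrt \<bar>x\<bar>" for x :: real
  using mult_right_mono[of "sqrt \<bar>x\<bar>" 1 "sqrt \<bar>x\<bar>"] by simp

text \<open>A product rule for second differences, left of the cusp: each factor may carry the
  second difference, and the mixed terms are products of first differences. d <= 1/2 keeps distances
  below 1, where Lipschitz implies square root Hoelder.\<close>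

lemma square_root_cusp_bounds:
  fixes f :: "real \<Rightarrow> real" and x0 d B :: real
  defines "w \<equiv> \<lambda>s. sqrt (max 0 (x0 - s))"
  assumes d: "0 < d" "d \<le> 1 / 2" and B: "B \<ge> 0" "\<And>x. \<bar>x - x0\<bar> \<le> d \<Longrightarrow> \<bar>f x\<bar> \<le> B"
    "\<And>x y. \<bar>x - x0\<bar> \<le> d \<Longrightarrow> \<bar>y - x0\<bar> \<le> d \<Longrightarrow> \<bar>f x - f y\<bar> \<le> B * \<bar>x - y\<bar>"
    "\<And>x u. \<bar>x - x0\<bar> + \<bar>u\<bar> \<le> d \<Longrightarrow> \<bar>f (x + u) + f (x - u) - 2 * f x\<bar> \<le> B * u\<^sup>2"
  shows "\<bar>x - x0\<bar> \<le> d \<Longrightarrow> \<bar>w x * f x\<bar> \<le> B"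
    and "\<bar>x - x0\<bar> \<le> d \<Longrightarrow> \<bar>y - x0\<bar> \<le> d \<Longrightarrow> \<bar>w x * f x - w y * f y\<bar> \<le> 2 * B * sqrt \<bar>x - y\<bar>"
    and "x \<noteq> x0 \<Longrightarrow> \<bar>x - x0\<bar> \<le> d / 2 \<Longrightarrow> \<bar>u\<bar> \<le> \<bar>x - x0\<bar> / 2 \<Longrightarrow>
      \<bar>w (x + u) * f (x + u) + w (x - u) * f (x - u) - 2 * (w x * f x)\<bar> \<le> 4 * B * (u\<^sup>2 / (x - x0)\<^sup>2)"
proof -
  have w: "0 \<le> w x" "w x \<le> 1" if "\<bar>x - x0\<bar> \<le> d" for x
    using that d by (auto simp: w_def)
  have bnd: "\<bar>w x * f x\<bar> \<le> B" if "\<bar>x - x0\<bar> \<le> d" for x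
    using mult_mono[OF w(2)[OF that] B(2)[OF that]] w(1)[OF that] by (simp add: abs_mult)
  show "\<bar>x - x0\<bar> \<le> d \<Longrightarrow> \<bar>w x * f x\<bar> \<le> B"
    by (rule bnd)
  show "\<bar>w x * f x - w y * f y\<bar> \<le> 2 * B * sqrt \<bar>x - y\<bar>" if x: "\<bar>x - x0\<bar> \<le> d" and y: "\<bar>y - x0\<bar> \<le> d"
  proof -
    have "\<bar>w x - w y\<bar> \<le> sqrt \<bar>max 0 (x0 - x) - max 0 (x0 - y)\<bar>"
      unfolding w_def by (rule abs_sqrt_diff_le) auto
    also have "\<dots> \<le> sqrt \<bar>x - y\<bar>"
      by (rule real_sqrt_le_mono) auto
    finally have "\<bar>w x - w y\<bar> * \<bar>f x\<bar> \<le> sqrt \<bar>x - y\<bar> * B"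
      using B(2)[OF x] by (intro mult_mono) auto
    moreover have "\<bar>w y\<bar> * \<bar>f x - f y\<bar> \<le> 1 * (B * sqrt \<bar>x - y\<bar>)"
    proof (intro mult_mono)
      have "\<bar>x - y\<bar> \<le> sqrt \<bar>x - y\<bar>"
        using x y d by (intro abs_le_sqrt_abs) auto
      then show "\<bar>f x - f y\<bar> \<le> B * sqrt \<bar>x - y\<bar>"
        using B(3)[OF x y] mult_left_mono[OF _ B(1)] by (meson order_trans)
    qed (use w[OF y] in auto)
    moreover have "w x * f x - w y * f y = (w x - w y) * f x + w y * (f x - f y)"
      by (simp add: algebra_simps)
    ultimately show ?thesis
      using abs_triangle_ineq[of "(w x - w y) * f x" "w y * (f x - f y)"] by (simp add: abs_mult mult.commute)
  qed
  show "\<bar>w (x + u) * f (x + u) + w (x - u) * f (x - u) - 2 * (w x * f x)\<bar> \<le> 4 * B * (u\<^sup>2 / (x - x0)\<^sup>2)"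
    if x: "x \<noteq> x0" "\<bar>x - x0\<bar> \<le> d / 2" and u: "\<bar>u\<bar> \<le> \<bar>x - x0\<bar> / 2"
  proof (cases "x > x0")
    case True
    \<comment> \<open>The step u is at most half of the distance to \<open>x0\<close>, so none of
      the three points reaches the cusp.\<close>
    then have "w (x + u) = 0" "w (x - u) = 0" "w x = 0"
      using u by (auto simp: w_def)
    then show ?thesis
      using B(1) by simp
  next
    case False
    define y where "y = x0 - x"
    have y: "0 < y" "y \<le> 1" "\<bar>u\<bar> \<le> y / 2" "\<bar>- u\<bar> \<le> y / 2"
      using x u d False by (auto simp: y_def)
    have wy: "w (x + u) = sqrt (y + - u)" "w (x - u) = sqrt (y - - u)" "w x = sqrt y"
      using y by (auto simp: w_def y_def max_def)
    define \<alpha> \<alpha>' \<beta> \<beta>' where "\<alpha> = w (x + u) - w x" and "\<alpha>' = w (x - u) - w x"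
      and "\<beta> = f (x + u) - f x" and "\<beta>' = f (x - u) - f x"
    have near: "\<bar>x - x0\<bar> \<le> d" "\<bar>x + u - x0\<bar> \<le> d" "\<bar>x - u - x0\<bar> \<le> d" "\<bar>x - x0\<bar> + \<bar>u\<bar> \<le> d"
    proof -
      have "\<bar>u\<bar> \<le> d / 2"
        using x(2) u d(1) by argo
      moreover have "\<bar>x + u - x0\<bar> \<le> \<bar>x - x0\<bar> + \<bar>u\<bar>" "\<bar>x - u - x0\<bar> \<le> \<bar>x - x0\<bar> + \<bar>u\<bar>"
        by linarith+
      ultimately show "\<bar>x - x0\<bar> \<le> d" "\<bar>x + u - x0\<bar> \<le> d" "\<bar>x - u - x0\<bar> \<le> d" "\<bar>x - x0\<bar> + \<bar>u\<bar> \<le> d"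
        using x(2) d(1) by argo+
    qed
    define Y where "Y = u\<^sup>2 / y\<^sup>2"
    have Y0: "Y \<ge> 0"
      by (simp add: Y_def)
    have y2: "y\<^sup>2 \<le> 1" "y\<^sup>2 \<le> y"
      using y power_le_one[of y 2] by (auto simp: power2_eq_square mult_left_le)
    have uY: "u\<^sup>2 \<le> Y" "u\<^sup>2 / y \<le> Y"
      unfolding Y_def using y y2 divide_left_mono[of "y\<^sup>2" 1 "u\<^sup>2"] divide_left_mono[of "y\<^sup>2" y "u\<^sup>2"] by auto
    have \<alpha>: "\<bar>\<alpha>\<bar> \<le> \<bar>u\<bar> / y" "\<bar>\<alpha>'\<bar> \<le> \<bar>u\<bar> / y" "\<bar>\<alpha> + \<alpha>'\<bar> \<le> Y"
      using sqrt_second_difference[OF y(1,2,4)] sqrt_second_difference(1)[OF y(1,2,3)]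
      unfolding \<alpha>_def \<alpha>'_def wy Y_def by (auto simp: algebra_simps)
    have \<beta>: "\<bar>\<beta>\<bar> \<le> B * \<bar>u\<bar>" "\<bar>\<beta>'\<bar> \<le> B * \<bar>u\<bar>" "\<bar>\<beta> + \<beta>'\<bar> \<le> B * u\<^sup>2"
      using B(3)[OF near(2,1)] B(3)[OF near(3,1)] B(4)[OF near(4)]
      unfolding \<beta>_def \<beta>'_def by (auto simp: algebra_simps)
    have "\<bar>w x * (\<beta> + \<beta>')\<bar> \<le> 1 * (B * Y)"
      unfolding abs_mult using w[OF near(1)] \<beta>(3) mult_left_mono[OF uY(1) B(1)] B(1) Y0
      by (intro mult_mono) auto
    moreover have "\<bar>f x * (\<alpha> + \<alpha>')\<bar> \<le> B * Y"
      unfolding abs_mult using B(2)[OF near(1)] \<alpha>(3) B(1) by (intro mult_mono) auto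
    moreover have "\<bar>\<alpha> * \<beta>\<bar> \<le> B * Y" "\<bar>\<alpha>' * \<beta>'\<bar> \<le> B * Y"
    proof -
      have *: "\<bar>s * t\<bar> \<le> B * Y" if "\<bar>s\<bar> \<le> \<bar>u\<bar> / y" "\<bar>t\<bar> \<le> B * \<bar>u\<bar>" for s t
      proof -
        have "\<bar>s * t\<bar> \<le> \<bar>u\<bar> / y * (B * \<bar>u\<bar>)"
          unfolding abs_mult using that y by (intro mult_mono) auto
        also have "\<dots> = B * (u\<^sup>2 / y)"
          by (simp add: power2_eq_square)
        also have "\<dots> \<le> B * Y"
          using uY(2) B(1) by (rule mult_left_mono)
        finally show ?thesis .
      qed
      show "\<bar>\<alpha> * \<beta>\<bar> \<le> B * Y" "\<bar>\<alpha>' * \<beta>'\<bar> \<le> B * Y"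
        using * \<alpha> \<beta> by auto
    qed
    moreover have "w (x + u) * f (x + u) + w (x - u) * f (x - u) - 2 * (w x * f x)
        = w x * (\<beta> + \<beta>') + f x * (\<alpha> + \<alpha>') + \<alpha> * \<beta> + \<alpha>' * \<beta>'"
      unfolding \<alpha>_def \<alpha>'_def \<beta>_def \<beta>'_def by (simp add: algebra_simps)
    moreover have "4 * B * (u\<^sup>2 / (x - x0)\<^sup>2) = 1 * (B * Y) + B * Y + B * Y + B * Y"
      by (simp add: Y_def y_def power2_commute)
    ultimately show ?thesis
      by (simp only:)
  qed
qed

context semicircular_flow
begin

text \<open>Regularity is asked only of a local factor \<open>g\<close>. Far from \<open>xs\<close>
  the quotient of \<open>\<psi>\<close> by (s - xs)^2 is at most \<open>\<psi>\<close> /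
  \<open>\<epsilon>\<close>^2, which gives boundedness and integrability.\<close>

lemma vanishing_densityI:
  fixes \<psi> g :: "real \<Rightarrow> real" and xs \<epsilon> \<delta> B B\<psi> :: real
  assumes M_eq: "M = density lborel (\<lambda>s. ennreal (\<psi> s))"
    and nonneg: "\<And>s. \<psi> s \<ge> 0" and cont: "continuous_on UNIV \<psi>" and bound: "\<And>s. \<psi> s \<le> B\<psi>"
    and \<delta>: "\<delta> > 0" "2 * \<delta> \<le> \<epsilon>"
    and g: "\<And>s. \<bar>s - xs\<bar> \<le> \<epsilon> \<Longrightarrow> \<psi> s = (s - xs)\<^sup>2 * g s"
    and gB: "\<And>s. \<bar>s - xs\<bar> \<le> \<epsilon> \<Longrightarrow> \<bar>g s\<bar> \<le> B"
    and hoelder: "\<And>a b. \<bar>a - xs\<bar> \<le> 2 * \<delta> \<Longrightarrow> \<bar>b - xs\<bar> \<le> 2 * \<delta> \<Longrightarrow> \<bar>g a - g b\<bar> \<le> B * sqrt \<bar>a - b\<bar>"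
    and second: "\<And>x u. x \<noteq> xs \<Longrightarrow> \<bar>x - xs\<bar> \<le> \<delta> \<Longrightarrow> \<bar>u\<bar> \<le> \<bar>x - xs\<bar> / 2 \<Longrightarrow>
      \<bar>g (x + u) + g (x - u) - 2 * g x\<bar> \<le> B * (u\<^sup>2 / (x - xs)\<^sup>2)"
    and sub: "\<tau> * (\<integral>s. 1 / (xs - s)\<^sup>2 \<partial>M) < 1"
  obtains \<phi> B' where "vanishing_density M R \<tau> \<psi> \<phi> xs \<delta> B'"
proof -
  \<comment> \<open>The value at \<open>xs\<close> makes \<open>\<phi>\<close> agree with
    \<open>g\<close> on the whole neighbourhood, as the Hoelder bound requires.\<close>
  define \<phi> where "\<phi> s = (if s = xs then g xs else \<psi> s / (s - xs)\<^sup>2)" for s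
  define B' where "B' = B + B\<psi> / \<epsilon>\<^sup>2"
  have \<epsilon>: "\<epsilon> > 0"
    using \<delta> by simp
  have [measurable]: "\<psi> \<in> borel_measurable borel"
    using cont by (rule borel_measurable_continuous_onI)
  have B0: "B \<ge> 0"
    using gB[of xs] \<epsilon> by simp
  have B\<psi>0: "B\<psi> \<ge> 0"
    using nonneg[of 0] bound[of 0] by linarith
  have BB': "B \<le> B'"
    unfolding B'_def using B\<psi>0 by simp
  have [measurable]: "\<phi> \<in> borel_measurable borel"
    unfolding \<phi>_def by measurable
  have \<psi>\<phi>: "\<psi> s = (s - xs)\<^sup>2 * \<phi> s" for s
    using g[of xs] \<epsilon> by (simp add: \<phi>_def)
  have \<phi>g: "\<phi> s = g s" if "\<bar>s - xs\<bar> \<le> \<epsilon>" for s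
    using g[OF that] by (simp add: \<phi>_def)
  have far: "\<bar>\<phi> s\<bar> \<le> \<psi> s / \<epsilon>\<^sup>2" if "\<bar>s - xs\<bar> > \<epsilon>" for s
  proof -
    have "\<epsilon>\<^sup>2 \<le> (s - xs)\<^sup>2"
      using that \<epsilon> by (intro abs_le_square_iff[THEN iffD1]) auto
    then have "\<psi> s / (s - xs)\<^sup>2 \<le> \<psi> s / \<epsilon>\<^sup>2"
      using \<epsilon> nonneg that by (intro divide_left_mono mult_pos_pos) auto
    then show ?thesis
      using that \<epsilon> nonneg[of s] by (auto simp: \<phi>_def)
  qed
  have \<phi>_bound: "\<bar>\<phi> s\<bar> \<le> B'" for s
  proof (cases "\<bar>s - xs\<bar> \<le> \<epsilon>")
    case True
    then show ?thesis
      using gB[OF True] BB' by (simp add: \<phi>g)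
  next
    case False
    then have "\<bar>\<phi> s\<bar> \<le> B\<psi> / \<epsilon>\<^sup>2"
      using far[of s] divide_right_mono[OF bound[of s], of "\<epsilon>\<^sup>2"] by simp
    then show ?thesis
      unfolding B'_def using B0 by simp
  qed
  have \<psi>_int: "integrable lborel \<psi>"
  proof -
    have "integrable M (\<lambda>_. 1 :: real)"
      by simp
    then show ?thesis
      unfolding M_eq by (subst (asm) integrable_density) (auto simp: nonneg)
  qed
  have \<phi>_int: "integrable lborel \<phi>"
  proof (rule Bochner_Integration.integrable_bound)
    show "integrable lborel (\<lambda>s. indicator {xs - \<epsilon>..xs + \<epsilon>} s * B' + \<psi> s / \<epsilon>\<^sup>2)"
      by (intro Bochner_Integration.integrable_add integrable_mult_left integrable_divide_zero \<psi>_int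
          integrable_real_indicator) (auto simp: emeasure_lborel_Icc_eq)
    have "\<bar>\<phi> s\<bar> \<le> indicator {xs - \<epsilon>..xs + \<epsilon>} s * B' + \<psi> s / \<epsilon>\<^sup>2" for s
    proof (cases "\<bar>s - xs\<bar> \<le> \<epsilon>")
      case True
      then have "indicator {xs - \<epsilon>..xs + \<epsilon>} s = (1 :: real)"
        by (auto simp: indicator_def)
      moreover have "\<psi> s / \<epsilon>\<^sup>2 \<ge> 0"
        using nonneg by simp
      ultimately show ?thesis
        using \<phi>_bound[of s] by simp
    next
      case False
      then show ?thesis
        using far[of s] by (auto simp: indicator_def)
    qed
    then show "AE s in lborel. norm (\<phi> s) \<le> norm (indicator {xs - \<epsilon>..xs + \<epsilon>} s * B' + \<psi> s / \<epsilon>\<^sup>2)"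
      unfolding real_norm_def by (intro AE_I2 order_trans[OF _ abs_ge_self]) auto
  qed simp
  have "(\<integral>s. 1 / (xs - s)\<^sup>2 \<partial>M) = (\<integral>s. \<psi> s *\<^sub>R (1 / (xs - s)\<^sup>2) \<partial>lborel)"
    unfolding M_eq by (rule integral_density) (auto simp: nonneg)
  also have "\<dots> = (\<integral>s. \<phi> s \<partial>lborel)"
    by (rule integral_cong_AE, measurable, rule AE_mp[OF AE_lborel_singleton[of xs]])
      (auto simp: \<phi>_def power2_commute)
  finally have sub': "\<tau> * (\<integral>s. \<phi> s \<partial>lborel) < 1"
    using sub by simp
  have "vanishing_density M R \<tau> \<psi> \<phi> xs \<delta> B'"
  proof (intro vanishing_density.intro semicircular_flow_axioms vanishing_density_axioms.intro)
    fix a b assume ab: "\<bar>a - xs\<bar> \<le> 2 * \<delta>" "\<bar>b - xs\<bar> \<le> 2 * \<delta>"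
    have "B * sqrt \<bar>a - b\<bar> \<le> B' * sqrt \<bar>a - b\<bar>"
      using BB' by (intro mult_right_mono) auto
    then show "\<bar>\<phi> a - \<phi> b\<bar> \<le> B' * sqrt \<bar>a - b\<bar>"
      using hoelder[OF ab] ab \<delta> by (simp add: \<phi>g)
  next
    fix x u assume x: "x \<noteq> xs" "\<bar>x - xs\<bar> \<le> \<delta>" and u: "\<bar>u\<bar> \<le> \<bar>x - xs\<bar> / 2"
    have "\<phi> (x + u) = g (x + u)" "\<phi> (x - u) = g (x - u)" "\<phi> x = g x"
      using x u \<delta> by (auto intro!: \<phi>g)
    moreover have "B * (u\<^sup>2 / (x - xs)\<^sup>2) \<le> B' * (u\<^sup>2 / (x - xs)\<^sup>2)"
      using BB' by (intro mult_right_mono) auto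
    ultimately show "\<bar>\<phi> (x + u) + \<phi> (x - u) - 2 * \<phi> x\<bar> \<le> B' * (u\<^sup>2 / (x - xs)\<^sup>2)"
      using second[OF x u] by simp
  qed (use M_eq nonneg cont \<psi>\<phi> \<phi>_bound \<phi>_int \<delta> sub' in auto)
  then show ?thesis
    by (rule that)
qed

lemma msupp_\<rho>: "msupp \<rho> = closure {t. p t > 0}"
  unfolding \<rho>_def by (intro msupp_density continuous_p p_nonneg)

end

context vanishing_density
begin

text \<open>At s = xs the integrand 1 / (xs - s)^2 has the default value 0 while
  \<open>\<phi>\<close> is arbitrary; the point is null.\<close>

lemma A_eq: "A = (\<integral>s. 1 / (xs - s)\<^sup>2 \<partial>M)"
proof -
  have "(\<integral>s. 1 / (xs - s)\<^sup>2 \<partial>M) = (\<integral>s. \<psi> s *\<^sub>R (1 / (xs - s)\<^sup>2) \<partial>lborel)"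
    unfolding M_eq by (rule integral_density) (auto simp: \<psi>_nonneg)
  also have "\<dots> = A"
    unfolding A_def
    by (rule integral_cong_AE, measurable, rule AE_mp[OF AE_lborel_singleton[of xs]])
      (auto simp: \<psi>_eq power2_commute)
  finally show ?thesis ..
qed

lemma G0_eq: "G0 = (\<integral>s. 1 / (xs - s) \<partial>M)"
proof -
  have "(\<integral>s. 1 / (xs - s) \<partial>M) = (\<integral>s. \<psi> s *\<^sub>R (1 / (xs - s)) \<partial>lborel)"
    unfolding M_eq by (rule integral_density) (auto simp: \<psi>_nonneg)
  also have "\<dots> = (\<integral>s. - ((s - xs) * \<phi> s) \<partial>lborel)"
  proof (rule integral_cong_AE)
    have *: "\<psi> s *\<^sub>R (1 / (xs - s)) = - ((s - xs) * \<phi> s)" if "s \<noteq> xs" for s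
    proof -
      define \<sigma> where "\<sigma> = s - xs"
      have "xs - s = - \<sigma>" "\<sigma> \<noteq> 0"
        using that by (simp_all add: \<sigma>_def)
      then show ?thesis
        unfolding \<psi>_eq \<sigma>_def[symmetric] by (simp add: power2_eq_square)
    qed
    show "AE s in lborel. \<psi> s *\<^sub>R (1 / (xs - s)) = - ((s - xs) * \<phi> s)"
      using AE_lborel_singleton[of xs] by eventually_elim (rule *)
  qed measurable
  finally show ?thesis
    by (simp add: G0_def)
qed

end

section \<open>The local shape of the density\<close>

lemma eventually_nhds_imp_at: "eventually Q (nhds x) \<Longrightarrow> eventually Q (at x within S)"
  unfolding eventually_at_filter by (auto elim: eventually_mono)

context vanishing_density
begin

lemma eventually_X_small: "e > 0 \<Longrightarrow> \<forall>\<^sub>F t in nhds xt. \<bar>X t\<bar> < e"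
  using tendstoD[OF X_tendsto, of e] by (simp add: dist_real_def)

lemma eventually_pos:
  fixes h :: "real \<Rightarrow> real" and L :: real
  assumes "L \<ge> 0" and h: "\<And>x. \<bar>x - xs\<bar> < \<delta> \<Longrightarrow> \<bar>h x - 1\<bar> \<le> L * \<bar>x - xs\<bar>"
  shows "\<forall>\<^sub>F t in nhds xt. h (xs + X t) > 0"
proof -
  \<comment> \<open>\<open>L + 1\<close> avoids division by zero, and L / (L + 1) < 1 keeps h within
    distance 1 of 1.\<close>
  have "1 / (L + 1) > 0"
    using assms(1) by simp
  from eventually_X_small[OF \<delta>_pos] eventually_X_small[OF this] show ?thesis
  proof eventually_elim
    case (elim t)
    have "L * \<bar>X t\<bar> \<le> L * (1 / (L + 1))"
      using elim assms(1) by (intro mult_left_mono) auto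
    also have "\<dots> < 1"
      using assms(1) by simp
    finally have "\<bar>h (xs + X t) - 1\<bar> < 1"
      using h[of "xs + X t"] elim by simp
    then show ?case
      by linarith
  qed
qed

lemma even_order_zero:
  fixes h :: "real \<Rightarrow> real" and c L :: real and k :: nat
  assumes c: "c > 0" and L: "L \<ge> 0"
    and h: "\<And>x. \<bar>x - xs\<bar> < \<delta> \<Longrightarrow> \<bar>h x - 1\<bar> \<le> L * \<bar>x - xs\<bar>"
    and \<psi>: "\<And>x. \<bar>x - xs\<bar> < \<delta> \<Longrightarrow> \<psi> x = c ^ (2 * k + 1) * (x - xs) ^ (2 * k) * h x"
  shows "xt \<in> interior (msupp \<rho>)"
    and "(\<lambda>t. p t / ((c / a) ^ (2 * k + 1) * (t - xt) ^ (2 * k)) - 1) \<in> O[at xt](\<lambda>t. t - xt)"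
proof -
  have comp: "\<forall>\<^sub>F t in nhds xt. \<bar>X t\<bar> \<le> 2 / a * \<bar>t - xt\<bar> \<and> (X t > 0 \<longleftrightarrow> t > xt) \<and> (X t = 0 \<longleftrightarrow> t = xt)"
    by (rule X_comparable)
  have hpos: "\<forall>\<^sub>F t in nhds xt. h (xs + X t) > 0"
    using L h by (rule eventually_pos)
  have "\<forall>\<^sub>F t in nhds xt. t \<noteq> xt \<longrightarrow> p t > 0"
    using hpos eventually_X_small[OF \<delta>_pos] comp p_zero_iff
  proof eventually_elim
    case (elim t)
    show ?case
    proof
      assume "t \<noteq> xt"
      then have "\<psi> (xs + X t) \<noteq> 0"
        using \<psi>[of "xs + X t"] elim c by simp
      then show "p t > 0"
        using elim p_nonneg[of t] by (simp add: less_le)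
    qed
  qed
  then obtain r where r: "r > 0" "\<And>t. dist t xt < r \<Longrightarrow> t \<noteq> xt \<Longrightarrow> p t > 0"
    by (auto simp: eventually_nhds_metric)
  have "ball xt r \<subseteq> closure {t. p t > 0}"
  proof
    fix t assume t: "t \<in> ball xt r"
    show "t \<in> closure {t. p t > 0}"
    proof (cases "t = xt")
      case False
      then have "t \<in> {t. p t > 0}"
        using r(2)[of t] t by (simp add: dist_commute)
      then show ?thesis
        by (rule subsetD[OF closure_subset])
    next
      case True
      \<comment> \<open>\<open>\<psi>\<close> vanishes at \<open>xs\<close>, hence \<open>p\<close>
        at \<open>xt\<close>, so \<open>xt\<close> enters the support only as a limit of nearby
        points.\<close>
      have "\<exists>y\<in>{t. p t > 0}. dist y xt < e" if e: "e > 0" for e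
      proof -
        obtain q where "q > 0" "q < min e r"
          using dense[of 0 "min e r"] e r(1) by auto
        then show ?thesis
          using r(2)[of "xt + q"] by (intro bexI[of _ "xt + q"]) (auto simp: dist_real_def)
      qed
      then show ?thesis
        unfolding True closure_approachable by blast
    qed
  qed
  then show "xt \<in> interior (msupp \<rho>)"
    unfolding msupp_\<rho> mem_interior using r(1) by blast
  have near: "\<forall>\<^sub>F t in at xt. \<bar>X t\<bar> < \<delta>"
    by (rule eventually_nhds_imp_at[OF eventually_X_small[OF \<delta>_pos]])
  have comp': "\<forall>\<^sub>F t in at xt. X t = 0 \<longleftrightarrow> t = xt"
    using eventually_nhds_imp_at[OF comp] by eventually_elim blast
  have neq: "\<forall>\<^sub>F t in at xt. t \<noteq> xt"
    by (simp add: eventually_at_filter)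
  have even: "\<bar>y\<bar> powr real (2 * k) = y ^ (2 * k)" if "y \<noteq> 0" for y :: real
    using that by (subst powr_realpow) (auto simp: power_even_abs)
  have odd: "y powr (real (2 * k) + 1) = y ^ (2 * k + 1)" if "y > 0" for y :: real
    using that powr_realpow[of y "2 * k + 1"] by (simp add: add.commute)
  have "(\<lambda>t. p t / ((c / a) powr (real (2 * k) + 1) * \<bar>t - xt\<bar> powr real (2 * k)) - 1) \<in> O[at xt](\<lambda>t. t - xt)"
  proof (rule p_asymptotics[OF order_refl c L h])
    show "\<forall>\<^sub>F t in at xt. \<psi> (xs + X t) = c powr (real (2 * k) + 1) * \<bar>X t\<bar> powr real (2 * k) * h (xs + X t)"
      using near comp' neq
    proof eventually_elim
      case (elim t)
      then show ?case
        using \<psi>[of "xs + X t"] even[of "X t"] odd[OF c] by simp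
    qed
  qed
  also have "?this \<longleftrightarrow> (\<lambda>t. p t / ((c / a) ^ (2 * k + 1) * (t - xt) ^ (2 * k)) - 1) \<in> O[at xt](\<lambda>t. t - xt)"
  proof (rule landau_o.big.in_cong)
    show "\<forall>\<^sub>F t in at xt. p t / ((c / a) powr (real (2 * k) + 1) * \<bar>t - xt\<bar> powr real (2 * k)) - 1
        = p t / ((c / a) ^ (2 * k + 1) * (t - xt) ^ (2 * k)) - 1"
      using neq
    proof eventually_elim
      case (elim t)
      show ?case
        using even[of "t - xt"] odd[of "c / a"] elim c a_pos by simp
    qed
  qed
  finally show "(\<lambda>t. p t / ((c / a) ^ (2 * k + 1) * (t - xt) ^ (2 * k)) - 1) \<in> O[at xt](\<lambda>t. t - xt)" .
qed

text \<open>X has the sign of t - xt and zeros of \<open>\<psi>\<close> transfer to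
  \<open>p\<close>, so near \<open>xt\<close> positivity of \<open>p\<close> means exactly t <
  xt.\<close>

lemma right_edge_zero:
  fixes h :: "real \<Rightarrow> real" and c L r :: real
  assumes c: "c > 0" and L: "L \<ge> 0"
    and h: "\<And>x. \<bar>x - xs\<bar> < \<delta> \<Longrightarrow> \<bar>h x - 1\<bar> \<le> L * \<bar>x - xs\<bar>"
    and left: "\<And>x. \<bar>x - xs\<bar> < \<delta> \<Longrightarrow> x \<le> xs \<Longrightarrow> \<psi> x = c powr (r + 1) * (xs - x) powr r * h x"
    and right: "\<And>x. \<bar>x - xs\<bar> < \<delta> \<Longrightarrow> x \<ge> xs \<Longrightarrow> \<psi> x = 0"
  shows "xt \<in> msupp \<rho>" and "\<exists>d>0. {xt<..<xt + d} \<inter> msupp \<rho> = {}"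
    and "(\<lambda>t. p t / ((c / a) powr (r + 1) * (xt - t) powr r) - 1) \<in> O[at_left xt](\<lambda>t. sqrt (xt - t))"
    and "\<exists>e>0. \<forall>t\<in>{xt..xt + e}. p t = 0"
proof -
  have comp: "\<forall>\<^sub>F t in nhds xt. \<bar>X t\<bar> \<le> 2 / a * \<bar>t - xt\<bar> \<and> (X t > 0 \<longleftrightarrow> t > xt) \<and> (X t = 0 \<longleftrightarrow> t = xt)"
    by (rule X_comparable)
  have hpos: "\<forall>\<^sub>F t in nhds xt. h (xs + X t) > 0"
    using L h by (rule eventually_pos)
  have "\<forall>\<^sub>F t in nhds xt. p t > 0 \<longleftrightarrow> t < xt"
    using hpos eventually_X_small[OF \<delta>_pos] comp p_zero_iff
  proof eventually_elim
    case (elim t)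
    show ?case
    proof (cases "t < xt")
      case True
      then have "X t < 0"
        using elim by auto
      then have "\<psi> (xs + X t) \<noteq> 0"
        using left[of "xs + X t"] elim c by simp
      then show ?thesis
        using True elim p_nonneg[of t] by (simp add: less_le)
    next
      case False
      then have "X t \<ge> 0"
        using elim by (metis linorder_neqE_linordered_idom order.order_iff_strict)
      then have "\<psi> (xs + X t) = 0"
        using right[of "xs + X t"] elim by simp
      then show ?thesis
        using False elim by simp
    qed
  qed
  then obtain d where d: "d > 0" "\<And>t. dist t xt < d \<Longrightarrow> p t > 0 \<longleftrightarrow> t < xt"
    by (auto simp: eventually_nhds_metric)
  have zero: "p t = 0" if "xt \<le> t" "t < xt + d" for t
    using d(2)[of t] that p_nonneg[of t] by (auto simp: dist_real_def less_le)
  have "\<exists>y\<in>{t. p t > 0}. dist y xt < e" if e: "e > 0" for e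
  proof -
    obtain q where "q > 0" "q < min e d"
      using dense[of 0 "min e d"] e d(1) by auto
    then show ?thesis
      using d(2)[of "xt - q"] by (intro bexI[of _ "xt - q"]) (auto simp: dist_real_def)
  qed
  then show "xt \<in> msupp \<rho>"
    unfolding msupp_\<rho> closure_approachable by blast
  have "{xt<..<xt + d} \<inter> {t. p t > 0} = {}"
    using zero by force
  then have "{xt<..<xt + d} \<inter> msupp \<rho> = {}"
    unfolding msupp_\<rho> by (subst open_Int_closure_eq_empty) auto
  then show "\<exists>d>0. {xt<..<xt + d} \<inter> msupp \<rho> = {}"
    using d(1) by blast
  show "\<exists>e>0. \<forall>t\<in>{xt..xt + e}. p t = 0"
    using d(1) zero by (intro exI[of _ "d / 2"]) auto
  have near: "\<forall>\<^sub>F t in at_left xt. \<bar>X t\<bar> < \<delta>"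
    by (rule eventually_nhds_imp_at[OF eventually_X_small[OF \<delta>_pos]])
  have lt: "\<forall>\<^sub>F t in at_left xt. t < xt"
    by (simp add: eventually_at_filter)
  have neg: "\<forall>\<^sub>F t in at_left xt. X t < 0"
    using eventually_nhds_imp_at[OF comp] lt by eventually_elim (metis less_asym linorder_neqE_linordered_idom)
  have "(\<lambda>t. p t / ((c / a) powr (r + 1) * \<bar>t - xt\<bar> powr r) - 1) \<in> O[at_left xt](\<lambda>t. t - xt)"
  proof (rule p_asymptotics[OF _ c L h])
    show "at_left xt \<le> at xt"
      by (simp add: at_le)
    show "\<forall>\<^sub>F t in at_left xt. \<psi> (xs + X t) = c powr (r + 1) * \<bar>X t\<bar> powr r * h (xs + X t)"
      using near neg
    proof eventually_elim
      case (elim t)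
      then show ?case
        using left[of "xs + X t"] by simp
    qed
  qed
  also have "?this \<longleftrightarrow> (\<lambda>t. p t / ((c / a) powr (r + 1) * (xt - t) powr r) - 1) \<in> O[at_left xt](\<lambda>t. t - xt)"
    using lt by (intro landau_o.big.in_cong) (auto elim!: eventually_mono)
  finally have 1: "(\<lambda>t. p t / ((c / a) powr (r + 1) * (xt - t) powr r) - 1) \<in> O[at_left xt](\<lambda>t. t - xt)" .
  \<comment> \<open>The error obtained is linear in xt - t; the square root of the claim is a weaker
    scale.\<close>
  have "(\<lambda>t. t - xt) \<in> O[at_left xt](\<lambda>t. sqrt (xt - t))"
  proof (rule bigoI[of _ 1])
    have "\<forall>\<^sub>F t in at_left xt. xt - 1 < t \<and> t < xt"
      using eventually_at_left_real[of "xt - 1" xt] by simp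
    then show "\<forall>\<^sub>F t in at_left xt. norm (t - xt) \<le> 1 * norm (sqrt (xt - t))"
    proof eventually_elim
      case (elim t)
      then show ?case
        using abs_le_sqrt_abs[of "xt - t"] by simp
    qed
  qed
  with 1 show "(\<lambda>t. p t / ((c / a) powr (r + 1) * (xt - t) powr r) - 1) \<in> O[at_left xt](\<lambda>t. sqrt (xt - t))"
    by (rule landau_o.big_trans)
qed

end

text \<open>In case (a) \<open>\<phi>\<close> is real analytic at \<open>xs\<close>; in case (b) it is \<open>sqrt (max 0 (xs - s))\<close> times
  a function that is real analytic at \<open>xs\<close>.\<close>

theorem theorem1p1:
  fixes \<mu>0 :: "real measure" and \<psi>0 h :: "real \<Rightarrow> real"
    and xs c0 \<tau> :: real and k :: nat
  assumes prob: "prob_space \<mu>0" and sets0: "sets \<mu>0 = sets borel"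
    \<comment> \<open>Assumption A\<close>
    and cont: "continuous_on UNIV \<psi>0" and nonneg: "\<And>s. \<psi>0 s \<ge> 0"
    and dens: "\<mu>0 = density lborel (\<lambda>s. ennreal (\<psi>0 s))"
    and cpt: "compact (msupp \<mu>0)"
    \<comment> \<open>Assumption B, common part\<close>
    and xs_supp: "xs \<in> msupp \<mu>0" and c0: "c0 > 0" and k: "k \<ge> 1"
    and h_an: "\<exists>U. open U \<and> xs \<in> U \<and> real_analytic_on U h" and h1: "h xs = 1"
    and B: "(xs \<in> interior (msupp \<mu>0) \<and>
              (\<forall>s\<in>msupp \<mu>0. \<psi>0 s = c0 ^ (2*k+1) * (s - xs) ^ (2*k) * h s))
          \<or> (\<exists>\<epsilon>>0. (\<forall>s\<in>{xs-\<epsilon>..xs}. \<psi>0 s = c0 powr (2*real k + 3/2) * (xs - s) powr (2*real k + 1/2) * h s)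
                   \<and> (\<forall>s\<in>{xs..xs+\<epsilon>}. \<psi>0 s = 0))"
    and tau: "0 < \<tau>" "\<tau> < tau_crit \<mu>0 xs"
  defines "\<mu>\<tau> \<equiv> \<mu>0 \<boxplus> semicircle \<tau>"
    and "ct \<equiv> tau_crit \<mu>0 xs / (tau_crit \<mu>0 xs - \<tau>) * c0"
    and "xt \<equiv> xs + \<tau> * (\<integral>s. 1 / (xs - s) \<partial>\<mu>0)"
  shows "\<exists>\<psi>t :: real \<Rightarrow> real.
      continuous_on UNIV \<psi>t \<and> (\<forall>s. \<psi>t s \<ge> 0) \<and>
      \<mu>\<tau> = density lborel (\<lambda>s. ennreal (\<psi>t s)) \<and>
      ((xs \<in> interior (msupp \<mu>0) \<and>
              (\<forall>s\<in>msupp \<mu>0. \<psi>0 s = c0 ^ (2*k+1) * (s - xs) ^ (2*k) * h s)) \<longrightarrow>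
         xt \<in> interior (msupp \<mu>\<tau>) \<and>
         (\<lambda>s. \<psi>t s / (ct ^ (2*k+1) * (s - xt) ^ (2*k)) - 1) \<in> O[at xt](\<lambda>s. s - xt)) \<and>
      ((\<exists>\<epsilon>>0. (\<forall>s\<in>{xs-\<epsilon>..xs}. \<psi>0 s = c0 powr (2*real k + 3/2) * (xs - s) powr (2*real k + 1/2) * h s)
                   \<and> (\<forall>s\<in>{xs..xs+\<epsilon>}. \<psi>0 s = 0)) \<longrightarrow>
         xt \<in> msupp \<mu>\<tau> \<and> (\<exists>\<delta>>0. {xt<..<xt+\<delta>} \<inter> msupp \<mu>\<tau> = {}) \<and>
         (\<lambda>s. \<psi>t s / (ct powr (2*real k + 3/2) * (xt - s) powr (2*real k + 1/2)) - 1)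
            \<in> O[at_left xt](\<lambda>s. sqrt (xt - s)) \<and>
         (\<exists>\<epsilon>>0. \<forall>s\<in>{xt..xt+\<epsilon>}. \<psi>t s = 0))"
proof -
  have supp: "msupp \<mu>0 = closure {s. \<psi>0 s > 0}"
    unfolding dens by (rule msupp_density[OF cont nonneg])
  obtain R where R: "R > 0" "\<And>s. s \<in> msupp \<mu>0 \<Longrightarrow> \<bar>s\<bar> \<le> R"
    using compact_imp_bounded[OF cpt] by (auto simp: bounded_pos)
  have \<psi>0_R: "\<psi>0 s = 0" if "\<bar>s\<bar> > R" for s
  proof (rule ccontr)
    assume "\<psi>0 s \<noteq> 0"
    then have "s \<in> {s. \<psi>0 s > 0}"
      using nonneg[of s] by simp
    then have "s \<in> msupp \<mu>0"
      unfolding supp by (rule subsetD[OF closure_subset])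
    then show False
      using R(2)[of s] that by simp
  qed
  obtain B\<psi> where B\<psi>: "\<And>s. \<psi>0 s \<le> B\<psi>"
  proof -
    have "compact (\<psi>0 ` {-R..R})"
      by (intro compact_continuous_image continuous_on_subset[OF cont]) auto
    then obtain b where b: "\<forall>y\<in>\<psi>0 ` {-R..R}. norm y \<le> b"
      using compact_imp_bounded bounded_iff by metis
    have "\<psi>0 s \<le> max b 0" for s
    proof (cases "\<bar>s\<bar> > R")
      case False
      then have "s \<in> {-R..R}"
        by auto
      then show ?thesis
        using b by force
    qed (simp add: \<psi>0_R)
    then show ?thesis
      by (rule that)
  qed
  have [measurable]: "\<psi>0 \<in> borel_measurable borel"
    using cont by (rule borel_measurable_continuous_onI)
  have "AE s in \<mu>0. \<bar>s\<bar> \<le> R"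
  proof -
    have "ennreal (\<psi>0 s) > 0 \<longrightarrow> \<bar>s\<bar> \<le> R" for s
      using \<psi>0_R[of s] by (cases "\<bar>s\<bar> \<le> R") auto
    then show ?thesis
      unfolding dens by (subst AE_density) auto
  qed
  then interpret semicircular_flow \<mu>0 R \<tau>
    using prob sets0 R(1) tau(1)
    unfolding semicircular_flow_def semicircular_flow_axioms_def by (auto intro: bounded_lawI)
  define I where "I = (\<integral>s. 1 / (xs - s)\<^sup>2 \<partial>\<mu>0)"
  have crit: "tau_crit \<mu>0 xs = inverse I"
    by (simp add: tau_crit_def I_def)
  \<comment> \<open>A non-integrable integrand would give the integral the default value 0 and thus
    \<open>tau_crit\<close> = 0, contradicting 0 < \<open>\<tau>\<close> <
    \<open>tau_crit\<close>.\<close>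
  have I: "I > 0" "\<tau> * I < 1"
  proof -
    show "I > 0"
      using tau by (simp add: crit) (meson inverse_positive_iff_positive order_less_trans)
    then show "\<tau> * I < 1"
      using tau(2) by (simp add: crit field_simps)
  qed
  have ct: "ct = c0 / (1 - \<tau> * I)"
    unfolding ct_def crit using I by (simp add: field_simps)
  obtain F where F: "(\<lambda>u. h (xs + u)) has_fps_expansion F"
    using h_an real_analytic_has_fps_expansion by metis
  obtain dh L where h: "dh > 0" "L \<ge> 0"
    "\<And>x y. \<bar>x\<bar> \<le> dh \<Longrightarrow> \<bar>y\<bar> \<le> dh \<Longrightarrow> \<bar>h (xs + x) - h (xs + y)\<bar> \<le> L * \<bar>x - y\<bar>"
    using has_fps_expansion_real_bounds[OF F] by metis
  have h_lip: "\<bar>h x - 1\<bar> \<le> L * \<bar>x - xs\<bar>" if "\<bar>x - xs\<bar> \<le> dh" for x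
    using h(3)[of "x - xs" 0] that h(1) h1 by simp
  \<comment> \<open>The density divided by (s - xs)^2, up to sqrt (xs - s) in case (b). k >= 1 keeps
    the natural number 2 k - 2 from being truncated. The constant c differs between the
    cases.\<close>
  define g where "g c s = c * (s - xs) ^ (2 * k - 2) * h s" for c s
  have g_bounds: "\<exists>d B. d > 0 \<and> B \<ge> 0 \<and> (\<forall>x. \<bar>x - xs\<bar> \<le> d \<longrightarrow> \<bar>g c x\<bar> \<le> B) \<and>
    (\<forall>x y. \<bar>x - xs\<bar> \<le> d \<longrightarrow> \<bar>y - xs\<bar> \<le> d \<longrightarrow> \<bar>g c x - g c y\<bar> \<le> B * \<bar>x - y\<bar>) \<and>
    (\<forall>x u. \<bar>x - xs\<bar> + \<bar>u\<bar> \<le> d \<longrightarrow> \<bar>g c (x + u) + g c (x - u) - 2 * g c x\<bar> \<le> B * u\<^sup>2)" for c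
  proof -
    have "(\<lambda>u. g c (xs + u)) has_fps_expansion fps_const c * fps_X ^ (2 * k - 2) * F"
      unfolding g_def add_diff_cancel_left'
      by (intro has_fps_expansion_mult has_fps_expansion_const has_fps_expansion_fps_X_power F)
    then obtain d B where b: "d > 0" "B \<ge> 0" "\<And>x. \<bar>x\<bar> \<le> d \<Longrightarrow> \<bar>g c (xs + x)\<bar> \<le> B"
      "\<And>x y. \<bar>x\<bar> \<le> d \<Longrightarrow> \<bar>y\<bar> \<le> d \<Longrightarrow> \<bar>g c (xs + x) - g c (xs + y)\<bar> \<le> B * \<bar>x - y\<bar>"
      "\<And>x u. \<bar>x\<bar> + \<bar>u\<bar> \<le> d \<Longrightarrow> \<bar>g c (xs + (x + u)) + g c (xs + (x - u)) - 2 * g c (xs + x)\<bar> \<le> B * u\<^sup>2"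
      by (rule has_fps_expansion_real_bounds) blast
    show ?thesis
    proof (rule exI[of _ d], rule exI[of _ B], intro conjI allI impI)
      show "\<bar>g c x\<bar> \<le> B" if "\<bar>x - xs\<bar> \<le> d" for x
        using b(3)[of "x - xs"] that by simp
      show "\<bar>g c x - g c y\<bar> \<le> B * \<bar>x - y\<bar>" if "\<bar>x - xs\<bar> \<le> d" "\<bar>y - xs\<bar> \<le> d" for x y
        using b(4)[of "x - xs" "y - xs"] that by simp
      show "\<bar>g c (x + u) + g c (x - u) - 2 * g c x\<bar> \<le> B * u\<^sup>2" if "\<bar>x - xs\<bar> + \<bar>u\<bar> \<le> d" for x u
      proof -
        have "xs + (x - xs + u) = x + u" "xs + (x - xs - u) = x - u" "xs + (x - xs) = x"
          by auto
        then show ?thesis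
          using b(5)[of "x - xs" u] that by simp
      qed
    qed (use b in auto)
  qed
  have k2: "(s - xs)\<^sup>2 * (s - xs) ^ (2 * k - 2) = (s - xs) ^ (2 * k)" for s
    using k by (cases k) (simp_all add: power2_eq_square)

  have conv: "\<mu>\<tau> = \<rho>"
    unfolding \<mu>\<tau>_def by (rule free_add_conv_semicircle)

  have case_a: "xt \<in> interior (msupp \<mu>\<tau>) \<and>
      (\<lambda>s. p s / (ct ^ (2*k+1) * (s - xt) ^ (2*k)) - 1) \<in> O[at xt](\<lambda>s. s - xt)"
    if a: "xs \<in> interior (msupp \<mu>0)" "\<forall>s\<in>msupp \<mu>0. \<psi>0 s = c0 ^ (2*k+1) * (s - xs) ^ (2*k) * h s"
  proof -
    obtain e where e: "e > 0" "cball xs e \<subseteq> msupp \<mu>0"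
      using a(1) by (auto simp: mem_interior_cball)
    define c where "c = c0 ^ (2 * k + 1)"
    obtain d B where b: "d > 0" "B \<ge> 0" "\<And>x. \<bar>x - xs\<bar> \<le> d \<Longrightarrow> \<bar>g c x\<bar> \<le> B"
      "\<And>x y. \<bar>x - xs\<bar> \<le> d \<Longrightarrow> \<bar>y - xs\<bar> \<le> d \<Longrightarrow> \<bar>g c x - g c y\<bar> \<le> B * \<bar>x - y\<bar>"
      "\<And>x u. \<bar>x - xs\<bar> + \<bar>u\<bar> \<le> d \<Longrightarrow> \<bar>g c (x + u) + g c (x - u) - 2 * g c x\<bar> \<le> B * u\<^sup>2"
      using g_bounds[of c] by blast
    \<comment> \<open>\<open>e\<close> secures the formula for the density, \<open>d\<close> the
      bounds on \<open>g\<close>, \<open>dh\<close> the Lipschitz bound on \<open>h\<close>; 1/2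
      keeps distances at most 1, where |y| <= sqrt |y|.\<close>
    define \<epsilon> where "\<epsilon> = Min {e, d, dh, 1 / 2}"
    have \<epsilon>: "\<epsilon> > 0" "\<epsilon> \<le> e" "\<epsilon> \<le> d" "\<epsilon> \<le> dh" "\<epsilon> \<le> 1 / 2"
      using e b h by (auto simp: \<epsilon>_def)
    have \<psi>g: "\<psi>0 s = (s - xs)\<^sup>2 * g c s" if "\<bar>s - xs\<bar> \<le> \<epsilon>" for s
    proof -
      have "s \<in> cball xs e"
        using that \<epsilon>(2) by (simp add: dist_real_def abs_minus_commute)
      then have "\<psi>0 s = c * (s - xs) ^ (2*k) * h s"
        using a(2) e(2) by (auto simp: c_def)
      then show ?thesis
        unfolding g_def k2[symmetric] by simp
    qed
    \<comment> \<open>\<open>\<delta>\<close> is \<open>\<epsilon> / 2\<close> because the Hoelder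
      condition reaches out to 2 \<open>\<delta>\<close>.\<close>
    obtain \<phi> B' where "vanishing_density \<mu>0 R \<tau> \<psi>0 \<phi> xs (\<epsilon> / 2) B'"
    proof (rule vanishing_densityI[where \<delta> = "\<epsilon> / 2" and \<epsilon> = \<epsilon> and xs = xs and g = "g c" and B = B,
          OF dens nonneg cont B\<psi>])
      show "\<bar>g c x - g c y\<bar> \<le> B * sqrt \<bar>x - y\<bar>" if "\<bar>x - xs\<bar> \<le> 2 * (\<epsilon> / 2)" "\<bar>y - xs\<bar> \<le> 2 * (\<epsilon> / 2)" for x y
      proof -
        have "\<bar>x - y\<bar> \<le> sqrt \<bar>x - y\<bar>"
          using that \<epsilon> by (intro abs_le_sqrt_abs) auto
        then show ?thesis
          using b(4)[of x y] that \<epsilon> mult_left_mono[OF _ b(2)] by (auto intro: order_trans)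
      qed
      show "\<bar>g c (x + u) + g c (x - u) - 2 * g c x\<bar> \<le> B * (u\<^sup>2 / (x - xs)\<^sup>2)"
        if "x \<noteq> xs" "\<bar>x - xs\<bar> \<le> \<epsilon> / 2" "\<bar>u\<bar> \<le> \<bar>x - xs\<bar> / 2" for x u
      proof -
        have "(x - xs)\<^sup>2 \<le> 1"
          using that \<epsilon> by (subst abs_square_le_1) auto
        then have "u\<^sup>2 \<le> u\<^sup>2 / (x - xs)\<^sup>2"
          using that(1) by (simp add: le_divide_eq mult_left_le)
        moreover have "\<bar>g c (x + u) + g c (x - u) - 2 * g c x\<bar> \<le> B * u\<^sup>2"
          using that \<epsilon> by (intro b(5)) argo
        ultimately show ?thesis
          using mult_left_mono[OF _ b(2)] by (meson order_trans)
      qed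
    qed (use \<epsilon> \<psi>g b(3) I(2) in \<open>auto simp: I_def\<close>)
    then interpret vd: vanishing_density \<mu>0 R \<tau> \<psi>0 \<phi> xs "\<epsilon> / 2" B' .
    have xt: "vd.xt = xt"
      unfolding vd.xt_def xt_def vd.G0_eq ..
    have ct': "c0 / vd.a = ct"
      unfolding ct vd.a_def vd.A_eq I_def ..
    have hl: "\<bar>h x - 1\<bar> \<le> L * \<bar>x - xs\<bar>" if "\<bar>x - xs\<bar> < \<epsilon> / 2" for x
      using that \<epsilon> by (intro h_lip) auto
    have \<psi>: "\<psi>0 x = c0 ^ (2*k+1) * (x - xs) ^ (2*k) * h x" if "\<bar>x - xs\<bar> < \<epsilon> / 2" for x
      using \<psi>g[of x] that k2[of x] \<epsilon>(1) by (simp add: g_def c_def mult_ac)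
    show ?thesis
      using vd.even_order_zero[of c0 L h k, OF c0 h(2) hl \<psi>] unfolding xt ct' conv by blast
  qed

  have case_b: "xt \<in> msupp \<mu>\<tau> \<and> (\<exists>\<delta>>0. {xt<..<xt+\<delta>} \<inter> msupp \<mu>\<tau> = {}) \<and>
      (\<lambda>s. p s / (ct powr (2*real k + 3/2) * (xt - s) powr (2*real k + 1/2)) - 1)
        \<in> O[at_left xt](\<lambda>s. sqrt (xt - s)) \<and>
      (\<exists>\<epsilon>>0. \<forall>s\<in>{xt..xt+\<epsilon>}. p s = 0)"
    if e: "e > 0" "\<forall>s\<in>{xs-e..xs}. \<psi>0 s = c0 powr (2*real k + 3/2) * (xs - s) powr (2*real k + 1/2) * h s"
      "\<forall>s\<in>{xs..xs+e}. \<psi>0 s = 0" for e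
  proof -
    define c where "c = c0 powr (2 * real k + 3 / 2)"
    obtain d B where b: "d > 0" "B \<ge> 0" "\<And>x. \<bar>x - xs\<bar> \<le> d \<Longrightarrow> \<bar>g c x\<bar> \<le> B"
      "\<And>x y. \<bar>x - xs\<bar> \<le> d \<Longrightarrow> \<bar>y - xs\<bar> \<le> d \<Longrightarrow> \<bar>g c x - g c y\<bar> \<le> B * \<bar>x - y\<bar>"
      "\<And>x u. \<bar>x - xs\<bar> + \<bar>u\<bar> \<le> d \<Longrightarrow> \<bar>g c (x + u) + g c (x - u) - 2 * g c x\<bar> \<le> B * u\<^sup>2"
      using g_bounds[of c] by blast
    define \<epsilon> where "\<epsilon> = Min {e, d, dh, 1 / 2}"
    have \<epsilon>: "\<epsilon> > 0" "\<epsilon> \<le> e" "\<epsilon> \<le> d" "\<epsilon> \<le> dh" "\<epsilon> \<le> 1 / 2"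
      using e b h by (auto simp: \<epsilon>_def)
    \<comment> \<open>The \<open>max\<close> encodes the vanishing of the density to the right of
      \<open>xs\<close>, so one formula holds on both sides.\<close>
    define f where "f s = sqrt (max 0 (xs - s)) * g c s" for s
    have "\<bar>g c (x + u) + g c (x - u) - 2 * g c x\<bar> \<le> B * u\<^sup>2" if "\<bar>x - xs\<bar> + \<bar>u\<bar> \<le> \<epsilon>" for x u
      using that \<epsilon> by (intro b(5)) auto
    note f_bounds = square_root_cusp_bounds[of \<epsilon> B xs "g c", OF \<epsilon>(1,5) b(2) b(3) b(4) this, folded f_def]
    have \<psi>f: "\<psi>0 s = (s - xs)\<^sup>2 * f s" if s: "\<bar>s - xs\<bar> \<le> \<epsilon>" for s
    proof (cases "s < xs")
      case True
      then have "s \<in> {xs-e..xs}"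
        using s \<epsilon>(2) by auto
      then have "\<psi>0 s = c * (xs - s) powr (2*real k + 1/2) * h s"
        using e(2) by (simp add: c_def)
      also have "(xs - s) powr (2*real k + 1/2) = (s - xs) ^ (2 * k) * sqrt (xs - s)"
      proof -
        have "(xs - s) powr (2*real k + 1/2) = (xs - s) powr real (2 * k) * (xs - s) powr (1 / 2)"
          by (simp add: powr_add)
        also have "(xs - s) powr real (2 * k) = (s - xs) ^ (2 * k)"
          using True by (subst powr_realpow) (auto simp: power_mult power2_commute)
        finally show ?thesis
          using True by (simp add: powr_half_sqrt)
      qed
      finally show ?thesis
        using True unfolding f_def g_def k2[symmetric] by simp
    next
      case False
      then have "s \<in> {xs..xs+e}"
        using s \<epsilon>(2) by auto
      then show ?thesis
        using e(3) False by (simp add: f_def)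
    qed
    \<comment> \<open>The cusp bounds come with the constants B, 2 B and 4 B; the largest one serves
      for all three.\<close>
    obtain \<phi> B' where "vanishing_density \<mu>0 R \<tau> \<psi>0 \<phi> xs (\<epsilon> / 2) B'"
    proof (rule vanishing_densityI[where \<delta> = "\<epsilon> / 2" and \<epsilon> = \<epsilon> and xs = xs and g = f and B = "4 * B",
          OF dens nonneg cont B\<psi>])
      show "\<bar>f s\<bar> \<le> 4 * B" if "\<bar>s - xs\<bar> \<le> \<epsilon>" for s
        using f_bounds(1)[of s] that \<epsilon> b(2) by auto
      show "\<bar>f x - f y\<bar> \<le> 4 * B * sqrt \<bar>x - y\<bar>" if xy: "\<bar>x - xs\<bar> \<le> 2 * (\<epsilon> / 2)" "\<bar>y - xs\<bar> \<le> 2 * (\<epsilon> / 2)" for x y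
      proof -
        have "\<bar>f x - f y\<bar> \<le> 2 * B * sqrt \<bar>x - y\<bar>"
          using f_bounds(2)[of x y] xy \<epsilon> by auto
        also have "\<dots> \<le> 4 * B * sqrt \<bar>x - y\<bar>"
          using b(2) by (intro mult_right_mono) auto
        finally show ?thesis .
      qed
      show "\<bar>f (x + u) + f (x - u) - 2 * f x\<bar> \<le> 4 * B * (u\<^sup>2 / (x - xs)\<^sup>2)"
        if "x \<noteq> xs" "\<bar>x - xs\<bar> \<le> \<epsilon> / 2" "\<bar>u\<bar> \<le> \<bar>x - xs\<bar> / 2" for x u
        using f_bounds(3)[of x u] that \<epsilon> by auto
    qed (use \<epsilon> \<psi>f I(2) in \<open>auto simp: I_def\<close>)
    then interpret vd: vanishing_density \<mu>0 R \<tau> \<psi>0 \<phi> xs "\<epsilon> / 2" B' .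
    have xt: "vd.xt = xt"
      unfolding vd.xt_def xt_def vd.G0_eq ..
    have ct': "c0 / vd.a = ct"
      unfolding ct vd.a_def vd.A_eq I_def ..
    have hl: "\<bar>h x - 1\<bar> \<le> L * \<bar>x - xs\<bar>" if "\<bar>x - xs\<bar> < \<epsilon> / 2" for x
      using that \<epsilon> by (intro h_lip) auto
    have r: "2 * real k + 1 / 2 + 1 = 2 * real k + 3 / 2"
      by simp
    have left: "\<psi>0 x = c0 powr (2 * real k + 1 / 2 + 1) * (xs - x) powr (2 * real k + 1 / 2) * h x"
      if "\<bar>x - xs\<bar> < \<epsilon> / 2" "x \<le> xs" for x
      unfolding r using e(2) that \<epsilon>(1,2) by auto
    have right: "\<psi>0 x = 0" if "\<bar>x - xs\<bar> < \<epsilon> / 2" "x \<ge> xs" for x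
      using e(3) that \<epsilon>(1,2) by auto
    show ?thesis
      using vd.right_edge_zero[of c0 L h "2 * real k + 1 / 2", OF c0 h(2) hl left right]
      unfolding xt ct' conv r by blast
  qed
  show ?thesis
    using case_a case_b continuous_p p_nonneg conv unfolding \<rho>_def by (intro exI[of _ p] conjI) auto
qed

end
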